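(* Let $X$ be a finite aspherical cell complex with fundamental group $\pi$. Suppose that for some $\mathcal O_{\mathcal D}$-module $\underline M$, with principal component $M=\underline M(G/1)$, there exists a Bredon cohomology class $\underline\alpha\in H^n_{\mathcal D}(\pi\times\pi,\underline M)$ such that the class $\Phi(\underline\alpha)\in H^n(\pi\times\pi,M)$ is nonzero. Then $\mathsf{TC}(X)\ge n$.
   Context: A connected cell complex $X$ is aspherical if $\pi_i(X)=0$ for all $i>1$. (Reduced) topological complexity: for a path-connected space $X$, $\mathsf{TC}(X)$ is the minimal integer $k\ge 0$ such that $X\times X$ can be covered by $k+1$ open subsets $U_0,\dots,U_k$ over each of which the path fibration $p:X^I\to X\times X$, $p(\gamma)=(\gamma(0),\gamma(1))$, has a continuous section ($\mathsf{TC}(X)=\infty$ if no such $k$ exists). Here $X^I$ is the space of continuous paths $[0,1]\to X$ with the compact-open topology. Let $G=\pi\times\pi$. $\mathcal D$ is the smallest set of subgroups of $G$ which contains the trivial subgroup and the diagonal $\Delta=\{(a,a):a\in\pi\}$ and is closed under conjugation and finite intersections. The orbit category $\mathcal O_{\mathcal D}$ has objects $G/H$, $H\in\mathcal D$, and $G$-equivariant maps as morphisms. An $\mathcal O_{\mathcal D}$-module is a contravariant functor from $\mathcal O_{\mathcal D}$ to abelian groups. Its principal component is $M=\underline M(G/1)$, a left $\mathbb Z[G]$-module on which $a\in G$ acts by $\underline M(r_a)$, $r_a:G\to G$, $r_a(g)=ga$. $\underline{\mathbb Z}$ is the constant module. For a $G$-CW-complex $Y$ with isotropy subgroups in $\mathcal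 D$, $\underline C_*(Y)$ is the chain complex of $\mathcal O_{\mathcal D}$-modules $G/H\mapsto C_*(Y^H)$ (cellular chains), and $H^*_{\mathcal D}(Y;\underline M)=H^*(\mathrm{Hom}_{\mathcal O_{\mathcal D}}(\underline C_*(Y),\underline M))$. If $G$ acts freely on $Y$, restriction to principal components gives $H^*_{\mathcal D}(Y;\underline M)\cong H^*(\mathrm{Hom}_{\mathbb Z[G]}(C_*(Y),M))=H^*(Y/G;M)$. Let $E(\pi)=\pi*\pi*\cdots$ be the infinite join of copies of the discrete space $\pi$ with $G$-action induced by $(x,y)\cdot g=xgy^{-1}$; it is a model for the classifying space $E_{\mathcal D}(G)$. Put $H^*_{\mathcal D}(\pi\times\pi,\underline M)=H^*_{\mathcal D}(E(\pi);\underline M)$, which equals $\mathrm{Ext}^*_{\mathcal O_{\mathcal D}}(\underline{\mathbb Z},\underline M)$. Let $E(\pi\times\pi)$ be the infinite join of copies of $\pi\times\pi$ with left translation action (a contractible free $G$-complex), and let $F:E(\pi\times\pi)\to E(\pi)$ be the $G$-map (unique up to $G$-homotopy) induced by $(x,y)\mapsto xy^{-1}$. Then $\Phi:H^n_{\mathcal D}(\pi\times\pi,\underline M)\to H^n(\pi\times\pi,M)$ is the homomorphism $F^*:H^n_{\mathcal D}(E(\pi);\underline M)\to H^n_{\mathcal D}(E(\pi\times\pi);\underline M)=H^n(\pi\times\pi,M)$. Algebraically: if $\underline P_*$ is a projective $\mathcal O_{\mathcal D}$-resolution of $\underline{\mathbb Z}$ and $Q_*$ a projective $\mathbb Z[G]$-resolution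 of $\mathbb Z$, $\Phi$ is induced by $\mathrm{Hom}_{\mathcal O_{\mathcal D}}(\underline P_*,\underline M)\to\mathrm{Hom}_{\mathbb Z[G]}(\underline P_*(G/1),M)\to\mathrm{Hom}_{\mathbb Z[G]}(Q_*,M)$, the second map coming from a chain map $Q_*\to\underline P_*(G/1)$ over $\mathrm{id}_{\mathbb Z}$. *)

theory Defs
  imports "HOL-Homology.Homology" "HOL-Algebra.Left_Coset" "HOL-Library.Extended_Nat"
begin

section \<open>Finite cell complexes\<close>

definition disc :: "nat \<Rightarrow> (nat \<Rightarrow> real) topology" where
  "disc d = subtopology (Euclidean_space d) {x. (\<Sum>i<d. (x i)\<^sup>2) \<le> 1}"

definition disc_interior :: "nat \<Rightarrow> (nat \<Rightarrow> real) set" where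
  "disc_interior d = {x \<in> topspace (disc d). (\<Sum>i<d. (x i)\<^sup>2) < 1}"

definition disc_boundary :: "nat \<Rightarrow> (nat \<Rightarrow> real) set" where
  "disc_boundary d = {x \<in> topspace (disc d). (\<Sum>i<d. (x i)\<^sup>2) = 1}"

text \<open>
  A finite CW structure, given by its cells: a pair \<open>(d, \<phi>)\<close> is a cell of dimension \<open>d\<close>
  with characteristic map \<open>\<phi>\<close>.  Closure finiteness and the weak topology
  are automatic because there are only finitely many cells.
\<close>

definition finite_cell_structure ::
    "'a topology \<Rightarrow> (nat \<times> ((nat \<Rightarrow> real) \<Rightarrow> 'a)) set \<Rightarrow> bool" where
  "finite_cell_structure X K \<longleftrightarrow>
     finite K \<and>
     (\<forall>(d, \<phi>) \<in> K.
        continuous_map (disc d) X \<phi> \<and>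
        homeomorphic_map (subtopology (disc d) (disc_interior d))
                         (subtopology X (\<phi> ` disc_interior d)) \<phi> \<and>
        \<phi> ` disc_boundary d \<subseteq> (\<Union>(d', \<phi>') \<in> {c \<in> K. fst c < d}. \<phi>' ` disc_interior d')) \<and>
     pairwise (\<lambda>(d, \<phi>) (d', \<phi>'). disjnt (\<phi> ` disc_interior d) (\<phi>' ` disc_interior d')) K \<and>
     (\<Union>(d, \<phi>) \<in> K. \<phi> ` disc_interior d) = topspace X"

definition finite_cell_complex :: "'a topology \<Rightarrow> bool" where
  "finite_cell_complex X \<longleftrightarrow> Hausdorff_space X \<and> (\<exists>K. finite_cell_structure X K)"


section \<open>Homotopy groups and asphericity\<close>

definition unit_cube :: "nat \<Rightarrow> (nat \<Rightarrow> real) topology" where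
  "unit_cube n = subtopology (Euclidean_space n) {x. \<forall>i<n. 0 \<le> x i \<and> x i \<le> 1}"

definition cube_boundary :: "nat \<Rightarrow> (nat \<Rightarrow> real) set" where
  "cube_boundary n = {x \<in> topspace (unit_cube n). \<exists>i<n. x i = 0 \<or> x i = 1}"

definition spheroids :: "nat \<Rightarrow> 'a topology \<Rightarrow> 'a \<Rightarrow> ((nat \<Rightarrow> real) \<Rightarrow> 'a) set" where
  "spheroids n X x0 = {f. continuous_map (unit_cube n) X f \<and> f ` cube_boundary n \<subseteq> {x0}}"

definition spheroid_class ::
    "nat \<Rightarrow> 'a topology \<Rightarrow> 'a \<Rightarrow> ((nat \<Rightarrow> real) \<Rightarrow> 'a) \<Rightarrow> ((nat \<Rightarrow> real) \<Rightarrow> 'a) set" where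
  "spheroid_class n X x0 f =
     {g. homotopic_with (\<lambda>h. h ` cube_boundary n \<subseteq> {x0}) (unit_cube n) X f g}"

definition spheroid_concat ::
    "((nat \<Rightarrow> real) \<Rightarrow> 'a) \<Rightarrow> ((nat \<Rightarrow> real) \<Rightarrow> 'a) \<Rightarrow> (nat \<Rightarrow> real) \<Rightarrow> 'a" where
  "spheroid_concat f g =
     (\<lambda>x. if x 0 \<le> 1/2 then f (x(0 := 2 * x 0)) else g (x(0 := 2 * x 0 - 1)))"

text \<open>
  \<open>\<pi>\<^sub>n(X, x\<^sub>0)\<close>, meant for \<open>n \<ge> 1\<close>; the fundamental group is the case \<open>n = 1\<close>.  The union in the
  product ranges over representatives, all of which yield the same class.
\<close>

definition homotopy_group ::
    "nat \<Rightarrow> 'a topology \<Rightarrow> 'a \<Rightarrow> ((nat \<Rightarrow> real) \<Rightarrow> 'a) set monoid" where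
  "homotopy_group n X x0 =
     \<lparr>carrier = spheroid_class n X x0 ` spheroids n X x0,
      monoid.mult = (\<lambda>A B. \<Union>f\<in>A. \<Union>g\<in>B. spheroid_class n X x0 (spheroid_concat f g)),
      one = spheroid_class n X x0 (\<lambda>_. x0)\<rparr>"

definition aspherical :: "'a topology \<Rightarrow> bool" where
  "aspherical X \<longleftrightarrow>
     connected_space X \<and> (\<forall>x \<in> topspace X. \<forall>i>1. trivial_group (homotopy_group i X x))"


section \<open>Topological complexity\<close>

text \<open>
  \<open>X\<^sup>I\<close> with the compact-open topology.  Paths are taken to be \<open>undefined\<close> outside
  \<open>[0,1]\<close>, so that every path is represented by exactly one function.
\<close>

definition path_set :: "'a topology \<Rightarrow> (real \<Rightarrow> 'a) set" where
  "path_set X = {\<gamma> \<in> extensional {0..1}. pathin X \<gamma>}"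

definition path_space :: "'a topology \<Rightarrow> (real \<Rightarrow> 'a) topology" where
  "path_space X = topology_generated_by
     {{\<gamma> \<in> path_set X. \<gamma> ` C \<subseteq> V} | C V. compact C \<and> C \<subseteq> {0..1} \<and> openin X V}"

definition has_path_section :: "'a topology \<Rightarrow> ('a \<times> 'a) set \<Rightarrow> bool" where
  "has_path_section X U \<longleftrightarrow>
     (\<exists>s. continuous_map (subtopology (prod_topology X X) U) (path_space X) s \<and>
          (\<forall>(x, y) \<in> U. s (x, y) 0 = x \<and> s (x, y) 1 = y))"

definition TC :: "'a topology \<Rightarrow> enat" where
  "TC X = Inf {enat k | k.
     \<exists>U :: nat \<Rightarrow> ('a \<times> 'a) set.
       (\<forall>i\<le>k. openin (prod_topology X X) (U i) \<and> has_path_section X (U i)) \<and>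
       (\<Union>i\<le>k. U i) = topspace (prod_topology X X)}"


section \<open>Modules over an orbit category\<close>

definition diagonal_subgroup :: "('p, 'b) monoid_scheme \<Rightarrow> ('p \<times> 'p) set" where
  "diagonal_subgroup P = {(a, a) | a. a \<in> carrier P}"

text \<open>
  Finite intersections are those of nonempty finite families, so that \<open>G\<close> itself is not adjoined
  as the empty intersection.
\<close>

inductive_set diagonal_family :: "('p, 'b) monoid_scheme \<Rightarrow> ('p \<times> 'p) set set"
  for P :: "('p, 'b) monoid_scheme" where
  trivial: "{\<one>\<^bsub>P \<times>\<times> P\<^esub>} \<in> diagonal_family P"
| diagonal: "diagonal_subgroup P \<in> diagonal_family P"
| conjugate: "\<lbrakk>H \<in> diagonal_family P; g \<in> carrier (P \<times>\<times> P)\<rbrakk> \<Longrightarrow>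
    g <#\<^bsub>P \<times>\<times> P\<^esub> H #>\<^bsub>P \<times>\<times> P\<^esub> inv\<^bsub>P \<times>\<times> P\<^esub> g \<in> diagonal_family P"
| inter: "\<lbrakk>H \<in> diagonal_family P; K \<in> diagonal_family P\<rbrakk> \<Longrightarrow> H \<inter> K \<in> diagonal_family P"

text \<open>
  The orbit category of a family \<open>D\<close> of subgroups of \<open>G\<close>: its objects \<open>G/H\<close> are represented by the
  subgroups \<open>H \<in> D\<close>, its morphisms are the \<open>G\<close>-maps between the sets of left cosets.
\<close>

definition orbit_maps ::
    "('g, 'b) monoid_scheme \<Rightarrow> 'g set \<Rightarrow> 'g set \<Rightarrow> ('g set \<Rightarrow> 'g set) set" where
  "orbit_maps G H K =
     {f \<in> lcosets\<^bsub>G\<^esub> H \<rightarrow>\<^sub>E lcosets\<^bsub>G\<^esub> K.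
        \<forall>g \<in> carrier G. \<forall>c \<in> lcosets\<^bsub>G\<^esub> H. f (g <#\<^bsub>G\<^esub> c) = g <#\<^bsub>G\<^esub> f c}"

text \<open>
  \<open>module_at M H\<close> is the (multiplicatively written) abelian group \<open>M(G/H)\<close>, and
  \<open>module_map M H K f\<close> is the homomorphism \<open>M(G/K) \<rightarrow> M(G/H)\<close> induced by
  \<open>f : G/H \<rightarrow> G/K\<close>.
\<close>

record ('g, 'm) orbit_functor =
  module_at :: "'g set \<Rightarrow> 'm monoid"
  module_map :: "'g set \<Rightarrow> 'g set \<Rightarrow> ('g set \<Rightarrow> 'g set) \<Rightarrow> 'm \<Rightarrow> 'm"

definition orbit_module ::
    "('g, 'b) monoid_scheme \<Rightarrow> 'g set set \<Rightarrow> ('g, 'm) orbit_functor \<Rightarrow> bool" where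
  "orbit_module G D M \<longleftrightarrow>
     (\<forall>H \<in> D. comm_group (module_at M H)) \<and>
     (\<forall>H \<in> D. \<forall>K \<in> D. \<forall>f \<in> orbit_maps G H K.
        module_map M H K f \<in> hom (module_at M K) (module_at M H)) \<and>
     (\<forall>H \<in> D. \<forall>m \<in> carrier (module_at M H).
        module_map M H H (\<lambda>c \<in> lcosets\<^bsub>G\<^esub> H. c) m = m) \<and>
     (\<forall>H \<in> D. \<forall>K \<in> D. \<forall>L \<in> D. \<forall>f \<in> orbit_maps G H K. \<forall>f' \<in> orbit_maps G K L.
        \<forall>m \<in> carrier (module_at M L).
          module_map M H L (compose (lcosets\<^bsub>G\<^esub> H) f' f) m =
          module_map M H K f (module_map M K L f' m))"

text \<open>
  The group of natural transformations \<open>N \<rightarrow> M\<close>.  All functions are \<open>undefined\<close> outside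
  the relevant domains, so that equality of natural transformations is equality in HOL.
\<close>

definition orbit_hom ::
    "('g, 'b) monoid_scheme \<Rightarrow> 'g set set \<Rightarrow> ('g, 'c) orbit_functor \<Rightarrow> ('g, 'm) orbit_functor
      \<Rightarrow> ('g set \<Rightarrow> 'c \<Rightarrow> 'm) monoid" where
  "orbit_hom G D N M =
     \<lparr>carrier =
        {\<phi> \<in> (\<Pi>\<^sub>E H \<in> D. hom (module_at N H) (module_at M H) \<inter> extensional (carrier (module_at N H))).
           \<forall>H \<in> D. \<forall>K \<in> D. \<forall>f \<in> orbit_maps G H K. \<forall>c \<in> carrier (module_at N K).
             \<phi> H (module_map N H K f c) = module_map M H K f (\<phi> K c)},
      monoid.mult = (\<lambda>\<phi> \<psi>. \<lambda>H \<in> D. \<lambda>c \<in> carrier (module_at N H). \<phi> H c \<otimes>\<^bsub>module_at M H\<^esub> \<psi> H c),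
      one = (\<lambda>H \<in> D. \<lambda>c \<in> carrier (module_at N H). \<one>\<^bsub>module_at M H\<^esub>)\<rparr>"

text \<open>
  The left action of \<open>a \<in> G\<close> on the principal component \<open>M(G/1)\<close>: it is induced by the
  right translation \<open>g \<mapsto> g a\<close>, a \<open>G\<close>-map \<open>G/1 \<rightarrow> G/1\<close>.
\<close>

definition principal_component :: "('g, 'b) monoid_scheme \<Rightarrow> ('g, 'm) orbit_functor \<Rightarrow> 'm monoid" where
  "principal_component G M = module_at M {\<one>\<^bsub>G\<^esub>}"

definition principal_action ::
    "('g, 'b) monoid_scheme \<Rightarrow> ('g, 'm) orbit_functor \<Rightarrow> 'g \<Rightarrow> 'm \<Rightarrow> 'm" where
  "principal_action G M a =
     module_map M {\<one>\<^bsub>G\<^esub>} {\<one>\<^bsub>G\<^esub>} (\<lambda>c \<in> lcosets\<^bsub>G\<^esub> {\<one>\<^bsub>G\<^esub>}. c #>\<^bsub>G\<^esub> a)"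


section \<open>Chains of infinite joins\<close>

text \<open>
  The infinite join \<open>S * S * \<dots>\<close> of a discrete set \<open>S\<close> is the simplicial complex with vertex set
  \<open>\<nat> \<times> S\<close> in which a simplex is a nonempty finite set of vertices lying in pairwise different
  copies of \<open>S\<close>.  We write an \<open>n\<close>-simplex as the list of its \<open>n + 1\<close> vertices, ordered (and
  thereby oriented) by the index of the copy.  A group acting on \<open>S\<close> acts on each copy;
  an element mapping a simplex to itself fixes it pointwise, so the join is a \<open>G\<close>-CW complex, the
  fixed points of \<open>H\<close> form the infinite join of the fixed set of \<open>H\<close> in \<open>S\<close>, and the cellular
  chains are the free abelian groups on the simplices.
\<close>

definition join_simplices :: "'s set \<Rightarrow> nat \<Rightarrow> (nat \<times> 's) list set" where
  "join_simplices S n =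
     {\<sigma>. length \<sigma> = Suc n \<and> sorted_wrt (<) (map fst \<sigma>) \<and> snd ` set \<sigma> \<subseteq> S}"

definition join_chain_group :: "'s set \<Rightarrow> nat \<Rightarrow> ((nat \<times> 's) list \<Rightarrow>\<^sub>0 int) monoid" where
  "join_chain_group S n = free_Abelian_group (join_simplices S n)"

text \<open>The boundary of chains in degree \<open>n \<ge> 1\<close>.\<close>

definition join_boundary :: "nat \<Rightarrow> ((nat \<times> 's) list \<Rightarrow>\<^sub>0 int) \<Rightarrow> ((nat \<times> 's) list \<Rightarrow>\<^sub>0 int)" where
  "join_boundary n =
     frag_extend (\<lambda>\<sigma>. \<Sum>i\<le>n. frag_cmul ((-1) ^ i) (frag_of (take i \<sigma> @ drop (Suc i) \<sigma>)))"

definition join_map :: "('s \<Rightarrow> 't) \<Rightarrow> ((nat \<times> 's) list \<Rightarrow>\<^sub>0 int) \<Rightarrow> ((nat \<times> 't) list \<Rightarrow>\<^sub>0 int)" where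
  "join_map u = frag_extend (\<lambda>\<sigma>. frag_of (map (map_prod id u) \<sigma>))"

definition fixed_points :: "('g \<Rightarrow> 's \<Rightarrow> 's) \<Rightarrow> 's set \<Rightarrow> 'g set \<Rightarrow> 's set" where
  "fixed_points act S H = {s \<in> S. \<forall>h \<in> H. act h s = s}"

text \<open>
  The functor \<open>G/H \<mapsto> C\<^sub>n(Y\<^sup>H)\<close>, where \<open>Y\<close> is the infinite join of the \<open>G\<close>-set \<open>S\<close>.
  A \<open>G\<close>-map \<open>f : G/H \<rightarrow> G/K\<close> with \<open>f(H) = aK\<close> induces \<open>Y\<^sup>K \<rightarrow> Y\<^sup>H\<close>, \<open>y \<mapsto> a y\<close>, which does not depend
  on the choice of \<open>a\<close> in the coset \<open>f(H)\<close>.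
\<close>

definition join_chains ::
    "('g \<Rightarrow> 's \<Rightarrow> 's) \<Rightarrow> 's set \<Rightarrow> nat \<Rightarrow> ('g, (nat \<times> 's) list \<Rightarrow>\<^sub>0 int) orbit_functor" where
  "join_chains act S n =
     \<lparr>module_at = (\<lambda>H. join_chain_group (fixed_points act S H) n),
      module_map = (\<lambda>H K f. join_map (act (SOME a. a \<in> f H)))\<rparr>"


section \<open>Bredon cohomology and group cohomology\<close>

definition cocycles :: "(nat \<Rightarrow> 'c monoid) \<Rightarrow> (nat \<Rightarrow> 'c \<Rightarrow> 'c) \<Rightarrow> nat \<Rightarrow> 'c set" where
  "cocycles C \<delta> n = kernel (C n) (C (Suc n)) (\<delta> n)"

definition coboundaries :: "(nat \<Rightarrow> 'c monoid) \<Rightarrow> (nat \<Rightarrow> 'c \<Rightarrow> 'c) \<Rightarrow> nat \<Rightarrow> 'c set" where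
  "coboundaries C \<delta> n = (case n of 0 \<Rightarrow> {\<one>\<^bsub>C 0\<^esub>} | Suc k \<Rightarrow> \<delta> k ` carrier (C k))"

definition cohomology_group ::
    "(nat \<Rightarrow> 'c monoid) \<Rightarrow> (nat \<Rightarrow> 'c \<Rightarrow> 'c) \<Rightarrow> nat \<Rightarrow> 'c set monoid" where
  "cohomology_group C \<delta> n = (C n)\<lparr>carrier := cocycles C \<delta> n\<rparr> Mod coboundaries C \<delta> n"

text \<open>Bredon cochains and cohomology of the infinite join of a \<open>G\<close>-set \<open>S\<close>.\<close>

definition bredon_cochains ::
    "('g, 'b) monoid_scheme \<Rightarrow> 'g set set \<Rightarrow> ('g \<Rightarrow> 's \<Rightarrow> 's) \<Rightarrow> 's set \<Rightarrow> ('g, 'm) orbit_functor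
      \<Rightarrow> nat \<Rightarrow> ('g set \<Rightarrow> ((nat \<times> 's) list \<Rightarrow>\<^sub>0 int) \<Rightarrow> 'm) monoid" where
  "bredon_cochains G D act S M n = orbit_hom G D (join_chains act S n) M"

definition bredon_coboundary ::
    "'g set set \<Rightarrow> ('g \<Rightarrow> 's \<Rightarrow> 's) \<Rightarrow> 's set \<Rightarrow> nat
      \<Rightarrow> ('g set \<Rightarrow> ((nat \<times> 's) list \<Rightarrow>\<^sub>0 int) \<Rightarrow> 'm)
      \<Rightarrow> ('g set \<Rightarrow> ((nat \<times> 's) list \<Rightarrow>\<^sub>0 int) \<Rightarrow> 'm)" where
  "bredon_coboundary D act S n \<phi> =
     (\<lambda>H \<in> D. \<lambda>c \<in> carrier (module_at (join_chains act S (Suc n)) H). \<phi> H (join_boundary (Suc n) c))"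

definition bredon_cohomology ::
    "('g, 'b) monoid_scheme \<Rightarrow> 'g set set \<Rightarrow> ('g \<Rightarrow> 's \<Rightarrow> 's) \<Rightarrow> 's set \<Rightarrow> ('g, 'm) orbit_functor
      \<Rightarrow> nat \<Rightarrow> ('g set \<Rightarrow> ((nat \<times> 's) list \<Rightarrow>\<^sub>0 int) \<Rightarrow> 'm) set monoid" where
  "bredon_cohomology G D act S M =
     cohomology_group (bredon_cochains G D act S M) (bredon_coboundary D act S)"

text \<open>
  The cohomology of \<open>G\<close> with coefficients in the left \<open>\<int>[G]\<close>-module given by an abelian group \<open>A\<close> and
  an action \<open>act\<close> of \<open>G\<close> on it, computed from the infinite join \<open>E(G)\<close> of copies of \<open>G\<close> with
  the left translation action.  The cochains are the \<open>\<int>[G]\<close>-linear maps, i.e. the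
  \<open>G\<close>-equivariant homomorphisms, \<open>C\<^sub>n(E(G)) \<rightarrow> A\<close>.
\<close>

definition group_cochains ::
    "('g, 'b) monoid_scheme \<Rightarrow> 'm monoid \<Rightarrow> ('g \<Rightarrow> 'm \<Rightarrow> 'm)
      \<Rightarrow> nat \<Rightarrow> (((nat \<times> 'g) list \<Rightarrow>\<^sub>0 int) \<Rightarrow> 'm) monoid" where
  "group_cochains G A act n =
     \<lparr>carrier =
        {\<phi> \<in> hom (join_chain_group (carrier G) n) A \<inter> extensional (carrier (join_chain_group (carrier G) n)).
           \<forall>g \<in> carrier G. \<forall>c \<in> carrier (join_chain_group (carrier G) n).
             \<phi> (join_map (\<lambda>x. g \<otimes>\<^bsub>G\<^esub> x) c) = act g (\<phi> c)},
      monoid.mult = (\<lambda>\<phi> \<psi>. \<lambda>c \<in> carrier (join_chain_group (carrier G) n). \<phi> c \<otimes>\<^bsub>A\<^esub> \<psi> c),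
      one = (\<lambda>c \<in> carrier (join_chain_group (carrier G) n). \<one>\<^bsub>A\<^esub>)\<rparr>"

definition group_coboundary ::
    "('g, 'b) monoid_scheme \<Rightarrow> nat
      \<Rightarrow> (((nat \<times> 'g) list \<Rightarrow>\<^sub>0 int) \<Rightarrow> 'm) \<Rightarrow> (((nat \<times> 'g) list \<Rightarrow>\<^sub>0 int) \<Rightarrow> 'm)" where
  "group_coboundary G n \<phi> =
     (\<lambda>c \<in> carrier (join_chain_group (carrier G) (Suc n)). \<phi> (join_boundary (Suc n) c))"

definition group_cohomology ::
    "('g, 'b) monoid_scheme \<Rightarrow> 'm monoid \<Rightarrow> ('g \<Rightarrow> 'm \<Rightarrow> 'm)
      \<Rightarrow> nat \<Rightarrow> (((nat \<times> 'g) list \<Rightarrow>\<^sub>0 int) \<Rightarrow> 'm) set monoid" where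
  "group_cohomology G A act = cohomology_group (group_cochains G A act) (group_coboundary G)"


section \<open>The homomorphism \<open>\<Phi>\<close>\<close>

definition two_sided_action :: "('p, 'b) monoid_scheme \<Rightarrow> 'p \<times> 'p \<Rightarrow> 'p \<Rightarrow> 'p" where
  "two_sided_action P = (\<lambda>(x, y) g. x \<otimes>\<^bsub>P\<^esub> g \<otimes>\<^bsub>P\<^esub> inv\<^bsub>P\<^esub> y)"

text \<open>\<open>H\<^sup>n\<^sub>D(\<pi> \<times> \<pi>, M)\<close>, the Bredon cohomology of \<open>E(\<pi>)\<close>.\<close>

definition bredon_HD ::
    "('p, 'b) monoid_scheme \<Rightarrow> ('p \<times> 'p, 'm) orbit_functor
      \<Rightarrow> nat \<Rightarrow> (('p \<times> 'p) set \<Rightarrow> ((nat \<times> 'p) list \<Rightarrow>\<^sub>0 int) \<Rightarrow> 'm) set monoid" where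
  "bredon_HD P M =
     bredon_cohomology (P \<times>\<times> P) (diagonal_family P) (two_sided_action P) (carrier P) M"

text \<open>\<open>H\<^sup>n(\<pi> \<times> \<pi>, M)\<close>, with coefficients in the principal component of the functor.\<close>

definition principal_cochains ::
    "('p, 'b) monoid_scheme \<Rightarrow> ('p \<times> 'p, 'm) orbit_functor
      \<Rightarrow> nat \<Rightarrow> (((nat \<times> 'p \<times> 'p) list \<Rightarrow>\<^sub>0 int) \<Rightarrow> 'm) monoid" where
  "principal_cochains P M =
     group_cochains (P \<times>\<times> P) (principal_component (P \<times>\<times> P) M) (principal_action (P \<times>\<times> P) M)"

definition principal_cohomology ::
    "('p, 'b) monoid_scheme \<Rightarrow> ('p \<times> 'p, 'm) orbit_functor
      \<Rightarrow> nat \<Rightarrow> (((nat \<times> 'p \<times> 'p) list \<Rightarrow>\<^sub>0 int) \<Rightarrow> 'm) set monoid" where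
  "principal_cohomology P M =
     group_cohomology (P \<times>\<times> P) (principal_component (P \<times>\<times> P) M) (principal_action (P \<times>\<times> P) M)"

text \<open>
  Restriction of a Bredon cochain to the principal component, followed by pulling back
  along the equivariant simplicial map \<open>F : E(\<pi> \<times> \<pi>) \<rightarrow> E(\<pi>)\<close> induced by
  \<open>(x, y) \<mapsto> x y\<^sup>-\<^sup>1\<close>.
\<close>

definition Phi_cochain ::
    "('p, 'b) monoid_scheme \<Rightarrow> nat \<Rightarrow> (('p \<times> 'p) set \<Rightarrow> ((nat \<times> 'p) list \<Rightarrow>\<^sub>0 int) \<Rightarrow> 'm)
      \<Rightarrow> ((nat \<times> 'p \<times> 'p) list \<Rightarrow>\<^sub>0 int) \<Rightarrow> 'm" where
  "Phi_cochain P n \<phi> =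
     (\<lambda>c \<in> carrier (join_chain_group (carrier (P \<times>\<times> P)) n).
        \<phi> {\<one>\<^bsub>P \<times>\<times> P\<^esub>} (join_map (\<lambda>(x, y). x \<otimes>\<^bsub>P\<^esub> inv\<^bsub>P\<^esub> y) c))"

text \<open>The class of \<open>Phi_cochain P n \<phi>\<close> is the same for all representatives \<open>\<phi>\<close> of \<open>\<alpha>\<close>.\<close>

definition Phi ::
    "('p, 'b) monoid_scheme \<Rightarrow> ('p \<times> 'p, 'm) orbit_functor \<Rightarrow> nat
      \<Rightarrow> (('p \<times> 'p) set \<Rightarrow> ((nat \<times> 'p) list \<Rightarrow>\<^sub>0 int) \<Rightarrow> 'm) set
      \<Rightarrow> (((nat \<times> 'p \<times> 'p) list \<Rightarrow>\<^sub>0 int) \<Rightarrow> 'm) set" where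
  "Phi P M n \<alpha> = the_elem
     ((\<lambda>\<phi>. coboundaries (principal_cochains P M) (group_coboundary (P \<times>\<times> P)) n
             #>\<^bsub>principal_cochains P M n\<^esub> Phi_cochain P n \<phi>) ` \<alpha>)"

end

theory Submission
  imports Defs
begin

text \<open>
  Suppose \<open>X \<times> X\<close> is covered by \<open>k + 1 \<le> n\<close> open sets \<open>U i\<close> with path sections.  Since the higher
  homotopy groups of \<open>X\<close> vanish, the simplices of the bar construction of \<open>\<pi>\<close> can be realised compatibly
  by singular simplices of \<open>X\<close> at \<open>x0\<close>; pairs of them realise \<open>E(\<pi> \<times> \<pi>) / (\<pi> \<times> \<pi>)\<close> in \<open>X \<times> X\<close>.  Closing up a path of
  the section over \<open>U i\<close> by the two rays to the base point yields an equivariant and locally constant function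
  from the part of \<open>E(\<pi> \<times> \<pi>)\<close> over \<open>U i\<close> to \<open>\<pi>\<close>.  Subdivide the simplices until every piece lies in some
  \<open>U i\<close>, and label every piece by the least such \<open>i\<close> and the value of the function.  A face of a piece has
  a smaller index, or else the same label, so the flags of pieces give an equivariant chain map
  from \<open>E(\<pi> \<times> \<pi>)\<close> to the join \<open>E(\<pi>)\<close> that only uses the first \<open>k + 1\<close> copies of \<open>\<pi>\<close>, and hence vanishes in
  degree \<open>n\<close>.  It is equivariantly chain homotopic to the map inducing \<open>\<Phi>\<close>, because \<open>E(\<pi>)\<close> can be
  coned off inside a later copy of \<open>\<pi>\<close>.  So \<open>\<Phi>\<close> vanishes in degree \<open>n\<close>; only the principal
  component of a Bredon cocycle enters into this.
\<close>

text \<open>The argument runs on chains and on squares in \<open>X\<close>; no universal cover is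
  built. A pair \<open>(a, b)\<close> of words serves as a chart, and statements about homotopy
  classes of paths become the existence of a square \<open>Sq\<close> with prescribed sides. The
  obstacle is strictness: the map on E(\<pi> \<times> \<pi>) has to commute with faces and
  translations exactly, not up to homotopy. Hence \<open>cell\<close> and \<open>theta\<close> are
  chosen recursively under conditions that see a simplex only through data invariant under
  translation, and equal conditions give equal choices. For the same reason subdividing is not
  enough: the number of subdivisions depends on the simplex, whose faces already carry chosen
  chains, so the subdivided chain is corrected along the chain homotopy between subdivision and
  identity, which keeps pieces small. The least index replaces a partition of unity: labels can jump
  only where the index jumps, and a repeated vertex makes a flag degenerate, which
  \<open>snoc\<close> sends to 0.\<close>

section \<open>Ordered chains\<close>

text \<open>The boundary operator is augmented: the boundary of a vertex is the empty list.\<close>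

definition bd :: "('v list \<Rightarrow>\<^sub>0 int) \<Rightarrow> ('v list \<Rightarrow>\<^sub>0 int)" where
  "bd = frag_extend (\<lambda>\<sigma>. \<Sum>i<length \<sigma>. frag_cmul ((-1) ^ i) (frag_of (take i \<sigma> @ drop (Suc i) \<sigma>)))"

definition app_chain :: "'v \<Rightarrow> ('v list \<Rightarrow>\<^sub>0 int) \<Rightarrow> ('v list \<Rightarrow>\<^sub>0 int)" where
  "app_chain v = frag_extend (\<lambda>l. frag_of (l @ [v]))"

text \<open>Two vertices from the same copy never span a simplex of the join, so such terms are set
  to 0, as one does with degenerate simplices. Only the copies are compared; on
  \<open>appendable v\<close> a last vertex in the copy of \<open>v\<close> is \<open>v\<close>
  itself.\<close>

definition snoc :: "nat \<times> 's \<Rightarrow> ((nat \<times> 's) list \<Rightarrow>\<^sub>0 int) \<Rightarrow> ((nat \<times> 's) list \<Rightarrow>\<^sub>0 int)" where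
  "snoc v = frag_extend (\<lambda>l. if l \<noteq> [] \<and> fst (last l) = fst v then 0 else frag_of (l @ [v]))"

lemma bd_0 [simp]: "bd 0 = 0" by (simp add: bd_def)
lemma bd_add: "bd (a + b) = bd a + bd b" by (simp add: bd_def frag_extend_add)
lemma bd_diff: "bd (a - b) = bd a - bd b" by (simp add: bd_def frag_extend_diff)
lemma bd_minus: "bd (- a) = - bd a" by (simp add: bd_def frag_extend_minus)
lemma bd_cmul: "bd (frag_cmul k a) = frag_cmul k (bd a)" by (simp add: bd_def frag_extend_cmul)

lemma snoc_0 [simp]: "snoc v 0 = 0" by (simp add: snoc_def)
lemma snoc_add: "snoc v (a + b) = snoc v a + snoc v b" by (simp add: snoc_def frag_extend_add)
lemma snoc_diff: "snoc v (a - b) = snoc v a - snoc v b" by (simp add: snoc_def frag_extend_diff)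
lemma snoc_cmul: "snoc v (frag_cmul k a) = frag_cmul k (snoc v a)"
  by (simp add: snoc_def frag_extend_cmul)

lemma bd_of:
  "bd (frag_of \<sigma>) = (\<Sum>i<length \<sigma>. frag_cmul ((-1) ^ i) (frag_of (take i \<sigma> @ drop (Suc i) \<sigma>)))"
  by (simp add: bd_def)

lemma bd_Nil [simp]: "bd (frag_of []) = 0"
  by (simp add: bd_of)

lemma bd_append:
  "bd (frag_of (l @ [v])) = app_chain v (bd (frag_of l)) + frag_cmul ((-1) ^ length l) (frag_of l)"
proof -
  have "(\<Sum>i<length l. frag_cmul ((-1) ^ i) (frag_of (take i (l @ [v]) @ drop (Suc i) (l @ [v]))))
      = app_chain v (bd (frag_of l))"
    by (simp add: bd_of app_chain_def frag_extend_sum frag_extend_cmul)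
  then show ?thesis
    by (simp add: bd_of)
qed

lemma frag_induct_all [case_names zero one diff]:
  assumes "P 0" "\<And>x. P (frag_of x)" "\<And>a b. \<lbrakk>P a; P b\<rbrakk> \<Longrightarrow> P (a - b)"
  shows "P c"
  by (rule frag_induction [of c UNIV]) (use assms in auto)

lemma bd_app_chain:
  assumes "Poly_Mapping.keys c \<subseteq> {l. length l = m}"
  shows "bd (app_chain v c) = app_chain v (bd c) + frag_cmul ((-1) ^ m) c"
  using assms
proof (induction rule: frag_induction)
  case (one l)
  then show ?case using bd_append [of l v] by (simp add: app_chain_def)
next
  case (diff a b)
  then show ?case
    by (simp add: app_chain_def frag_extend_diff bd_diff algebra_simps frag_cmul_distrib2)
      (metis add_diff_eq add.commute frag_cmul_distrib2 diff_add_cancel)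
qed (auto simp: app_chain_def)

lemma keys_bd_of: "Poly_Mapping.keys (bd (frag_of l)) \<subseteq> (\<lambda>i. take i l @ drop (Suc i) l) ` {..<length l}"
  unfolding bd_of using keys_sum by fastforce

lemma keys_bd: "Poly_Mapping.keys (bd c) \<subseteq> (\<Union>l\<in>Poly_Mapping.keys c. (\<lambda>i. take i l @ drop (Suc i) l) ` {..<length l})"
  using keys_frag_extend [of "\<lambda>l. bd (frag_of l)" c] keys_bd_of
  unfolding bd_def by (fastforce simp: bd_def)

text \<open>Induction on the last vertex: the two terms in \<open>bd (frag_of l)\<close> carry the
  signs of \<open>length l - 1\<close> and \<open>length l\<close> and cancel. The case
  \<open>l = []\<close> is separate because the subtraction truncates there.\<close>

lemma bd_bd_of: "bd (bd (frag_of l)) = 0"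
proof (induction l rule: rev_induct)
  case (snoc v l)
  have "Poly_Mapping.keys (bd (frag_of l)) \<subseteq> {m. length m = length l - 1}"
    using keys_bd_of [of l] by fastforce
  then have *: "bd (app_chain v (bd (frag_of l)))
      = app_chain v (bd (bd (frag_of l))) + frag_cmul ((-1) ^ (length l - 1)) (bd (frag_of l))"
    by (rule bd_app_chain)
  show ?case
  proof (cases "l = []")
    case True
    then show ?thesis by (simp add: bd_of)
  next
    case False
    then obtain k where "length l = Suc k" by (cases l) auto
    then show ?thesis
      using snoc * by (simp add: bd_append bd_add bd_cmul app_chain_def flip: frag_cmul_distrib)
  qed
qed simp

lemma bd_bd: "bd (bd c) = 0"
  by (induction c rule: frag_induct_all) (auto simp: bd_bd_of bd_diff)

text \<open>Simplices to which the vertex \<open>v\<close> may be appended: \<open>v\<close> comes last, or was appended already.\<close>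

definition appendable :: "nat \<times> 's \<Rightarrow> (nat \<times> 's) list set" where
  "appendable v = {l. sorted_wrt (<) (map fst l) \<and> (\<forall>x\<in>set l. fst x < fst v \<or> x = v)}"

lemma snoc_app_chain:
  assumes "Poly_Mapping.keys c \<subseteq> {l. \<forall>x\<in>set l. fst x \<noteq> fst v}"
  shows "snoc v c = app_chain v c"
  unfolding snoc_def app_chain_def
  by (rule frag_extend_eq) (use assms in \<open>auto simp: subset_iff\<close>)

text \<open>The cone formula \<open>bd_append\<close> survives the zero clause of
  \<open>snoc\<close>: if \<open>l = l' @ [v]\<close>, every face still ending in \<open>v\<close>
  is killed, and the one remaining face \<open>l'\<close> is coned back to \<open>l\<close> with the
  sign opposite to that of the second summand.\<close>

lemma bd_snoc_of:
  assumes "l \<in> appendable v"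
  shows "bd (snoc v (frag_of l)) = snoc v (bd (frag_of l)) + frag_cmul ((-1) ^ length l) (frag_of l)"
proof (cases "l \<noteq> [] \<and> last l = v")
  case False
  have ne: "\<forall>x\<in>set l. fst x \<noteq> fst v"
  proof
    fix x assume x: "x \<in> set l"
    then obtain l' w where l: "l = l' @ [w]" by (cases l rule: rev_cases) auto
    then have w: "fst w < fst v" using False assms by (auto simp: appendable_def)
    moreover have "fst x \<le> fst w"
      using x l assms by (auto simp: appendable_def sorted_wrt_append less_imp_le)
    ultimately show "fst x \<noteq> fst v" by simp
  qed
  have "snoc v (bd (frag_of l)) = app_chain v (bd (frag_of l))"
    by (rule snoc_app_chain) (use keys_bd_of [of l] ne in \<open>fastforce dest!: in_set_takeD in_set_dropD subsetD\<close>)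
  moreover have "snoc v (frag_of l) = frag_of (l @ [v])"
    using ne last_in_set [of l] by (auto simp: snoc_def)
  ultimately show ?thesis by (simp add: bd_append)
next
  case True
  then obtain l' where l: "l = l' @ [v]" by (cases l rule: rev_cases) auto
  then have ne: "\<forall>x\<in>set l'. fst x \<noteq> fst v"
    using assms by (auto simp: appendable_def sorted_wrt_append)
  have "snoc v (app_chain v c) = 0" for c
    unfolding app_chain_def
    by (induction c rule: frag_induct_all) (auto simp: frag_extend_diff snoc_diff, simp add: snoc_def)
  moreover have "snoc v (frag_of l') = frag_of l"
    using ne l last_in_set [of l'] by (auto simp: snoc_def)
  moreover have "snoc v (frag_of l) = 0" using l by (simp add: snoc_def)
  ultimately show ?thesis by (simp add: l bd_append snoc_add snoc_cmul flip: frag_cmul_distrib)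
qed

lemma bd_snoc:
  assumes "Poly_Mapping.keys c \<subseteq> {l \<in> appendable v. length l = m}"
  shows "bd (snoc v c) = snoc v (bd c) + frag_cmul ((-1) ^ m) c"
  using assms
proof (induction rule: frag_induction)
  case (one l)
  then have "l \<in> appendable v" "length l = m" by auto
  then show ?case using bd_snoc_of [of l v] by simp
next
  case (diff a b)
  have "frag_cmul ((-1) ^ m) (a - b) = frag_cmul ((-1) ^ m) a - frag_cmul ((-1) ^ m) b"
    by (metis add_diff_cancel_right' diff_add_cancel frag_cmul_distrib2)
  then show ?case using diff
    by (simp add: snoc_diff bd_diff)
qed auto

lemma keys_snoc: "Poly_Mapping.keys (snoc v c) \<subseteq> {l @ [v] |l. l \<in> Poly_Mapping.keys c \<and> (l \<noteq> [] \<longrightarrow> fst (last l) \<noteq> fst v)}"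
  unfolding snoc_def using keys_frag_extend [of _ c] by (fastforce split: if_splits)

lemma join_boundary_eq_bd:
  assumes "Poly_Mapping.keys c \<subseteq> {l. length l = Suc n}"
  shows "join_boundary n c = bd c"
  unfolding join_boundary_def bd_def
  by (rule frag_extend_eq) (use assms in \<open>auto simp: subset_iff lessThan_Suc_atMost\<close>)

section \<open>Compressing the join\<close>

declare carrier_DirProd [simp del] one_DirProd [simp del]

text \<open>Indexed by the number \<open>m\<close> of vertices instead of the dimension, so that the
  empty simplex, where the augmented boundary ends, is the case \<open>m = 0\<close>.\<close>

definition ordered_simplices :: "'s set \<Rightarrow> nat \<Rightarrow> (nat \<times> 's) list set" where
  "ordered_simplices S m =
     {\<sigma>. length \<sigma> = m \<and> sorted_wrt (<) (map fst \<sigma>) \<and> snd ` set \<sigma> \<subseteq> S}"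

lemma join_simplices_eq: "join_simplices S n = ordered_simplices S (Suc n)"
  by (simp add: join_simplices_def ordered_simplices_def)

lemma face_ordered_simplex:
  assumes "\<sigma> \<in> ordered_simplices S m" "i < m"
  shows "take i \<sigma> @ drop (Suc i) \<sigma> \<in> ordered_simplices S (m - 1)"
proof -
  have "\<sigma> = take i \<sigma> @ \<sigma> ! i # drop (Suc i) \<sigma>"
    using assms by (simp add: ordered_simplices_def id_take_nth_drop)
  moreover have "sorted_wrt (<) (map fst \<sigma>)" using assms by (simp add: ordered_simplices_def)
  ultimately have "sorted_wrt (<) (map fst (take i \<sigma> @ \<sigma> ! i # drop (Suc i) \<sigma>))" by metis
  then have "sorted_wrt (<) (map fst (take i \<sigma> @ drop (Suc i) \<sigma>))"
    by (auto simp: sorted_wrt_append)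
  then show ?thesis
    using assms by (auto simp: ordered_simplices_def dest!: in_set_takeD in_set_dropD)
qed

lemma keys_bd_ordered:
  assumes "Poly_Mapping.keys c \<subseteq> ordered_simplices S m"
  shows "Poly_Mapping.keys (bd c) \<subseteq> ordered_simplices S (m - 1)"
proof -
  have "take i l @ drop (Suc i) l \<in> ordered_simplices S (m - 1)"
    if "l \<in> Poly_Mapping.keys c" "i < length l" for l i
    using face_ordered_simplex [of l S m i] that assms by (auto simp: ordered_simplices_def)
  then show ?thesis using keys_bd [of c] by blast
qed

lemma join_map_0 [simp]: "join_map u 0 = 0" by (simp add: join_map_def)
lemma join_map_diff: "join_map u (a - b) = join_map u a - join_map u b"
  by (simp add: join_map_def frag_extend_diff)
lemma join_map_cmul: "join_map u (frag_cmul k a) = frag_cmul k (join_map u a)"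
  by (simp add: join_map_def frag_extend_cmul)
lemma join_map_of [simp]: "join_map u (frag_of l) = frag_of (map (map_prod id u) l)"
  by (simp add: join_map_def)

lemma bd_join_map: "bd (join_map u c) = join_map u (bd c)"
proof (induction c rule: frag_induct_all)
  case (one l)
  show ?case
    by (simp add: bd_of join_map_def frag_extend_sum frag_extend_cmul take_map drop_map)
qed (auto simp: bd_diff join_map_diff)

lemma snoc_join_map: "snoc (map_prod id u v) (join_map u c) = join_map u (snoc v c)"
proof (induction c rule: frag_induct_all)
  case (one l)
  show ?case by (cases v) (auto simp: snoc_def last_map)
qed (auto simp: snoc_diff join_map_diff)

lemma keys_join_map: "Poly_Mapping.keys (join_map u c) \<subseteq> map (map_prod id u) ` Poly_Mapping.keys c"
  unfolding join_map_def using keys_frag_extend [of _ c] by fastforce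

lemma ordered_simplices_map:
  assumes "\<sigma> \<in> ordered_simplices S m" "\<And>x. x \<in> S \<Longrightarrow> u x \<in> T"
  shows "map (map_prod id u) \<sigma> \<in> ordered_simplices T m"
  using assms by (auto simp: ordered_simplices_def comp_def)

lemma keys_join_map_ordered:
  assumes "Poly_Mapping.keys c \<subseteq> ordered_simplices S m" "\<And>x. x \<in> S \<Longrightarrow> u x \<in> T"
  shows "Poly_Mapping.keys (join_map u c) \<subseteq> ordered_simplices T m"
  using keys_join_map [of u c] ordered_simplices_map assms by blast

lemma frag_extend_join_map:
  "frag_extend f (join_map u c) = frag_extend (\<lambda>l. f (map (map_prod id u) l)) c"
  unfolding join_map_def
  by (induction c rule: frag_induct_all) (auto simp: frag_extend_diff)

section \<open>The chain homotopy between the compressed map and the map inducing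
  \<open>Phi\<close>\<close>

definition quot_map :: "('p, 'b) monoid_scheme \<Rightarrow> 'p \<times> 'p \<Rightarrow> 'p" where
  "quot_map P = (\<lambda>(x, y). x \<otimes>\<^bsub>P\<^esub> inv\<^bsub>P\<^esub> y)"

text \<open>The interface between topology and algebra: an equivariant augmented chain map
  \<open>\<psi>\<close> into the join of the copies 0 to \<open>k\<close>. \<open>psi_Nil\<close>
  together with \<open>psi_bd\<close> expresses compatibility with the augmentation.\<close>

locale join_compression =
  fixes P :: "('p, 'b) monoid_scheme" and k :: nat
    and \<psi> :: "(nat \<times> 'p \<times> 'p) list \<Rightarrow> ((nat \<times> 'p) list \<Rightarrow>\<^sub>0 int)"
  assumes grp: "group P"
    and psi_Nil: "\<psi> [] = frag_of []"
    and psi_keys: "s \<in> ordered_simplices (carrier (P \<times>\<times> P)) m \<Longrightarrow>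
       Poly_Mapping.keys (\<psi> s) \<subseteq> {l \<in> ordered_simplices (carrier P) m. \<forall>x\<in>set l. fst x \<le> k}"
    and psi_equiv: "\<lbrakk>g \<in> carrier (P \<times>\<times> P); s \<in> ordered_simplices (carrier (P \<times>\<times> P)) m\<rbrakk> \<Longrightarrow>
       \<psi> (map (map_prod id (\<lambda>x. g \<otimes>\<^bsub>P \<times>\<times> P\<^esub> x)) s) = join_map (two_sided_action P g) (\<psi> s)"
    and psi_bd: "s \<in> ordered_simplices (carrier (P \<times>\<times> P)) m \<Longrightarrow>
       bd (\<psi> s) = frag_extend \<psi> (bd (frag_of s))"
begin

definition F :: "(nat \<times> 'p \<times> 'p) list \<Rightarrow> (nat \<times> 'p) list" where
  "F = map (map_prod id (quot_map P))"

text \<open>The cone point lies in a copy of the group beyond all vertices of \<open>F s - \<psi> s\<close> and of the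
  previously constructed chains, so that appending it is a contraction.\<close>

definition top_index :: "(nat \<times> 'p \<times> 'p) list \<Rightarrow> nat" where
  "top_index s = Suc (max k (fst (last s))) + length s"

definition cone_point :: "(nat \<times> 'p \<times> 'p) list \<Rightarrow> nat \<times> 'p" where
  "cone_point s = (top_index s, quot_map P (snd (hd s)))"

text \<open>The inductive homotopy of a cone argument. The bracket is a cycle by the homotopy
  identity one degree lower; for a cycle with \<open>Suc m\<close> vertices, \<open>bd_snoc\<close>
  makes it the boundary of its cone up to the sign \<open>(-1) ^ Suc m\<close>, which the factor in
  front undoes.\<close>

primrec K :: "nat \<Rightarrow> (nat \<times> 'p \<times> 'p) list \<Rightarrow> ((nat \<times> 'p) list \<Rightarrow>\<^sub>0 int)" where
  "K 0 s = 0"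
| "K (Suc m) s = frag_cmul ((-1) ^ Suc m)
     (snoc (cone_point s) (frag_of (F s) - \<psi> s - frag_extend (K m) (bd (frag_of s))))"

lemma quot_closed [simp]: "x \<in> carrier (P \<times>\<times> P) \<Longrightarrow> quot_map P x \<in> carrier P"
  by (auto simp: quot_map_def carrier_DirProd intro!: monoid.m_closed group.inv_closed group.is_monoid grp)

lemma face_last_le:
  assumes "\<sigma> \<in> ordered_simplices S m" "i < m" "take i \<sigma> @ drop (Suc i) \<sigma> \<noteq> []"
  shows "fst (last (take i \<sigma> @ drop (Suc i) \<sigma>)) \<le> fst (last \<sigma>)"
proof -
  have "last (take i \<sigma> @ drop (Suc i) \<sigma>) \<in> set \<sigma>"
    using last_in_set [OF assms(3)] by (auto dest: in_set_takeD in_set_dropD)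
  moreover obtain l' w where l: "\<sigma> = l' @ [w]" using assms by (cases \<sigma> rule: rev_cases) auto
  ultimately show ?thesis
    using assms(1) by (auto simp: ordered_simplices_def sorted_wrt_append less_imp_le)
qed

text \<open>A face has one vertex less and no larger last index, so its \<open>top_index\<close> is
  strictly smaller; this leaves the copy of the cone point of \<open>s\<close> free of everything
  built before. The bound on the bracket is part of the same induction because it uses the bound on
  \<open>K\<close> for the faces.\<close>

lemma K_keys_aux:
  "s \<in> ordered_simplices (carrier (P \<times>\<times> P)) m \<Longrightarrow>
   (\<forall>q. m = Suc q \<longrightarrow> Poly_Mapping.keys (frag_of (F s) - \<psi> s - frag_extend (K q) (bd (frag_of s)))
     \<subseteq> {l \<in> ordered_simplices (carrier P) m. \<forall>x\<in>set l. fst x < top_index s}) \<and>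
   Poly_Mapping.keys (K m s) \<subseteq> {l \<in> ordered_simplices (carrier P) (Suc m). \<forall>x\<in>set l. fst x \<le> top_index s}"
proof (induction m arbitrary: s)
  case (Suc m)
  let ?c = "frag_of (F s) - \<psi> s - frag_extend (K m) (bd (frag_of s))"
  have s: "length s = Suc m" "s \<noteq> []" using Suc.prems by (auto simp: ordered_simplices_def)
  have F: "F s \<in> ordered_simplices (carrier P) (Suc m)"
    unfolding F_def by (rule ordered_simplices_map [OF Suc.prems]) simp
  have le_last: "fst x \<le> fst (last s)" if "x \<in> set s" for x
  proof -
    obtain l' w where l: "s = l' @ [w]" using s by (cases s rule: rev_cases) auto
    then show ?thesis using that Suc.prems
      by (auto simp: ordered_simplices_def sorted_wrt_append less_imp_le)
  qed
  have 1: "\<forall>x\<in>set (F s). fst x < top_index s"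
    using le_last by (fastforce simp: F_def top_index_def)
  have 2: "Poly_Mapping.keys (\<psi> s) \<subseteq> {l \<in> ordered_simplices (carrier P) (Suc m). \<forall>x\<in>set l. fst x < top_index s}"
    using psi_keys [OF Suc.prems] by (fastforce simp: top_index_def)
  have 3: "Poly_Mapping.keys (K m t) \<subseteq> {l \<in> ordered_simplices (carrier P) (Suc m). \<forall>x\<in>set l. fst x < top_index s}"
    if t_in: "t \<in> Poly_Mapping.keys (bd (frag_of s))" for t
  \<comment> \<open>\<open>top_index\<close> of an empty face involves an unspecified
    \<open>last\<close>; but an empty face occurs only for \<open>m = 0\<close>, where
    \<open>K 0\<close> vanishes.\<close>
  proof (cases "t = []")
    case True
    then have "m = 0" using t_in keys_bd_of [of s] s by (auto split: if_splits)
    then show ?thesis by simp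
  next
    case False
    obtain i where i: "i < Suc m" "t = take i s @ drop (Suc i) s"
      using t_in keys_bd_of [of s] s by auto
    have t: "t \<in> ordered_simplices (carrier (P \<times>\<times> P)) m"
      using face_ordered_simplex [OF Suc.prems i(1)] i(2) by simp
    then have "top_index t < top_index s"
      using face_last_le [OF Suc.prems i(1)] False i(2) s(1)
      by (fastforce simp: top_index_def ordered_simplices_def)
    then show ?thesis using Suc.IH [OF t] by fastforce
  qed
  have c: "Poly_Mapping.keys ?c \<subseteq> {l \<in> ordered_simplices (carrier P) (Suc m). \<forall>x\<in>set l. fst x < top_index s}"
  proof -
    have "Poly_Mapping.keys (frag_extend (K m) (bd (frag_of s)))
        \<subseteq> {l \<in> ordered_simplices (carrier P) (Suc m). \<forall>x\<in>set l. fst x < top_index s}"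
      using keys_frag_extend [of "K m" "bd (frag_of s)"] 3 by blast
    moreover have "Poly_Mapping.keys (frag_of (F s)) \<subseteq> {l \<in> ordered_simplices (carrier P) (Suc m). \<forall>x\<in>set l. fst x < top_index s}"
      using F 1 by simp
    ultimately show ?thesis
      using 2 keys_diff [of "frag_of (F s) - \<psi> s"] keys_diff [of "frag_of (F s)" "\<psi> s"] by blast
  qed
  have "quot_map P (snd (hd s)) \<in> carrier P"
    using Suc.prems s by (intro quot_closed) (auto simp: ordered_simplices_def)
  then have "l @ [cone_point s] \<in> {l \<in> ordered_simplices (carrier P) (Suc (Suc m)). \<forall>x\<in>set l. fst x \<le> top_index s}"
    if "l \<in> Poly_Mapping.keys ?c" for l
    using subsetD [OF c that]
    by (fastforce simp: ordered_simplices_def cone_point_def sorted_wrt_append less_imp_le)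
  moreover have "Poly_Mapping.keys (K (Suc m) s) \<subseteq> Poly_Mapping.keys (snoc (cone_point s) ?c)"
    by (auto simp del: join_map_of)
  ultimately show ?case
    using keys_snoc [of "cone_point s" ?c] c by blast
qed simp

lemmas K_keys = K_keys_aux [THEN conjunct2]
lemmas K_arg_keys = K_keys_aux [THEN conjunct1, rule_format, OF _ refl]

lemma F_chain: "frag_of (F s) = join_map (quot_map P) (frag_of s)"
  by (simp add: F_def)

lemma appendable_cone:
  assumes "\<forall>x\<in>set l. fst x < top_index s" "l \<in> ordered_simplices S m"
  shows "l \<in> appendable (cone_point s)" "length l = m"
  using assms by (auto simp: appendable_def cone_point_def ordered_simplices_def)

text \<open>At \<open>m = 0\<close> both maps fix the empty simplex. For the step, applying
  \<open>bd\<close> to the bracket and inserting the identity for the faces leaves only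
  \<open>K\<close> of \<open>bd (bd c)\<close>, which is 0; so the bracket is a cycle and its cone
  bounds it.\<close>

lemma K_bd:
  "Poly_Mapping.keys c \<subseteq> ordered_simplices (carrier (P \<times>\<times> P)) m \<Longrightarrow>
   bd (frag_extend (K m) c) = join_map (quot_map P) c - frag_extend \<psi> c - frag_extend (K (m - 1)) (bd c)"
proof (induction m arbitrary: c)
  case 0
  then have "Poly_Mapping.keys c \<subseteq> {[]}" by (auto simp: ordered_simplices_def)
  then show ?case
  proof (induction rule: frag_induction)
    case (one x)
    then show ?case by (simp add: psi_Nil)
  qed (auto simp: frag_extend_diff bd_diff join_map_diff frag_extend_eq_0)
next
  case (Suc m)
  have of_case: "bd (K (Suc m) s) = frag_of (F s) - \<psi> s - frag_extend (K m) (bd (frag_of s))"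
    if s_in: "s \<in> ordered_simplices (carrier (P \<times>\<times> P)) (Suc m)" for s
  proof -
    let ?c = "frag_of (F s) - \<psi> s - frag_extend (K m) (bd (frag_of s))"
    have kb: "Poly_Mapping.keys (bd (frag_of s)) \<subseteq> ordered_simplices (carrier (P \<times>\<times> P)) m"
      using keys_bd_ordered [of "frag_of s" _ "Suc m"] s_in by simp
    have "bd ?c = join_map (quot_map P) (bd (frag_of s)) - frag_extend \<psi> (bd (frag_of s))
        - bd (frag_extend (K m) (bd (frag_of s)))"
      by (simp only: bd_diff F_chain bd_join_map psi_bd [OF s_in])
    also have "\<dots> = 0"
      by (simp add: Suc.IH [OF kb] bd_bd)
    finally have c0: "bd ?c = 0" .
    have "Poly_Mapping.keys ?c \<subseteq> {l \<in> appendable (cone_point s). length l = Suc m}"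
      using K_arg_keys [OF s_in] appendable_cone by blast
    then have "bd (snoc (cone_point s) ?c) = snoc (cone_point s) (bd ?c) + frag_cmul ((-1) ^ Suc m) ?c"
      by (rule bd_snoc)
    then show ?thesis
      by (simp add: c0 bd_cmul bd_minus flip: power_mult_distrib)
  qed
  show ?case
    using Suc.prems
  proof (induction rule: frag_induction)
    case (one s)
    then show ?case using of_case by (simp add: F_def del: K.simps)
  qed (auto simp: frag_extend_diff bd_diff join_map_diff simp del: K.simps)
qed

text \<open>\<open>quot_map\<close> is the orbit map of the unit: it sends \<open>(x, y)\<close> to
  the result of letting \<open>(x, y)\<close> act on the unit of \<open>P\<close>.\<close>

lemma quot_map_equiv:
  assumes "g \<in> carrier (P \<times>\<times> P)" "x \<in> carrier (P \<times>\<times> P)"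
  shows "quot_map P (g \<otimes>\<^bsub>P \<times>\<times> P\<^esub> x) = two_sided_action P g (quot_map P x)"
proof -
  interpret group P by (rule grp)
  show ?thesis using assms
    by (auto simp: quot_map_def two_sided_action_def DirProd_def inv_mult_group m_assoc)
qed

text \<open>The cone point is itself equivariant: its copy depends only on the copies in
  \<open>s\<close>, and its group element is \<open>quot_map\<close> of the first vertex. The rest
  is induction.\<close>

lemma K_equiv:
  "\<lbrakk>g \<in> carrier (P \<times>\<times> P); s \<in> ordered_simplices (carrier (P \<times>\<times> P)) m\<rbrakk> \<Longrightarrow>
    K m (map (map_prod id (\<lambda>x. g \<otimes>\<^bsub>P \<times>\<times> P\<^esub> x)) s) = join_map (two_sided_action P g) (K m s)"
proof (induction m arbitrary: s)
  case (Suc m)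
  let ?gs = "map (map_prod id (\<lambda>x. g \<otimes>\<^bsub>P \<times>\<times> P\<^esub> x)) s"
  let ?a = "two_sided_action P g"
  have s: "s \<noteq> []" "snd ` set s \<subseteq> carrier (P \<times>\<times> P)"
    using Suc.prems by (auto simp: ordered_simplices_def)
  then have "snd (hd s) \<in> carrier (P \<times>\<times> P)"
    using hd_in_set by blast
  note s = s this
  have cp: "cone_point ?gs = map_prod id ?a (cone_point s)"
    using s Suc.prems by (simp add: cone_point_def top_index_def last_map hd_map quot_map_equiv)
  have F: "frag_of (F ?gs) = join_map ?a (frag_of (F s))"
  proof -
    have "F ?gs = map (map_prod id ?a) (F s)"
      unfolding F_def map_map
    proof (rule map_cong [OF refl])
      fix x assume "x \<in> set s"
      then have "snd x \<in> carrier (P \<times>\<times> P)" using s(2) by blast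
      then show "(map_prod id (quot_map P) \<circ> map_prod id ((\<otimes>\<^bsub>P \<times>\<times> P\<^esub>) g)) x
          = (map_prod id ?a \<circ> map_prod id (quot_map P)) x"
        using quot_map_equiv [OF Suc.prems(1)] by (cases x) simp
    qed
    then show ?thesis by simp
  qed
  have kb: "Poly_Mapping.keys (bd (frag_of s)) \<subseteq> ordered_simplices (carrier (P \<times>\<times> P)) m"
    using keys_bd_ordered [of "frag_of s" _ "Suc m"] Suc.prems by simp
  have "bd (frag_of ?gs) = join_map (\<lambda>x. g \<otimes>\<^bsub>P \<times>\<times> P\<^esub> x) (bd (frag_of s))"
    by (simp add: bd_join_map flip: join_map_of)
  then have "frag_extend (K m) (bd (frag_of ?gs))
     = frag_extend (\<lambda>l. K m (map (map_prod id (\<lambda>x. g \<otimes>\<^bsub>P \<times>\<times> P\<^esub> x)) l)) (bd (frag_of s))"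
    by (simp add: frag_extend_join_map)
  also have "\<dots> = frag_extend (\<lambda>l. join_map ?a (K m l)) (bd (frag_of s))"
    by (rule frag_extend_eq) (use kb Suc in blast)
  also have "\<dots> = join_map ?a (frag_extend (K m) (bd (frag_of s)))"
  proof -
    have "frag_extend (\<lambda>l. join_map ?a (K m l)) c = join_map ?a (frag_extend (K m) c)" for c
      by (induction c rule: frag_induct_all) (auto simp: frag_extend_diff join_map_diff)
    then show ?thesis .
  qed
  finally have Kb: "frag_extend (K m) (bd (frag_of ?gs)) = join_map ?a (frag_extend (K m) (bd (frag_of s)))" .
  show ?case
    by (simp only: K.simps cp F psi_equiv [OF Suc.prems] Kb join_map_diff [symmetric] snoc_join_map join_map_cmul)
qed simp

text \<open>Pigeonhole: the vertices of a simplex lie in different copies, and only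
  \<open>k + 1\<close> copies are available.\<close>

lemma psi_vanishes:
  assumes "s \<in> ordered_simplices (carrier (P \<times>\<times> P)) m" "k + 1 < m"
  shows "\<psi> s = 0"
proof (rule ccontr)
  assume "\<psi> s \<noteq> 0"
  then obtain l where "l \<in> Poly_Mapping.keys (\<psi> s)" by fastforce
  then have l: "length l = m" "sorted_wrt (<) (map fst l)" "\<forall>x\<in>set l. fst x \<le> k"
    using psi_keys [OF assms(1)] by (auto simp: ordered_simplices_def)
  have "distinct (map fst l)" using l(2) strict_sorted_iff by blast
  then have "card (set (map fst l)) = m" using l(1) by (metis distinct_card length_map)
  moreover have "card (set (map fst l)) \<le> card {..k}"
    by (rule card_mono) (use l(3) in auto)
  ultimately show False using assms(2) by simp
qed

lemma F_eq_boundary: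
  assumes "Poly_Mapping.keys c \<subseteq> ordered_simplices (carrier (P \<times>\<times> P)) m" "k + 1 < m"
  shows "join_map (quot_map P) c = bd (frag_extend (K m) c) + frag_extend (K (m - 1)) (bd c)"
proof -
  have "frag_extend \<psi> c = 0"
    by (rule frag_extend_eq_0) (use assms psi_vanishes in blast)
  then show ?thesis using K_bd [OF assms(1)] by simp
qed

lemma K_chain_keys:
  assumes "Poly_Mapping.keys c \<subseteq> ordered_simplices (carrier (P \<times>\<times> P)) m"
  shows "Poly_Mapping.keys (frag_extend (K m) c) \<subseteq> ordered_simplices (carrier P) (Suc m)"
  using keys_frag_extend [of "K m" c] K_keys assms by blast

lemma K_chain_equiv:
  assumes "Poly_Mapping.keys c \<subseteq> ordered_simplices (carrier (P \<times>\<times> P)) m" "g \<in> carrier (P \<times>\<times> P)"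
  shows "frag_extend (K m) (join_map (\<lambda>x. g \<otimes>\<^bsub>P \<times>\<times> P\<^esub> x) c)
    = join_map (two_sided_action P g) (frag_extend (K m) c)"
  using assms(1)
proof (induction rule: frag_induction)
  case (one s)
  then show ?case using K_equiv [OF assms(2)] by simp
qed (auto simp: frag_extend_diff join_map_diff)

end

text \<open>The part of a Bredon cocycle that enters into its image under \<open>\<Phi>\<close>.\<close>

definition principal_cocycle ::
    "('p, 'b) monoid_scheme \<Rightarrow> ('p \<times> 'p, 'm) orbit_functor \<Rightarrow> nat \<Rightarrow> (((nat \<times> 'p) list \<Rightarrow>\<^sub>0 int) \<Rightarrow> 'm) \<Rightarrow> bool" where
  "principal_cocycle P M n h \<longleftrightarrow>
     h \<in> hom (free_Abelian_group (ordered_simplices (carrier P) (Suc n))) (principal_component (P \<times>\<times> P) M) \<and>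
     (\<forall>g \<in> carrier (P \<times>\<times> P). \<forall>c. Poly_Mapping.keys c \<subseteq> ordered_simplices (carrier P) (Suc n) \<longrightarrow>
        h (join_map (two_sided_action P g) c) = principal_action (P \<times>\<times> P) M g (h c)) \<and>
     (\<forall>c. Poly_Mapping.keys c \<subseteq> ordered_simplices (carrier P) (Suc (Suc n)) \<longrightarrow>
        h (bd c) = \<one>\<^bsub>principal_component (P \<times>\<times> P) M\<^esub>)"

text \<open>With \<open>\<psi>\<close> gone, the homotopy identity reads F = bd K + K bd. The
  cocycle kills the first summand, and the second is the coboundary of the cochain composed with
  \<open>K\<close>, which is equivariant because \<open>K\<close> is.\<close>

lemma (in join_compression) Phi_cochain_coboundary:
  assumes cocycle: "principal_cocycle P M n (\<phi> {\<one>\<^bsub>P \<times>\<times> P\<^esub>})" and "k < n"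
    and comm: "comm_group (principal_component (P \<times>\<times> P) M)"
  shows "Phi_cochain P n \<phi> \<in> coboundaries (principal_cochains P M) (group_coboundary (P \<times>\<times> P)) n"
proof -
  obtain m where n: "n = Suc m" using \<open>k < n\<close> by (cases n) auto
  define h where "h = \<phi> {\<one>\<^bsub>P \<times>\<times> P\<^esub>}"
  let ?A = "principal_component (P \<times>\<times> P) M"
  let ?OE = "ordered_simplices (carrier (P \<times>\<times> P))"
  interpret A: comm_group ?A by (rule comm)
  have h: "principal_cocycle P M n h" using cocycle by (simp only: h_def)
  have hom: "h (a + b) = h a \<otimes>\<^bsub>?A\<^esub> h b"
    if "Poly_Mapping.keys a \<subseteq> ordered_simplices (carrier P) (Suc n)"
      "Poly_Mapping.keys b \<subseteq> ordered_simplices (carrier P) (Suc n)" for a b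
    using h that by (auto simp: principal_cocycle_def hom_def)
  have hcl: "h a \<in> carrier ?A"
    if "Poly_Mapping.keys a \<subseteq> ordered_simplices (carrier P) (Suc n)" for a
    using h that by (auto simp: principal_cocycle_def hom_def)
  \<comment> \<open>A chain of degree \<open>m\<close> has simplices with \<open>Suc m = n\<close>
    vertices; this is why \<open>K n\<close> occurs in a cochain of degree \<open>m\<close>.\<close>
  define \<beta> where "\<beta> = (\<lambda>c \<in> carrier (join_chain_group (carrier (P \<times>\<times> P)) m). h (frag_extend (K n) c))"
  have carr: "c \<in> carrier (join_chain_group (carrier (P \<times>\<times> P)) q) \<longleftrightarrow> Poly_Mapping.keys c \<subseteq> ?OE (Suc q)" for c q
    by (simp add: join_chain_group_def join_simplices_eq)
  have "\<beta> \<in> carrier (principal_cochains P M m)"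
    unfolding principal_cochains_def group_cochains_def
  proof (clarsimp, intro conjI ballI)
    show "\<beta> \<in> hom (join_chain_group (carrier (P \<times>\<times> P)) m) ?A"
    proof (rule homI)
      fix x assume "x \<in> carrier (join_chain_group (carrier (P \<times>\<times> P)) m)"
      then show "\<beta> x \<in> carrier ?A"
        using K_chain_keys [of x n] hcl by (auto simp: \<beta>_def carr n simp del: K.simps)
    next
      fix x y assume xy: "x \<in> carrier (join_chain_group (carrier (P \<times>\<times> P)) m)"
        "y \<in> carrier (join_chain_group (carrier (P \<times>\<times> P)) m)"
      have "x + y \<in> carrier (join_chain_group (carrier (P \<times>\<times> P)) m)"
        using xy carr Poly_Mapping.keys_add [of x y] by blast
      then show "\<beta> (x \<otimes>\<^bsub>join_chain_group (carrier (P \<times>\<times> P)) m\<^esub> y) = \<beta> x \<otimes>\<^bsub>?A\<^esub> \<beta> y"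
        using xy K_chain_keys [of x n] K_chain_keys [of y n] hom
        by (simp add: \<beta>_def carr n frag_extend_add join_chain_group_def join_simplices_eq del: K.simps)
    qed
    show "\<beta> \<in> extensional (carrier (join_chain_group (carrier (P \<times>\<times> P)) m))"
      by (simp add: \<beta>_def)
    fix g c assume g: "g \<in> carrier (P \<times>\<times> P)" and c: "c \<in> carrier (join_chain_group (carrier (P \<times>\<times> P)) m)"
    interpret G: group "P \<times>\<times> P" by (intro DirProd_group grp)
    have "join_map (\<lambda>x. g \<otimes>\<^bsub>P \<times>\<times> P\<^esub> x) c \<in> carrier (join_chain_group (carrier (P \<times>\<times> P)) m)"
      using c g unfolding carr by (intro keys_join_map_ordered) auto
    then show "\<beta> (join_map (\<lambda>x. g \<otimes>\<^bsub>P \<times>\<times> P\<^esub> x) c) = principal_action (P \<times>\<times> P) M g (\<beta> c)"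
      using c g h K_chain_equiv [of c n g] K_chain_keys [of c n]
      by (simp add: \<beta>_def carr n principal_cocycle_def del: K.simps)
  qed
  moreover have "Phi_cochain P n \<phi> = group_coboundary (P \<times>\<times> P) m \<beta>"
  proof (rule extensionalityI)
    show "Phi_cochain P n \<phi> \<in> extensional (carrier (join_chain_group (carrier (P \<times>\<times> P)) n))"
      "group_coboundary (P \<times>\<times> P) m \<beta> \<in> extensional (carrier (join_chain_group (carrier (P \<times>\<times> P)) n))"
      by (auto simp: Phi_cochain_def group_coboundary_def n)
    fix c assume "c \<in> carrier (join_chain_group (carrier (P \<times>\<times> P)) n)"
    then have c: "Poly_Mapping.keys c \<subseteq> ?OE (Suc n)" by (simp add: carr)
    have bc: "Poly_Mapping.keys (bd c) \<subseteq> ?OE n" using keys_bd_ordered [OF c] by simp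
    have jb: "join_boundary n c = bd c"
      by (rule join_boundary_eq_bd) (use c in \<open>auto simp: ordered_simplices_def\<close>)
    have "Phi_cochain P n \<phi> c = h (join_map (quot_map P) c)"
      using c by (simp add: Phi_cochain_def carr quot_map_def flip: h_def)
    also have "\<dots> = h (bd (frag_extend (K (Suc n)) c) + frag_extend (K n) (bd c))"
      using F_eq_boundary [OF c] \<open>k < n\<close> by simp
    also have "\<dots> = h (bd (frag_extend (K (Suc n)) c)) \<otimes>\<^bsub>?A\<^esub> h (frag_extend (K n) (bd c))"
      by (rule hom) (use keys_bd_ordered [OF K_chain_keys [OF c]] K_chain_keys [OF bc] in auto)
    also have "h (bd (frag_extend (K (Suc n)) c)) = \<one>\<^bsub>?A\<^esub>"
      using h K_chain_keys [OF c] by (simp add: principal_cocycle_def del: K.simps)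
    also have "\<one>\<^bsub>?A\<^esub> \<otimes>\<^bsub>?A\<^esub> h (frag_extend (K n) (bd c)) = h (frag_extend (K n) (bd c))"
      using hcl [OF K_chain_keys [OF bc]] by simp
    also have "\<dots> = group_coboundary (P \<times>\<times> P) m \<beta> c"
      using c bc by (simp add: group_coboundary_def \<beta>_def carr n jb [unfolded n] del: K.simps)
    finally show "Phi_cochain P n \<phi> c = group_coboundary (P \<times>\<times> P) m \<beta> c" .
  qed
  ultimately show ?thesis
    by (auto simp: coboundaries_def n)
qed

section \<open>Principal components of Bredon cocycles\<close>

lemma diagonal_family_subgroup:
  assumes "group P" "H \<in> diagonal_family P"
  shows "subgroup H (P \<times>\<times> P)"
proof -
  interpret P: group P by fact
  interpret G: group "P \<times>\<times> P" by (intro DirProd_group assms)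
  show ?thesis
    using assms(2)
  proof induction
    case trivial
    show ?case by (rule G.triv_subgroup)
  next
    case diagonal
    show ?case
      by (rule subgroup.intro) (auto simp: diagonal_subgroup_def carrier_DirProd one_DirProd)
  next
    case (conjugate H g)
    interpret H: subgroup H "P \<times>\<times> P" by fact
    have HG: "H \<subseteq> carrier (P \<times>\<times> P)" by (rule H.subset)
    have eq: "g <#\<^bsub>P \<times>\<times> P\<^esub> H #>\<^bsub>P \<times>\<times> P\<^esub> inv\<^bsub>P \<times>\<times> P\<^esub> g
        = (\<lambda>h. g \<otimes>\<^bsub>P \<times>\<times> P\<^esub> h \<otimes>\<^bsub>P \<times>\<times> P\<^esub> inv\<^bsub>P \<times>\<times> P\<^esub> g) ` H"
      by (auto simp: l_coset_def r_coset_def)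
    have cancel: "inv\<^bsub>P \<times>\<times> P\<^esub> g \<otimes>\<^bsub>P \<times>\<times> P\<^esub> (g \<otimes>\<^bsub>P \<times>\<times> P\<^esub> z) = z"
      if "z \<in> carrier (P \<times>\<times> P)" for z
      using that conjugate.hyps by (simp flip: G.m_assoc)
    have mult: "(g \<otimes>\<^bsub>P \<times>\<times> P\<^esub> x \<otimes>\<^bsub>P \<times>\<times> P\<^esub> inv\<^bsub>P \<times>\<times> P\<^esub> g) \<otimes>\<^bsub>P \<times>\<times> P\<^esub>
       (g \<otimes>\<^bsub>P \<times>\<times> P\<^esub> y \<otimes>\<^bsub>P \<times>\<times> P\<^esub> inv\<^bsub>P \<times>\<times> P\<^esub> g) = g \<otimes>\<^bsub>P \<times>\<times> P\<^esub> (x \<otimes>\<^bsub>P \<times>\<times> P\<^esub> y) \<otimes>\<^bsub>P \<times>\<times> P\<^esub> inv\<^bsub>P \<times>\<times> P\<^esub> g"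
      if "x \<in> H" "y \<in> H" for x y
      using that conjugate.hyps HG by (simp add: G.m_assoc cancel subsetD)
    have inv: "inv\<^bsub>P \<times>\<times> P\<^esub> (g \<otimes>\<^bsub>P \<times>\<times> P\<^esub> x \<otimes>\<^bsub>P \<times>\<times> P\<^esub> inv\<^bsub>P \<times>\<times> P\<^esub> g)
        = g \<otimes>\<^bsub>P \<times>\<times> P\<^esub> inv\<^bsub>P \<times>\<times> P\<^esub> x \<otimes>\<^bsub>P \<times>\<times> P\<^esub> inv\<^bsub>P \<times>\<times> P\<^esub> g"
      if "x \<in> H" for x
      using that conjugate.hyps HG by (simp add: G.inv_mult_group G.m_assoc subsetD)
    show ?case unfolding eq
    proof (rule G.subgroupI)
      show "(\<lambda>h. g \<otimes>\<^bsub>P \<times>\<times> P\<^esub> h \<otimes>\<^bsub>P \<times>\<times> P\<^esub> inv\<^bsub>P \<times>\<times> P\<^esub> g) ` H \<subseteq> carrier (P \<times>\<times> P)"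
        using HG conjugate.hyps by auto
      show "(\<lambda>h. g \<otimes>\<^bsub>P \<times>\<times> P\<^esub> h \<otimes>\<^bsub>P \<times>\<times> P\<^esub> inv\<^bsub>P \<times>\<times> P\<^esub> g) ` H \<noteq> {}"
        using H.one_closed by blast
      fix a b
      assume "a \<in> (\<lambda>h. g \<otimes>\<^bsub>P \<times>\<times> P\<^esub> h \<otimes>\<^bsub>P \<times>\<times> P\<^esub> inv\<^bsub>P \<times>\<times> P\<^esub> g) ` H"
      then obtain x where x: "x \<in> H" "a = g \<otimes>\<^bsub>P \<times>\<times> P\<^esub> x \<otimes>\<^bsub>P \<times>\<times> P\<^esub> inv\<^bsub>P \<times>\<times> P\<^esub> g" by blast
      show "inv\<^bsub>P \<times>\<times> P\<^esub> a \<in> (\<lambda>h. g \<otimes>\<^bsub>P \<times>\<times> P\<^esub> h \<otimes>\<^bsub>P \<times>\<times> P\<^esub> inv\<^bsub>P \<times>\<times> P\<^esub> g) ` H"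
        unfolding x(2) inv [OF x(1)] using x(1) H.m_inv_closed by blast
      assume "b \<in> (\<lambda>h. g \<otimes>\<^bsub>P \<times>\<times> P\<^esub> h \<otimes>\<^bsub>P \<times>\<times> P\<^esub> inv\<^bsub>P \<times>\<times> P\<^esub> g) ` H"
      then obtain y where y: "y \<in> H" "b = g \<otimes>\<^bsub>P \<times>\<times> P\<^esub> y \<otimes>\<^bsub>P \<times>\<times> P\<^esub> inv\<^bsub>P \<times>\<times> P\<^esub> g" by blast
      show "a \<otimes>\<^bsub>P \<times>\<times> P\<^esub> b \<in> (\<lambda>h. g \<otimes>\<^bsub>P \<times>\<times> P\<^esub> h \<otimes>\<^bsub>P \<times>\<times> P\<^esub> inv\<^bsub>P \<times>\<times> P\<^esub> g) ` H"
        unfolding x(2) y(2) mult [OF x(1) y(1)] using x(1) y(1) H.m_closed by blast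
    qed
  next
    case (inter H K)
    then show ?case by (intro G.subgroups_Inter_pair)
  qed
qed

lemma two_sided_action_mult:
  assumes "group P" "g \<in> carrier (P \<times>\<times> P)" "h \<in> carrier (P \<times>\<times> P)" "x \<in> carrier P"
  shows "two_sided_action P (g \<otimes>\<^bsub>P \<times>\<times> P\<^esub> h) x = two_sided_action P g (two_sided_action P h x)"
proof -
  interpret P: group P by fact
  show ?thesis using assms
    by (auto simp: two_sided_action_def carrier_DirProd P.inv_mult_group P.m_assoc)
qed

lemma two_sided_action_closed:
  assumes "group P" "g \<in> carrier (P \<times>\<times> P)" "x \<in> carrier P"
  shows "two_sided_action P g x \<in> carrier P"
proof -
  interpret P: group P by fact
  show ?thesis using assms by (auto simp: two_sided_action_def carrier_DirProd)
qed

text \<open>Equivariance makes the coset \<open>f H = xK\<close> invariant under \<open>H\<close>.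
  So both \<open>a\<close> and \<open>h a\<close> have the form x times an element of
  \<open>K\<close>, and as \<open>K\<close> fixes \<open>s\<close>, both send \<open>s\<close> to
  the same point x s.\<close>

lemma orbit_map_fixed_points:
  assumes P: "group P" and H: "H \<in> diagonal_family P" and K: "K \<in> diagonal_family P"
    and f: "f \<in> orbit_maps (P \<times>\<times> P) H K"
    and s: "s \<in> fixed_points (two_sided_action P) (carrier P) K"
  shows "two_sided_action P (SOME a. a \<in> f H) s \<in> fixed_points (two_sided_action P) (carrier P) H"
proof -
  interpret G: group "P \<times>\<times> P" by (intro DirProd_group P)
  interpret H: subgroup H "P \<times>\<times> P" using diagonal_family_subgroup [OF P H] .
  interpret K: subgroup K "P \<times>\<times> P" using diagonal_family_subgroup [OF P K] .
  have "H = \<one>\<^bsub>P \<times>\<times> P\<^esub> <#\<^bsub>P \<times>\<times> P\<^esub> H"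
    using H.subset by (force simp: l_coset_def)
  then have Hin: "H \<in> lcosets\<^bsub>P \<times>\<times> P\<^esub> H"
    unfolding LCOSETS_def using G.one_closed by blast
  then have "f H \<in> lcosets\<^bsub>P \<times>\<times> P\<^esub> K" using f by (auto simp: orbit_maps_def)
  then obtain x where x: "x \<in> carrier (P \<times>\<times> P)" "f H = x <#\<^bsub>P \<times>\<times> P\<^esub> K"
    by (auto simp: LCOSETS_def)
  define a where "a = (SOME a. a \<in> f H)"
  have "x \<otimes>\<^bsub>P \<times>\<times> P\<^esub> \<one>\<^bsub>P \<times>\<times> P\<^esub> \<in> f H"
    unfolding x(2) l_coset_def using K.one_closed by blast
  then have "a \<in> f H" unfolding a_def by (rule someI)
  then obtain k where k: "k \<in> K" "a = x \<otimes>\<^bsub>P \<times>\<times> P\<^esub> k" by (auto simp: x(2) l_coset_def)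
  have kG: "k \<in> carrier (P \<times>\<times> P)" using k by simp
  have a: "a \<in> carrier (P \<times>\<times> P)" using k x by simp
  have sP: "s \<in> carrier P" and sK: "\<And>k. k \<in> K \<Longrightarrow> two_sided_action P k s = s"
    using s by (auto simp: fixed_points_def)
  have "two_sided_action P h (two_sided_action P a s) = two_sided_action P a s" if h: "h \<in> H" for h
  proof -
    have hG: "h \<in> carrier (P \<times>\<times> P)" using h by simp
    have "h <#\<^bsub>P \<times>\<times> P\<^esub> H = H"
      using h G.coset_join3 [OF _ H.subgroup_axioms] by simp
    then have "h <#\<^bsub>P \<times>\<times> P\<^esub> f H = f H"
      using f Hin hG by (force simp: orbit_maps_def)
    then have "h \<otimes>\<^bsub>P \<times>\<times> P\<^esub> a \<in> f H" using \<open>a \<in> f H\<close> by (auto simp: l_coset_def)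
    then obtain k' where k': "k' \<in> K" "h \<otimes>\<^bsub>P \<times>\<times> P\<^esub> a = x \<otimes>\<^bsub>P \<times>\<times> P\<^esub> k'"
      by (auto simp: x(2) l_coset_def)
    have kG': "k' \<in> carrier (P \<times>\<times> P)" using k' by simp
    have "two_sided_action P h (two_sided_action P a s) = two_sided_action P (h \<otimes>\<^bsub>P \<times>\<times> P\<^esub> a) s"
      using two_sided_action_mult [OF P hG a sP] by simp
    also have "\<dots> = two_sided_action P x s"
      using two_sided_action_mult [OF P x(1) kG' sP] k' sK by simp
    also have "\<dots> = two_sided_action P a s"
      using two_sided_action_mult [OF P x(1) kG sP] k sK by simp
    finally show ?thesis .
  qed
  then show ?thesis
    using two_sided_action_closed [OF P a sP] by (simp add: fixed_points_def a_def)
qed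

text \<open>Cochains are determined only on chains of admissible simplices, so agreement is assumed
  only there; the action, \<open>bd\<close> and sums do not leave this domain.\<close>

lemma principal_cocycle_cong:
  assumes "\<And>c. Poly_Mapping.keys c \<subseteq> ordered_simplices (carrier P) (Suc n) \<Longrightarrow> h c = h' c"
    and "group P" "principal_cocycle P M n h'"
  shows "principal_cocycle P M n h"
proof -
  have eq: "h (join_map (two_sided_action P g) c) = h' (join_map (two_sided_action P g) c)"
    if "g \<in> carrier (P \<times>\<times> P)" "Poly_Mapping.keys c \<subseteq> ordered_simplices (carrier P) (Suc n)" for g c
    by (rule assms(1), rule keys_join_map_ordered [OF that(2)])
      (rule two_sided_action_closed [OF assms(2) that(1)])
  have "h (bd c) = h' (bd c)"
    if "Poly_Mapping.keys c \<subseteq> ordered_simplices (carrier P) (Suc (Suc n))" for c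
    using keys_bd_ordered [OF that] assms(1) by simp
  moreover have "h (a + b) = h' (a + b)"
    if "Poly_Mapping.keys a \<subseteq> ordered_simplices (carrier P) (Suc n)"
       "Poly_Mapping.keys b \<subseteq> ordered_simplices (carrier P) (Suc n)" for a b
    by (rule assms(1)) (use that Poly_Mapping.keys_add [of a b] in blast)
  ultimately show ?thesis
    using assms(3) eq assms(1)
    by (simp add: principal_cocycle_def hom_def Pi_iff)
qed

locale bredon_setup =
  fixes P :: "('p, 'b) monoid_scheme" and M :: "('p \<times> 'p, 'm) orbit_functor"
  assumes P: "group P" and M: "orbit_module (P \<times>\<times> P) (diagonal_family P) M"
begin

abbreviation "A \<equiv> principal_component (P \<times>\<times> P) M"
abbreviation "C \<equiv> bredon_cochains (P \<times>\<times> P) (diagonal_family P) (two_sided_action P) (carrier P) M"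
abbreviation "\<delta> \<equiv> bredon_coboundary (diagonal_family P) (two_sided_action P) (carrier P)"
abbreviation "pt \<equiv> {\<one>\<^bsub>P \<times>\<times> P\<^esub>}"
abbreviation "N \<equiv> join_chains (two_sided_action P) (carrier P)"

sublocale A: comm_group A
  using M diagonal_family.trivial [of P] by (simp add: principal_component_def orbit_module_def)

sublocale P: group P by (rule P)
sublocale G: group "P \<times>\<times> P" by (intro DirProd_group P)

lemma fixed_points_trivial: "fixed_points (two_sided_action P) (carrier P) pt = carrier P"
  by (auto simp: fixed_points_def two_sided_action_def one_DirProd)

lemma carrier_N:
  "c \<in> carrier (module_at (N n) H) \<longleftrightarrow>
   Poly_Mapping.keys c \<subseteq> ordered_simplices (fixed_points (two_sided_action P) (carrier P) H) (Suc n)"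
  by (simp add: join_chains_def join_chain_group_def join_simplices_eq)

lemma module_N_pt: "module_at (N n) pt = free_Abelian_group (ordered_simplices (carrier P) (Suc n))"
  unfolding join_chains_def by (simp add: join_chain_group_def join_simplices_eq fixed_points_trivial)

lemma lcosets_pt: "lcosets\<^bsub>P \<times>\<times> P\<^esub> pt = (\<lambda>g. {g}) ` carrier (P \<times>\<times> P)"
  by (auto simp: LCOSETS_def l_coset_def image_iff)

definition right_translation :: "'p \<times> 'p \<Rightarrow> ('p \<times> 'p) set \<Rightarrow> ('p \<times> 'p) set" where
  "right_translation a = (\<lambda>c \<in> lcosets\<^bsub>P \<times>\<times> P\<^esub> pt. c #>\<^bsub>P \<times>\<times> P\<^esub> a)"

lemma right_translation_orbit_map:
  assumes "a \<in> carrier (P \<times>\<times> P)"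
  shows "right_translation a \<in> orbit_maps (P \<times>\<times> P) pt pt"
proof -
  have "g <#\<^bsub>P \<times>\<times> P\<^esub> {x} \<in> lcosets\<^bsub>P \<times>\<times> P\<^esub> pt" if "g \<in> carrier (P \<times>\<times> P)" "x \<in> carrier (P \<times>\<times> P)" for g x
    using that by (auto simp: lcosets_pt l_coset_def)
  then show ?thesis using assms unfolding orbit_maps_def
    by (auto simp: right_translation_def lcosets_pt r_coset_def l_coset_def G.m_assoc)
qed

lemma right_translation_pt:
  assumes "a \<in> carrier (P \<times>\<times> P)"
  shows "(SOME x. x \<in> right_translation a pt) = a"
proof -
  have "pt \<in> lcosets\<^bsub>P \<times>\<times> P\<^esub> pt" by (auto simp: lcosets_pt)
  then have "right_translation a pt = {a}"
    using assms by (simp add: right_translation_def r_coset_def)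
  then show ?thesis by simp
qed

text \<open>Naturality of \<open>\<phi>\<close> along the right translation by \<open>g\<close>. It
  sends the coset of the unit to \<open>{g}\<close>, so the choice in \<open>join_chains\<close> can
  only return \<open>g\<close>, and the induced map of chains is the action of
  \<open>g\<close>.\<close>

lemma cochain_equiv:
  assumes "\<phi> \<in> carrier (C n)" "g \<in> carrier (P \<times>\<times> P)"
    and c: "Poly_Mapping.keys c \<subseteq> ordered_simplices (carrier P) (Suc n)"
  shows "\<phi> pt (join_map (two_sided_action P g) c) = principal_action (P \<times>\<times> P) M g (\<phi> pt c)"
proof -
  have "c \<in> carrier (module_at (N n) pt)" using c by (simp add: module_N_pt)
  then have "\<phi> pt (module_map (N n) pt pt (right_translation g) c)
      = module_map M pt pt (right_translation g) (\<phi> pt c)"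
    using assms(1) right_translation_orbit_map [OF assms(2)] diagonal_family.trivial [of P]
    by (auto simp: bredon_cochains_def orbit_hom_def)
  then show ?thesis
    by (simp add: join_chains_def right_translation_pt [OF assms(2)] principal_action_def
        flip: right_translation_def)
qed

lemma cochain_hom:
  assumes "\<phi> \<in> carrier (C n)"
  shows "\<phi> pt \<in> hom (free_Abelian_group (ordered_simplices (carrier P) (Suc n))) A"
proof -
  have "\<phi> pt \<in> hom (module_at (N n) pt) (module_at M pt)"
    using assms diagonal_family.trivial [of P]
    by (auto simp: bredon_cochains_def orbit_hom_def PiE_iff)
  then show ?thesis by (simp add: module_N_pt principal_component_def)
qed

lemma cochain_cocycle:
  assumes "\<phi> \<in> carrier (C n)"
    and "\<And>c. Poly_Mapping.keys c \<subseteq> ordered_simplices (carrier P) (Suc (Suc n)) \<Longrightarrow> \<phi> pt (bd c) = \<one>\<^bsub>A\<^esub>"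
  shows "principal_cocycle P M n (\<phi> pt)"
  using cochain_equiv [OF assms(1)] cochain_hom [OF assms(1)] assms(2)
  by (simp add: principal_cocycle_def)

lemma coboundary_pt:
  assumes "Poly_Mapping.keys c \<subseteq> ordered_simplices (carrier P) (Suc (Suc n))"
  shows "\<delta> n \<phi> pt c = \<phi> pt (bd c)"
proof -
  have "join_boundary (Suc n) c = bd c"
    by (rule join_boundary_eq_bd) (use assms in \<open>auto simp: ordered_simplices_def\<close>)
  moreover have "c \<in> carrier (module_at (N (Suc n)) pt)" using assms by (simp add: module_N_pt)
  ultimately show ?thesis
    using diagonal_family.trivial [of P] by (simp add: bredon_coboundary_def)
qed

lemma cocycles_pt:
  assumes "\<phi> \<in> cocycles C \<delta> n"
  shows "principal_cocycle P M n (\<phi> pt)"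
proof (rule cochain_cocycle)
  show "\<phi> \<in> carrier (C n)" using assms by (simp add: cocycles_def kernel_def)
  fix c :: "(nat \<times> 'p) list \<Rightarrow>\<^sub>0 int"
  assume c: "Poly_Mapping.keys c \<subseteq> ordered_simplices (carrier P) (Suc (Suc n))"
  have "\<delta> n \<phi> = \<one>\<^bsub>C (Suc n)\<^esub>" using assms by (simp add: cocycles_def kernel_def)
  moreover have "\<one>\<^bsub>C (Suc n)\<^esub> pt c = \<one>\<^bsub>A\<^esub>"
  proof -
    have "c \<in> carrier (module_at (N (Suc n)) pt)" using c by (simp add: module_N_pt)
    then show ?thesis using diagonal_family.trivial [of P]
      by (simp add: bredon_cochains_def orbit_hom_def principal_component_def)
  qed
  ultimately show "\<phi> pt (bd c) = \<one>\<^bsub>A\<^esub>"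
    using coboundary_pt [OF c, of \<phi>] by simp
qed

lemma principal_action_hom: "g \<in> carrier (P \<times>\<times> P) \<Longrightarrow> principal_action (P \<times>\<times> P) M g \<in> hom A A"
  using M right_translation_orbit_map diagonal_family.trivial [of P]
  by (auto simp: orbit_module_def principal_action_def principal_component_def right_translation_def)

text \<open>A representative of a Bredon class is a fixed cocycle times a coboundary, so
  coboundaries must qualify as well; they do because \<open>bd\<close> squares to zero.\<close>

lemma coboundaries_pt:
  assumes "\<phi> \<in> coboundaries C \<delta> (Suc m)"
  shows "principal_cocycle P M (Suc m) (\<phi> pt)"
proof -
  obtain \<beta> where \<beta>: "\<beta> \<in> carrier (C m)" "\<phi> = \<delta> m \<beta>" using assms by (auto simp: coboundaries_def)
  have "principal_cocycle P M (Suc m) (\<lambda>c. \<beta> pt (bd c))"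
    unfolding principal_cocycle_def
  proof (intro conjI allI ballI impI)
    have h: "\<beta> pt \<in> hom (free_Abelian_group (ordered_simplices (carrier P) (Suc m))) A"
      by (rule cochain_hom [OF \<beta>(1)])
    have k: "Poly_Mapping.keys (bd c) \<subseteq> ordered_simplices (carrier P) (Suc m)"
      if "Poly_Mapping.keys c \<subseteq> ordered_simplices (carrier P) (Suc (Suc m))" for c
      using keys_bd_ordered [OF that] by simp
    show "(\<lambda>c. \<beta> pt (bd c)) \<in> hom (free_Abelian_group (ordered_simplices (carrier P) (Suc (Suc m)))) A"
      using h k by (simp add: hom_def Pi_iff bd_add)
    show "\<beta> pt (bd (join_map (two_sided_action P g) c)) = principal_action (P \<times>\<times> P) M g (\<beta> pt (bd c))"
      if "g \<in> carrier (P \<times>\<times> P)" "Poly_Mapping.keys c \<subseteq> ordered_simplices (carrier P) (Suc (Suc m))" for g c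
      unfolding bd_join_map by (rule cochain_equiv [OF \<beta>(1) that(1) k [OF that(2)]])
    show "\<beta> pt (bd (bd c)) = \<one>\<^bsub>A\<^esub>" for c
      using hom_one [OF h] by (simp add: bd_bd A.is_group)
  qed
  then show ?thesis
    by (rule principal_cocycle_cong [rotated 2]) (simp_all add: P \<beta>(2) coboundary_pt)
qed

lemma principal_cocycle_mult:
  assumes "principal_cocycle P M n h" "principal_cocycle P M n h'"
  shows "principal_cocycle P M n (\<lambda>c. h c \<otimes>\<^bsub>A\<^esub> h' c)"
  unfolding principal_cocycle_def
proof (intro conjI allI ballI impI)
  show "(\<lambda>c. h c \<otimes>\<^bsub>A\<^esub> h' c) \<in> hom (free_Abelian_group (ordered_simplices (carrier P) (Suc n))) A"
    using assms by (auto simp: principal_cocycle_def hom_def Pi_iff A.m_ac)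
  show "h (join_map (two_sided_action P g) c) \<otimes>\<^bsub>A\<^esub> h' (join_map (two_sided_action P g) c)
      = principal_action (P \<times>\<times> P) M g (h c \<otimes>\<^bsub>A\<^esub> h' c)"
    if "g \<in> carrier (P \<times>\<times> P)" "Poly_Mapping.keys c \<subseteq> ordered_simplices (carrier P) (Suc n)" for g c
  proof -
    have "h c \<in> carrier A" "h' c \<in> carrier A"
      using assms that(2) by (auto simp: principal_cocycle_def hom_def Pi_iff)
    then show ?thesis
      using assms that principal_action_hom [OF that(1)] by (simp add: principal_cocycle_def hom_def)
  qed
  show "h (bd c) \<otimes>\<^bsub>A\<^esub> h' (bd c) = \<one>\<^bsub>A\<^esub>"
    if "Poly_Mapping.keys c \<subseteq> ordered_simplices (carrier P) (Suc (Suc n))" for c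
    using assms that by (simp add: principal_cocycle_def)
qed

text \<open>Through the coboundaries this makes a Bredon class inhabited, without which
  \<open>the_elem\<close> in \<open>Phi\<close> would be unspecified. The witness is the zero
  cochain; its naturality needs induced maps to stay inside the carriers, since cochains are
  undefined outside.\<close>

lemma bredon_class_nonempty: "carrier (C m) \<noteq> {}"
proof -
  let ?o = "\<lambda>H \<in> diagonal_family P. \<lambda>c \<in> carrier (module_at (N m) H). \<one>\<^bsub>module_at M H\<^esub>"
  have gr: "group (module_at M H)" if "H \<in> diagonal_family P" for H
    using M that by (simp add: orbit_module_def comm_group_def)
  have "module_map (N m) H K f c \<in> carrier (module_at (N m) H)"
    if "H \<in> diagonal_family P" "K \<in> diagonal_family P" "f \<in> orbit_maps (P \<times>\<times> P) H K"
      "c \<in> carrier (module_at (N m) K)" for H K f c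
  proof -
    have "Poly_Mapping.keys (join_map (two_sided_action P (SOME a. a \<in> f H)) c)
        \<subseteq> ordered_simplices (fixed_points (two_sided_action P) (carrier P) H) (Suc m)"
      by (rule keys_join_map_ordered [OF that(4) [unfolded carrier_N]])
        (rule orbit_map_fixed_points [OF P that(1-3)])
    then show ?thesis unfolding carrier_N by (simp add: join_chains_def)
  qed
  moreover have "module_map M H K f \<one>\<^bsub>module_at M K\<^esub> = \<one>\<^bsub>module_at M H\<^esub>"
    if "H \<in> diagonal_family P" "K \<in> diagonal_family P" "f \<in> orbit_maps (P \<times>\<times> P) H K" for H K f
    by (rule hom_one) (use M that gr in \<open>auto simp: orbit_module_def\<close>)
  moreover have "(\<lambda>c \<in> carrier (module_at (N m) H). \<one>\<^bsub>module_at M H\<^esub>) \<in> hom (module_at (N m) H) (module_at M H)"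
    if "H \<in> diagonal_family P" for H
  proof (rule homI)
    interpret group "module_at M H" by (rule gr [OF that])
    show "(\<lambda>c \<in> carrier (module_at (N m) H). \<one>\<^bsub>module_at M H\<^esub>) x \<in> carrier (module_at M H)"
      if "x \<in> carrier (module_at (N m) H)" for x using that by simp
    interpret N: group "module_at (N m) H"
      by (simp add: join_chains_def join_chain_group_def)
    fix x y assume "x \<in> carrier (module_at (N m) H)" "y \<in> carrier (module_at (N m) H)"
    then show "(\<lambda>c \<in> carrier (module_at (N m) H). \<one>\<^bsub>module_at M H\<^esub>) (x \<otimes>\<^bsub>module_at (N m) H\<^esub> y)
      = (\<lambda>c \<in> carrier (module_at (N m) H). \<one>\<^bsub>module_at M H\<^esub>) x \<otimes>\<^bsub>module_at M H\<^esub>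
        (\<lambda>c \<in> carrier (module_at (N m) H). \<one>\<^bsub>module_at M H\<^esub>) y"
      by simp
  qed
  ultimately have "?o \<in> carrier (C m)"
    unfolding bredon_cochains_def orbit_hom_def by auto
  then show ?thesis by blast
qed

section \<open>Cosets of group coboundaries and the value of \<open>Phi\<close>\<close>

abbreviation "B \<equiv> principal_cochains P M"
abbreviation "OG \<equiv> ordered_simplices (carrier (P \<times>\<times> P))"

lemma carrier_E:
  "c \<in> carrier (join_chain_group (carrier (P \<times>\<times> P)) q) \<longleftrightarrow> Poly_Mapping.keys c \<subseteq> OG (Suc q)"
  by (simp add: join_chain_group_def join_simplices_eq)

lemma coboundary_mult:
  assumes "\<beta> \<in> carrier (B m)" "\<gamma> \<in> carrier (B m)"
  shows "group_coboundary (P \<times>\<times> P) m \<beta> \<otimes>\<^bsub>B (Suc m)\<^esub> group_coboundary (P \<times>\<times> P) m \<gamma>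
       = group_coboundary (P \<times>\<times> P) m (\<beta> \<otimes>\<^bsub>B m\<^esub> \<gamma>)"
proof -
  have "join_boundary (Suc m) c \<in> carrier (join_chain_group (carrier (P \<times>\<times> P)) m)"
    if "c \<in> carrier (join_chain_group (carrier (P \<times>\<times> P)) (Suc m))" for c
  proof -
    have "Poly_Mapping.keys c \<subseteq> OG (Suc (Suc m))" using that by (simp add: carrier_E)
    moreover from this have "join_boundary (Suc m) c = bd c"
      by (intro join_boundary_eq_bd) (auto simp: ordered_simplices_def)
    ultimately show ?thesis using keys_bd_ordered [of c _ "Suc (Suc m)"] by (simp add: carrier_E)
  qed
  then show ?thesis
    by (auto simp: principal_cochains_def group_cochains_def group_coboundary_def)
qed

lemma group_principal_cochains: "group (B m)"
proof (rule groupI)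
  let ?L = "join_chain_group (carrier (P \<times>\<times> P)) m"
  have L: "group ?L" by (simp add: join_chain_group_def)
  interpret L: group ?L by (rule L)
  have cl: "join_map (\<lambda>x. g \<otimes>\<^bsub>P \<times>\<times> P\<^esub> x) c \<in> carrier ?L"
    if "g \<in> carrier (P \<times>\<times> P)" "c \<in> carrier ?L" for g c
    using that unfolding carrier_E by (intro keys_join_map_ordered) auto
  have B: "\<beta> \<in> carrier (B m) \<longleftrightarrow> \<beta> \<in> hom ?L A \<and> \<beta> \<in> extensional (carrier ?L) \<and>
     (\<forall>g \<in> carrier (P \<times>\<times> P). \<forall>c \<in> carrier ?L.
        \<beta> (join_map (\<lambda>x. g \<otimes>\<^bsub>P \<times>\<times> P\<^esub> x) c) = principal_action (P \<times>\<times> P) M g (\<beta> c))" for \<beta>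
    by (auto simp: principal_cochains_def group_cochains_def)
  have m: "\<beta> \<otimes>\<^bsub>B m\<^esub> \<gamma> = (\<lambda>c \<in> carrier ?L. \<beta> c \<otimes>\<^bsub>A\<^esub> \<gamma> c)" for \<beta> \<gamma>
    by (simp add: principal_cochains_def group_cochains_def)
  have o: "\<one>\<^bsub>B m\<^esub> = (\<lambda>c \<in> carrier ?L. \<one>\<^bsub>A\<^esub>)"
    by (simp add: principal_cochains_def group_cochains_def)
  have val: "\<beta> c \<in> carrier A" if "\<beta> \<in> carrier (B m)" "c \<in> carrier ?L" for \<beta> c
    using that by (auto simp: B hom_def)
  have pa: "principal_action (P \<times>\<times> P) M g (x \<otimes>\<^bsub>A\<^esub> y)
     = principal_action (P \<times>\<times> P) M g x \<otimes>\<^bsub>A\<^esub> principal_action (P \<times>\<times> P) M g y"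
    if "g \<in> carrier (P \<times>\<times> P)" "x \<in> carrier A" "y \<in> carrier A" for g x y
    using principal_action_hom [OF that(1)] that by (simp add: hom_def)
  have pac: "principal_action (P \<times>\<times> P) M g x \<in> carrier A"
    if "g \<in> carrier (P \<times>\<times> P)" "x \<in> carrier A" for g x
    using principal_action_hom [OF that(1)] that by (auto simp: hom_def)
  have pao: "principal_action (P \<times>\<times> P) M g \<one>\<^bsub>A\<^esub> = \<one>\<^bsub>A\<^esub>" if "g \<in> carrier (P \<times>\<times> P)" for g
    using hom_one [OF principal_action_hom [OF that]] by (simp add: A.is_group)
  have pai: "principal_action (P \<times>\<times> P) M g (inv\<^bsub>A\<^esub> x) = inv\<^bsub>A\<^esub> principal_action (P \<times>\<times> P) M g x"
    if "g \<in> carrier (P \<times>\<times> P)" "x \<in> carrier A" for g x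
    by (rule A.inv_equality [symmetric]) (use that pa [of g "inv\<^bsub>A\<^esub> x" x] pac pao in auto)
  show "\<beta> \<otimes>\<^bsub>B m\<^esub> \<gamma> \<in> carrier (B m)" if "\<beta> \<in> carrier (B m)" "\<gamma> \<in> carrier (B m)" for \<beta> \<gamma>
    using that val [OF that(1)] val [OF that(2)] cl
    by (auto simp: B m hom_def Pi_iff A.m_ac pa)
  show "\<one>\<^bsub>B m\<^esub> \<in> carrier (B m)"
    using cl by (auto simp: B o hom_def pao)
  show "\<one>\<^bsub>B m\<^esub> \<otimes>\<^bsub>B m\<^esub> \<beta> = \<beta>" if "\<beta> \<in> carrier (B m)" for \<beta>
    by (rule extensionalityI [of _ "carrier ?L"]) (use that val [OF that] in \<open>auto simp: m o B\<close>)
  show "\<exists>\<gamma> \<in> carrier (B m). \<gamma> \<otimes>\<^bsub>B m\<^esub> \<beta> = \<one>\<^bsub>B m\<^esub>" if "\<beta> \<in> carrier (B m)" for \<beta>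
  proof
    show "(\<lambda>c \<in> carrier ?L. inv\<^bsub>A\<^esub> \<beta> c) \<in> carrier (B m)"
      using that val [OF that] cl by (auto simp: B hom_def Pi_iff A.inv_mult pai)
    show "(\<lambda>c \<in> carrier ?L. inv\<^bsub>A\<^esub> \<beta> c) \<otimes>\<^bsub>B m\<^esub> \<beta> = \<one>\<^bsub>B m\<^esub>"
      using val [OF that] by (auto simp: m o)
  qed
  show "\<alpha> \<otimes>\<^bsub>B m\<^esub> \<beta> \<otimes>\<^bsub>B m\<^esub> \<gamma> = \<alpha> \<otimes>\<^bsub>B m\<^esub> (\<beta> \<otimes>\<^bsub>B m\<^esub> \<gamma>)"
    if "\<alpha> \<in> carrier (B m)" "\<beta> \<in> carrier (B m)" "\<gamma> \<in> carrier (B m)" for \<alpha> \<beta> \<gamma>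
    using val [OF that(1)] val [OF that(2)] val [OF that(3)] by (auto simp: m A.m_assoc)
qed

text \<open>The coboundary map is multiplicative, so the coset is the image of
  \<open>carrier (B m)\<close> multiplied by \<open>\<beta>\<close>, and right multiplication by
  \<open>\<beta>\<close> permutes the group \<open>B m\<close>.\<close>

lemma coboundaries_coset:
  assumes "\<psi> \<in> coboundaries B (group_coboundary (P \<times>\<times> P)) (Suc m)"
  shows "coboundaries B (group_coboundary (P \<times>\<times> P)) (Suc m) #>\<^bsub>B (Suc m)\<^esub> \<psi>
       = coboundaries B (group_coboundary (P \<times>\<times> P)) (Suc m)"
proof -
  interpret Bm: group "B m" by (rule group_principal_cochains)
  let ?d = "group_coboundary (P \<times>\<times> P) m"
  obtain \<beta> where \<beta>: "\<beta> \<in> carrier (B m)" "\<psi> = ?d \<beta>" using assms by (auto simp: coboundaries_def)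
  have "?d ` carrier (B m) #>\<^bsub>B (Suc m)\<^esub> \<psi> = (\<lambda>\<gamma>. ?d (\<gamma> \<otimes>\<^bsub>B m\<^esub> \<beta>)) ` carrier (B m)"
    using \<beta> by (force simp: r_coset_def coboundary_mult)
  also have "\<dots> = ?d ` (\<lambda>\<gamma>. \<gamma> \<otimes>\<^bsub>B m\<^esub> \<beta>) ` carrier (B m)" by (simp add: image_image)
  also have "(\<lambda>\<gamma>. \<gamma> \<otimes>\<^bsub>B m\<^esub> \<beta>) ` carrier (B m) = carrier (B m)"
  proof
    show "carrier (B m) \<subseteq> (\<lambda>\<gamma>. \<gamma> \<otimes>\<^bsub>B m\<^esub> \<beta>) ` carrier (B m)"
    proof
      fix x assume "x \<in> carrier (B m)"
      then have "x = (x \<otimes>\<^bsub>B m\<^esub> inv\<^bsub>B m\<^esub> \<beta>) \<otimes>\<^bsub>B m\<^esub> \<beta>" "x \<otimes>\<^bsub>B m\<^esub> inv\<^bsub>B m\<^esub> \<beta> \<in> carrier (B m)"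
        using \<beta>(1) by (simp_all add: Bm.m_assoc)
      then show "x \<in> (\<lambda>\<gamma>. \<gamma> \<otimes>\<^bsub>B m\<^esub> \<beta>) ` carrier (B m)" by blast
    qed
  qed (use \<beta>(1) in auto)
  finally show ?thesis by (simp add: coboundaries_def)
qed

text \<open>Every representative of \<open>\<alpha>\<close> is a principal cocycle at the orbit of
  the trivial group, hence goes to a coboundary by \<open>triv\<close>. All cosets in the image
  therefore equal the trivial one, which also makes \<open>the_elem\<close> meaningful.\<close>

lemma Phi_eq_one:
  assumes \<alpha>: "\<alpha> \<in> carrier (bredon_HD P M (Suc m))"
    and triv: "\<And>\<phi>. principal_cocycle P M (Suc m) (\<phi> pt) \<Longrightarrow>
       Phi_cochain P (Suc m) \<phi> \<in> coboundaries B (group_coboundary (P \<times>\<times> P)) (Suc m)"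
  shows "Phi P M (Suc m) \<alpha> = \<one>\<^bsub>principal_cohomology P M (Suc m)\<^esub>"
proof -
  let ?Z = "(C (Suc m))\<lparr>carrier := cocycles C \<delta> (Suc m)\<rparr>"
  let ?D = "coboundaries B (group_coboundary (P \<times>\<times> P)) (Suc m)"
  obtain \<phi>0 where \<phi>0: "\<phi>0 \<in> cocycles C \<delta> (Suc m)" "\<alpha> = coboundaries C \<delta> (Suc m) #>\<^bsub>?Z\<^esub> \<phi>0"
    using \<alpha> by (auto simp: bredon_HD_def bredon_cohomology_def cohomology_group_def carrier_FactGroup RCOSETS_def)
  have "\<alpha> \<noteq> {}"
    using bredon_class_nonempty [of m] by (auto simp: \<phi>0(2) r_coset_def coboundaries_def)
  have "principal_cocycle P M (Suc m) (\<phi> pt)" if in_class: "\<phi> \<in> \<alpha>" for \<phi>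
  proof -
    obtain b where b: "b \<in> coboundaries C \<delta> (Suc m)" "\<phi> = b \<otimes>\<^bsub>C (Suc m)\<^esub> \<phi>0"
      using in_class by (auto simp: \<phi>0(2) r_coset_def)
    have "\<phi> pt c = b pt c \<otimes>\<^bsub>A\<^esub> \<phi>0 pt c"
      if "Poly_Mapping.keys c \<subseteq> ordered_simplices (carrier P) (Suc (Suc m))" for c
    proof -
      have "c \<in> carrier (module_at (N (Suc m)) pt)" using that by (simp add: module_N_pt)
      then show ?thesis using diagonal_family.trivial [of P]
        by (simp add: b(2) bredon_cochains_def orbit_hom_def principal_component_def)
    qed
    moreover have "principal_cocycle P M (Suc m) (\<lambda>c. b pt c \<otimes>\<^bsub>A\<^esub> \<phi>0 pt c)"
      by (intro principal_cocycle_mult coboundaries_pt b(1) cocycles_pt \<phi>0(1))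
    ultimately show ?thesis
      by (rule principal_cocycle_cong [OF _ P])
  qed
  then have "?D #>\<^bsub>B (Suc m)\<^esub> Phi_cochain P (Suc m) \<phi> = ?D" if "\<phi> \<in> \<alpha>" for \<phi>
    using coboundaries_coset triv that by blast
  then have "(\<lambda>\<phi>. ?D #>\<^bsub>B (Suc m)\<^esub> Phi_cochain P (Suc m) \<phi>) ` \<alpha> = {?D}"
    using \<open>\<alpha> \<noteq> {}\<close> by auto
  then show ?thesis
    by (simp add: Phi_def principal_cohomology_def group_cohomology_def cohomology_group_def
        principal_cochains_def)
qed

end

section \<open>Filling cubes\<close>

lemma powertop_real_euclidean: "powertop_real UNIV = (euclidean :: (nat \<Rightarrow> real) topology)"
  using euclidean_product_topology by simp

lemma continuous_map_closed_Un:
  fixes S T :: "'c::topological_space set"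
  assumes "closed S" "closed T" "continuous_map (top_of_set S) X f" "continuous_map (top_of_set T) X f"
  shows "continuous_map (top_of_set (S \<union> T)) X f"
  unfolding continuous_map_closedin
proof (intro conjI allI impI)
  show "f \<in> topspace (top_of_set (S \<union> T)) \<rightarrow> topspace X"
    using assms(3,4) by (auto simp: continuous_map_def)
  fix C assume C: "closedin X C"
  have "closedin (top_of_set S) {x \<in> topspace (top_of_set S). f x \<in> C}"
    "closedin (top_of_set T) {x \<in> topspace (top_of_set T). f x \<in> C}"
    using assms(3,4) C unfolding continuous_map_closedin by blast+
  then have "closed {x \<in> S. f x \<in> C}" "closed {x \<in> T. f x \<in> C}"
    using assms(1,2) closedin_closed_trans by auto
  then have "closed ({x \<in> S. f x \<in> C} \<union> {x \<in> T. f x \<in> C})" by (rule closed_Un)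
  moreover have "{x \<in> topspace (top_of_set (S \<union> T)). f x \<in> C} = {x \<in> S. f x \<in> C} \<union> {x \<in> T. f x \<in> C}"
    by auto
  ultimately show "closedin (top_of_set (S \<union> T)) {x \<in> topspace (top_of_set (S \<union> T)). f x \<in> C}"
    by (metis (no_types, lifting) Un_mono closed_subset mem_Collect_eq subsetI)
qed

lemma continuous_map_via:
  assumes "continuous_map (top_of_set T) X f" "continuous_on S m" "m \<in> S \<rightarrow> T"
    "\<And>x. x \<in> S \<Longrightarrow> g x = f (m x)"
  shows "continuous_map (top_of_set S) X g"
proof -
  have "continuous_map (top_of_set S) (top_of_set T) m"
    using assms(2,3) by (auto simp: continuous_map_in_subtopology)
  then have "continuous_map (top_of_set S) X (f \<circ> m)"
    using assms(1) continuous_map_compose by blast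
  then show ?thesis
    by (rule continuous_map_eq) (use assms(4) in auto)
qed

lemma continuous_on_fun_upd:
  fixes m :: "'c::topological_space \<Rightarrow> nat \<Rightarrow> real"
  assumes "continuous_on S m" "continuous_on S e"
  shows "continuous_on S (\<lambda>x. (m x)(q := e x))"
proof (rule continuous_on_coordinatewise_then_product)
  fix i
  show "continuous_on S (\<lambda>x. ((m x)(q := e x)) i)"
    using assms continuous_on_product_then_coordinatewise [OF assms(1)] by (cases "i = q") auto
qed

lemma continuous_on_coord [continuous_intros]: "continuous_on S (\<lambda>x. (x :: nat \<Rightarrow> real) i)"
  by (rule continuous_on_product_then_coordinatewise [OF continuous_on_id])

text \<open>Trailing coordinates are 0, so all cubes lie in one function space and the face
  \<open>x n = 0\<close> of \<open>cub (Suc n)\<close> is literally \<open>cub n\<close>.\<close>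

definition cub :: "nat \<Rightarrow> (nat \<Rightarrow> real) set" where
  "cub n = {x. (\<forall>i<n. 0 \<le> x i \<and> x i \<le> 1) \<and> (\<forall>i\<ge>n. x i = 0)}"

lemma unit_cube_eq: "unit_cube n = top_of_set (cub n)"
proof -
  have "unit_cube n = subtopology (powertop_real UNIV) ({x. \<forall>i\<ge>n. x i = 0} \<inter> {x. \<forall>i<n. 0 \<le> x i \<and> x i \<le> 1})"
    by (simp add: unit_cube_def Euclidean_space_def subtopology_subtopology)
  also have "{x. \<forall>i\<ge>n. x i = 0} \<inter> {x. \<forall>i<n. 0 \<le> x i \<and> x i \<le> 1} = cub n"
    by (auto simp: cub_def)
  finally show ?thesis by (simp add: powertop_real_euclidean)
qed

lemma compact_cub: "compact (cub n)"
proof -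
  have "compactin (powertop_real UNIV) (PiE UNIV (\<lambda>i. if i < n then {0..1} else {0::real}))"
    by (auto simp: compactin_PiE)
  moreover have "PiE UNIV (\<lambda>i. if i < n then {0..1} else {0::real}) = cub n"
  proof -
    have "x i \<in> (if i < n then {0..1} else {0::real}) \<longleftrightarrow> (i < n \<longrightarrow> 0 \<le> x i \<and> x i \<le> 1) \<and> (n \<le> i \<longrightarrow> x i = 0)"
      for x :: "nat \<Rightarrow> real" and i
      by (auto simp: not_less)
    then show ?thesis by (simp add: PiE_def Pi_def all_conj_distrib cub_def)
  qed
  ultimately show ?thesis by (simp add: powertop_real_euclidean)
qed

lemma closed_coord: "closed {x :: nat \<Rightarrow> real. x i = c}"
  by (intro closed_Collect_eq continuous_intros)

text \<open>Maximum-norm distance of the first \<open>n\<close> coordinates from the centre of the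
  cube, scaled so that the boundary is the level 1.\<close>

primrec rho :: "nat \<Rightarrow> (nat \<Rightarrow> real) \<Rightarrow> real" where
  "rho 0 x = 0"
| "rho (Suc n) x = max (rho n x) \<bar>2 * x n - 1\<bar>"

lemma continuous_on_rho: "continuous_on S (rho n)"
  by (induction n) (auto intro!: continuous_intros)

lemma rho_ge: "i < n \<Longrightarrow> \<bar>2 * x i - 1\<bar> \<le> rho n x"
  by (induction n) (auto simp: less_Suc_eq)

lemma rho_le1: "(\<And>i. i < n \<Longrightarrow> 0 \<le> x i \<and> x i \<le> 1) \<Longrightarrow> rho n x \<le> 1"
  by (induction n) (force simp: abs_le_iff)+

lemma rho_attained: "rho n x = 0 \<or> (\<exists>i<n. rho n x = \<bar>2 * x i - 1\<bar>)"
  by (induction n) (auto simp: max_def less_Suc_eq)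

text \<open>The face left out is \<open>x n = 1\<close>; every filling constructed below is read off
  on that face.\<close>

definition openbox :: "nat \<Rightarrow> (nat \<Rightarrow> real) set" where
  "openbox n = {x \<in> cub (Suc n). x n = 0 \<or> (\<exists>i<n. x i = 0 \<or> x i = 1)}"

text \<open>Projection onto the open box from the point above the centre of the missing face at height 2.\<close>

definition retr :: "nat \<Rightarrow> (nat \<Rightarrow> real) \<Rightarrow> nat \<Rightarrow> real" where
  "retr n x = (let m = max ((2 - x n) / 2) (rho n x) in
     (\<lambda>i. if i < n then 1/2 + (x i - 1/2) / m else if i = n then 2 - (2 - x n) / m else 0))"

lemma continuous_on_retr: "continuous_on (cub (Suc n)) (retr n)"
proof (rule continuous_on_coordinatewise_then_product)
  fix i
  have "max ((2 - x n) / 2) (rho n x) \<noteq> 0" if "x \<in> cub (Suc n)" for x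
    using that by (auto simp: cub_def max_def dest!: spec [of _ n])
  then have "continuous_on (cub (Suc n)) (\<lambda>x. 1/2 + (x i - 1/2) / max ((2 - x n) / 2) (rho n x))"
     "continuous_on (cub (Suc n)) (\<lambda>x. 2 - (2 - x n) / max ((2 - x n) / 2) (rho n x))"
    by (auto intro!: continuous_intros continuous_on_rho)
  then show "continuous_on (cub (Suc n)) (\<lambda>x. retr n x i)"
    by (cases "i < n"; cases "i = n") (simp_all add: retr_def Let_def)
qed

text \<open>The term attaining the maximum decides where the ray from the apex leaves the cube:
  \<open>(2 - x n) / 2\<close> means through the bottom, \<open>rho n x\<close> through a side. The
  bound \<open>m \<ge> 1/2\<close> holds because the apex has height 2, and \<open>m \<le> 1\<close>
  keeps the last coordinate at most 1.\<close>

lemma retr_openbox: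
  assumes "x \<in> cub (Suc n)"
  shows "retr n x \<in> openbox n"
proof -
  define m where "m = max ((2 - x n) / 2) (rho n x)"
  have xn: "0 \<le> x n" "x n \<le> 1" and xi: "\<And>i. i < n \<Longrightarrow> 0 \<le> x i \<and> x i \<le> 1" using assms by (auto simp: cub_def)
  have m: "m \<ge> 1/2" "m \<ge> (2 - x n) / 2" "m \<ge> rho n x" using xn by (auto simp: m_def max_def)
  have m1: "m \<le> 1" using xn rho_le1 [of n x] xi by (auto simp: m_def)
  have r: "retr n x i = (if i < n then 1/2 + (x i - 1/2) / m else if i = n then 2 - (2 - x n) / m else 0)" for i
    by (simp add: retr_def Let_def m_def)
  have coord: "0 \<le> 1/2 + (x i - 1/2) / m \<and> 1/2 + (x i - 1/2) / m \<le> 1" if "i < n" for i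
  proof -
    have "\<bar>2 * x i - 1\<bar> \<le> m" using rho_ge [OF that, of x] m(3) by linarith
    then show ?thesis using m(1) by (simp add: field_simps abs_le_iff)
  qed
  have last: "0 \<le> 2 - (2 - x n) / m" "2 - (2 - x n) / m \<le> 1"
    using m m1 xn by (simp_all add: field_simps)
  have "retr n x \<in> cub (Suc n)"
    using coord last by (auto simp: cub_def r less_Suc_eq)
  moreover have "retr n x n = 0 \<or> (\<exists>i<n. retr n x i = 0 \<or> retr n x i = 1)"
  proof (cases "m = (2 - x n) / 2")
    case True
    then have "(2 - x n) / m = 2" using m(1) by (simp add: field_simps)
    then show ?thesis by (simp add: r)
  next
    case False
    then have "m = rho n x" by (auto simp: m_def max_def split: if_splits)
    then obtain i where i: "i < n" "m = \<bar>2 * x i - 1\<bar>" using rho_attained [of n x] m(1) by auto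
    have "2 * x i - 1 = m \<or> 2 * x i - 1 = - m" using i(2) by linarith
    then have "1/2 + (x i - 1/2) / m = 0 \<or> 1/2 + (x i - 1/2) / m = 1"
      using m(1) by (auto simp: field_simps)
    then show ?thesis using i(1) by (auto simp: r)
  qed
  ultimately show ?thesis by (simp add: openbox_def)
qed

text \<open>On the open box the scaling factor is 1.\<close>

lemma retr_id:
  assumes "x \<in> openbox n"
  shows "retr n x = x"
proof -
  have xn: "0 \<le> x n" "x n \<le> 1" and xi: "\<And>i. i < n \<Longrightarrow> 0 \<le> x i \<and> x i \<le> 1"
    and x0: "\<And>i. i > n \<Longrightarrow> x i = 0" using assms by (auto simp: openbox_def cub_def)
  have le: "rho n x \<le> 1" using rho_le1 xi by blast
  consider "x n = 0" | i where "i < n" "x i = 0 \<or> x i = 1" using assms by (auto simp: openbox_def)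
  then have "max ((2 - x n) / 2) (rho n x) = 1"
  proof cases
    case 1 then show ?thesis using le by (simp add: max_def)
  next
    case (2 i)
    then have "rho n x = 1" using rho_ge [of i n x] le by auto
    then show ?thesis using xn by (simp add: max_def)
  qed
  then show ?thesis using x0 by (auto simp: retr_def Let_def fun_eq_iff)
qed

lemma openbox_fill:
  assumes "continuous_map (top_of_set (openbox n)) X g"
  shows "continuous_map (top_of_set (cub (Suc n))) X (g \<circ> retr n)"
  by (rule continuous_map_via [OF assms continuous_on_retr]) (auto simp: retr_openbox)

subsection \<open>Squares\<close>

text \<open>A square with bottom \<open>p\<close>, top \<open>q\<close>, left side \<open>r\<close> and right side \<open>t\<close>.\<close>

definition Sq :: "'a topology \<Rightarrow> (real \<Rightarrow> 'a) \<Rightarrow> (real \<Rightarrow> 'a) \<Rightarrow> (real \<Rightarrow> 'a) \<Rightarrow> (real \<Rightarrow> 'a) \<Rightarrow> bool" where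
  "Sq X p q r t \<longleftrightarrow> (\<exists>h. continuous_map (top_of_set ({0..1} \<times> {0..1})) X h \<and>
     (\<forall>u\<in>{0..1}. h (u, 0) = p u \<and> h (u, 1) = q u \<and> h (0, u) = r u \<and> h (1, u) = t u))"

text \<open>Five faces of a 3-cube are prescribed and the sixth is obtained from
  \<open>openbox_fill\<close>. The paths \<open>c00\<close> to \<open>c11\<close> are the tracks of
  the four corners; the lemma moves the sides of a square along compatible homotopies.\<close>

lemma Sq_box:
  assumes "Sq X p0 q0 r0 t0" "Sq X c00 c10 p0 p1" "Sq X c01 c11 q0 q1" "Sq X c00 c01 r0 r1" "Sq X c10 c11 t0 t1"
  shows "Sq X p1 q1 r1 t1"
proof -
  let ?I = "{0..1::real}"
  obtain h0 where h0: "continuous_map (top_of_set (?I \<times> ?I)) X h0"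
    "\<And>u. u \<in> ?I \<Longrightarrow> h0 (u, 0) = p0 u \<and> h0 (u, 1) = q0 u \<and> h0 (0, u) = r0 u \<and> h0 (1, u) = t0 u"
    using assms(1) by (auto simp: Sq_def)
  obtain hp where hp: "continuous_map (top_of_set (?I \<times> ?I)) X hp"
    "\<And>u. u \<in> ?I \<Longrightarrow> hp (u, 0) = c00 u \<and> hp (u, 1) = c10 u \<and> hp (0, u) = p0 u \<and> hp (1, u) = p1 u"
    using assms(2) by (auto simp: Sq_def)
  obtain hq where hq: "continuous_map (top_of_set (?I \<times> ?I)) X hq"
    "\<And>u. u \<in> ?I \<Longrightarrow> hq (u, 0) = c01 u \<and> hq (u, 1) = c11 u \<and> hq (0, u) = q0 u \<and> hq (1, u) = q1 u"
    using assms(3) by (auto simp: Sq_def)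
  obtain hr where hr: "continuous_map (top_of_set (?I \<times> ?I)) X hr"
    "\<And>u. u \<in> ?I \<Longrightarrow> hr (u, 0) = c00 u \<and> hr (u, 1) = c01 u \<and> hr (0, u) = r0 u \<and> hr (1, u) = r1 u"
    using assms(4) by (auto simp: Sq_def)
  obtain ht where ht: "continuous_map (top_of_set (?I \<times> ?I)) X ht"
    "\<And>u. u \<in> ?I \<Longrightarrow> ht (u, 0) = c10 u \<and> ht (u, 1) = c11 u \<and> ht (0, u) = t0 u \<and> ht (1, u) = t1 u"
    using assms(5) by (auto simp: Sq_def)
  \<comment> \<open>Coordinates 0 and 1 are those of the squares, coordinate 2 is the deformation
    parameter. On common edges the order of the cases does not matter, since adjacent squares share
    the path named there.\<close>
  define E where "E = (\<lambda>x::nat\<Rightarrow>real. if x 2 = 0 then h0 (x 0, x 1) else if x 1 = 0 then hp (x 2, x 0)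
      else if x 1 = 1 then hq (x 2, x 0) else if x 0 = 0 then hr (x 2, x 1) else ht (x 2, x 1))"
  define F where "F = (\<lambda>i c. cub 3 \<inter> {x :: nat \<Rightarrow> real. x i = c})"
  have cl: "closed (F i c)" for i c
    unfolding F_def by (intro closed_Int compact_imp_closed compact_cub closed_coord)
  have I: "x 0 \<in> ?I" "x (Suc 0) \<in> ?I" "x 2 \<in> ?I" if "x \<in> F i c" for x i c
    using that by (auto simp: F_def cub_def)
  have 0: "continuous_map (top_of_set (F 2 0)) X E"
    by (rule continuous_map_via [OF h0(1), where m = "\<lambda>x. (x 0, x 1)"])
      (use I in \<open>auto intro!: continuous_intros simp: E_def F_def\<close>)
  have 1: "continuous_map (top_of_set (F 1 0)) X E"
    by (rule continuous_map_via [OF hp(1), where m = "\<lambda>x. (x 2, x 0)"])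
      (use I [of _ 1 0] h0 hp in \<open>auto intro!: continuous_intros simp: E_def F_def\<close>)
  have 2: "continuous_map (top_of_set (F 1 1)) X E"
    by (rule continuous_map_via [OF hq(1), where m = "\<lambda>x. (x 2, x 0)"])
      (use I [of _ 1 1] h0 hq in \<open>auto intro!: continuous_intros simp: E_def F_def\<close>)
  have 3: "continuous_map (top_of_set (F 0 0)) X E"
    by (rule continuous_map_via [OF hr(1), where m = "\<lambda>x. (x 2, x 1)"])
      (use I [of _ 0 0] h0 hp hq hr in \<open>auto intro!: continuous_intros simp: E_def F_def\<close>)
  have 4: "continuous_map (top_of_set (F 0 1)) X E"
    by (rule continuous_map_via [OF ht(1), where m = "\<lambda>x. (x 2, x 1)"])
      (use I [of _ 0 1] h0 hp hq ht in \<open>auto intro!: continuous_intros simp: E_def F_def\<close>)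
  have "openbox 2 = F 2 0 \<union> (F 1 0 \<union> (F 1 1 \<union> (F 0 0 \<union> F 0 1)))"
    by (auto simp: openbox_def F_def numeral_eq_Suc less_Suc_eq)
  then have "continuous_map (top_of_set (openbox 2)) X E"
    by (simp only:) (intro continuous_map_closed_Un closed_Un cl 0 1 2 3 4)
  note fill = openbox_fill [OF this]
  \<comment> \<open>The missing face \<open>x 2 = 1\<close>, parametrised by the square.\<close>
  define pt where "pt = (\<lambda>(u, v). (\<lambda>_. 0)(0 := u, 1 := v, 2 := 1 :: real) :: nat \<Rightarrow> real)"
  have ptcont: "continuous_on (?I \<times> ?I) pt"
    unfolding pt_def split_def
    by (intro continuous_on_fun_upd continuous_on_const continuous_on_fst continuous_on_snd
        continuous_on_id continuous_on_diff)
  have ptc: "pt (u, v) \<in> cub 3" if "u \<in> ?I" "v \<in> ?I" for u v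
    using that by (auto simp: pt_def cub_def)
  have pto: "retr 2 (pt (u, v)) = pt (u, v)" if "u \<in> ?I" "v \<in> ?I" "u = 0 \<or> u = 1 \<or> v = 0 \<or> v = 1" for u v
  proof (rule retr_id)
    have "\<exists>i<2. pt (u, v) i = 0 \<or> pt (u, v) i = 1"
      using that(3) by (intro exI [of _ "if u = 0 \<or> u = 1 then 0 else 1 :: nat"]) (auto simp: pt_def)
    then show "pt (u, v) \<in> openbox 2" using ptc [OF that(1,2)] by (simp add: openbox_def)
  qed
  have "continuous_map (top_of_set (?I \<times> ?I)) X (E \<circ> retr 2 \<circ> pt)"
    by (rule continuous_map_via [OF fill, where m = pt])
      (use ptc ptcont in \<open>auto simp: numeral_3_eq_3\<close>)
  moreover have "\<forall>u\<in>?I. (E \<circ> retr 2 \<circ> pt) (u, 0) = p1 u \<and> (E \<circ> retr 2 \<circ> pt) (u, 1) = q1 u \<and>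
      (E \<circ> retr 2 \<circ> pt) (0, u) = r1 u \<and> (E \<circ> retr 2 \<circ> pt) (1, u) = t1 u"
  proof
    fix u assume u: "u \<in> ?I"
    have E: "E (pt (u, v)) = (if v = 0 then hp (1, u) else if v = 1 then hq (1, u)
        else if u = 0 then hr (1, v) else ht (1, v))" for u v
      by (simp add: E_def pt_def)
    have "hr (1, 0) = hp (1, 0)" "hr (1, 1) = hq (1, 0)" "ht (1, 0) = hp (1, 1)" "ht (1, 1) = hq (1, 1)"
      using hp(2) [of 1] hq(2) [of 1] hr(2) [of 1] ht(2) [of 1] by auto
    then show "(E \<circ> retr 2 \<circ> pt) (u, 0) = p1 u \<and> (E \<circ> retr 2 \<circ> pt) (u, 1) = q1 u \<and>
      (E \<circ> retr 2 \<circ> pt) (0, u) = r1 u \<and> (E \<circ> retr 2 \<circ> pt) (1, u) = t1 u"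
      using u hp(2) [OF u] hq(2) [OF u] hr(2) [OF u] ht(2) [OF u] by (auto simp: pto E)
  qed
  ultimately show ?thesis unfolding Sq_def by blast
qed

text \<open>The filling of an open box in dimension 2: three sides are prescribed and the filling
  produces the fourth.\<close>

lemma Sq_open:
  assumes "pathin X q" "pathin X r" "pathin X t" "r 1 = q 0" "q 1 = t 1"
  obtains p where "Sq X p q r t"
proof -
  let ?I = "{0..1::real}"
  \<comment> \<open>Coordinate 1 is one minus the height in the square, so that the missing face
    \<open>x 1 = 1\<close> becomes the bottom and the given top \<open>q\<close> sits at
    \<open>x 1 = 0\<close>.\<close>
  define E where "E = (\<lambda>x::nat\<Rightarrow>real. if x 1 = 0 then q (x 0) else if x 0 = 0 then r (1 - x 1) else t (1 - x 1))"
  define F where "F = (\<lambda>i c. cub 2 \<inter> {x :: nat \<Rightarrow> real. x i = c})"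
  have cl: "closed (F i c)" for i c
    unfolding F_def by (intro closed_Int compact_imp_closed compact_cub closed_coord)
  have I: "x 0 \<in> ?I" "x (Suc 0) \<in> ?I" if "x \<in> F i c" for x i c
    using that by (auto simp: F_def cub_def)
  have 0: "continuous_map (top_of_set (F 1 0)) X E"
    by (rule continuous_map_via [OF assms(1) [unfolded pathin_def], where m = "\<lambda>x. x 0"])
      (use I in \<open>auto intro!: continuous_intros simp: E_def F_def\<close>)
  have 1: "continuous_map (top_of_set (F 0 0)) X E"
    by (rule continuous_map_via [OF assms(2) [unfolded pathin_def], where m = "\<lambda>x. 1 - x 1"])
      (use I [of _ 0 0] assms in \<open>auto intro!: continuous_intros simp: E_def F_def\<close>)
  have 2: "continuous_map (top_of_set (F 0 1)) X E"
    by (rule continuous_map_via [OF assms(3) [unfolded pathin_def], where m = "\<lambda>x. 1 - x 1"])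
      (use I [of _ 0 1] assms in \<open>auto intro!: continuous_intros simp: E_def F_def\<close>)
  have "openbox 1 = F 1 0 \<union> (F 0 0 \<union> F 0 1)"
    by (auto simp: openbox_def F_def numeral_eq_Suc less_Suc_eq)
  then have "continuous_map (top_of_set (openbox 1)) X E"
    by (simp only:) (intro continuous_map_closed_Un closed_Un cl 0 1 2)
  note fill = openbox_fill [OF this]
  define pt where "pt = (\<lambda>(u, v). (\<lambda>_. 0)(0 := u, 1 := 1 - v :: real) :: nat \<Rightarrow> real)"
  have ptcont: "continuous_on (?I \<times> ?I) pt"
    unfolding pt_def split_def
    by (intro continuous_on_fun_upd continuous_on_const continuous_on_fst continuous_on_snd
        continuous_on_id continuous_on_diff)
  have ptc: "pt (u, v) \<in> cub 2" if "u \<in> ?I" "v \<in> ?I" for u v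
    using that by (auto simp: pt_def cub_def)
  have pto: "retr 1 (pt (u, v)) = pt (u, v)" if "u \<in> ?I" "v \<in> ?I" "u = 0 \<or> u = 1 \<or> v = 1" for u v
    by (rule retr_id) (use that in \<open>auto simp: openbox_def cub_def pt_def\<close>)
  have c: "continuous_map (top_of_set (?I \<times> ?I)) X (E \<circ> retr 1 \<circ> pt)"
    by (rule continuous_map_via [OF fill, where m = pt])
      (use ptc ptcont in \<open>auto simp: numeral_2_eq_2\<close>)
  have E: "E (pt (u, v)) = (if v = 1 then q u else if u = 0 then r v else t v)" for u v
    by (simp add: E_def pt_def)
  have "\<forall>u\<in>?I. (E \<circ> retr 1 \<circ> pt) (u, 1) = q u \<and> (E \<circ> retr 1 \<circ> pt) (0, u) = r u
      \<and> (E \<circ> retr 1 \<circ> pt) (1, u) = t u"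
    using assms(4,5) by (simp add: pto [unfolded One_nat_def] E)
  then have "Sq X (\<lambda>u. (E \<circ> retr 1 \<circ> pt) (u, 0)) q r t"
    unfolding Sq_def using c by blast
  then show ?thesis by (rule that)
qed

section \<open>Null homotopies of spheroids and fillings of cubes\<close>

lemma continuous_on_snd_coord: "continuous_on S (\<lambda>z :: 'c::topological_space \<times> (nat \<Rightarrow> real). snd z i)"
  by (rule continuous_on_product_then_coordinatewise [OF continuous_on_snd [OF continuous_on_id]])

lemma prod_unit_cube_eq:
  "prod_topology (top_of_set {0..1}) (unit_cube n) = top_of_set ({0..1 :: real} \<times> cub n)"
  unfolding unit_cube_eq by (rule prod_topology_subtopology_eu)

lemma cub_drop: "x \<in> cub (Suc n) \<Longrightarrow> x(n := 0) \<in> cub n"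
  by (simp add: cub_def)

lemma cub_upd: "\<lbrakk>x \<in> cub n; i < n; 0 \<le> c; c \<le> 1\<rbrakk> \<Longrightarrow> x(i := c) \<in> cub n"
  by (simp add: cub_def)

lemma homotopic_withE:
  assumes "homotopic_with Q X Y f g"
  obtains H where "continuous_map (prod_topology (top_of_set {0..1::real}) X) Y H"
    "\<forall>x. H (0, x) = f x" "\<forall>x. H (1, x) = g x" "\<forall>t\<in>{0..1}. Q (\<lambda>x. H (t, x))"
  using assms unfolding homotopic_with_def by blast

definition bdcub :: "nat \<Rightarrow> (nat \<Rightarrow> real) set" where
  "bdcub n = {x \<in> cub n. \<exists>i<n. x i = 0 \<or> x i = 1}"

lemma cube_boundary_eq: "cube_boundary n = bdcub n"
  by (simp add: cube_boundary_def bdcub_def unit_cube_eq)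

text \<open>The only element of the group is also the class of the constant map. The constant map
  lies in its own class, hence in that of \<open>f\<close>, and this membership is the homotopy
  relative to the boundary.\<close>

lemma spheroid_null:
  assumes "trivial_group (homotopy_group q X x0)" "continuous_map (top_of_set (cub q)) X f"
    "\<And>x. x \<in> bdcub q \<Longrightarrow> f x = x0" and x0: "x0 \<in> topspace X"
  obtains H where "continuous_map (top_of_set ({0..1::real} \<times> cub q)) X H"
    "\<And>x. x \<in> cub q \<Longrightarrow> H (0, x) = f x" "\<And>x. x \<in> cub q \<Longrightarrow> H (1, x) = x0"
    "\<And>t x. \<lbrakk>t \<in> {0..1}; x \<in> bdcub q\<rbrakk> \<Longrightarrow> H (t, x) = x0"
proof -
  let ?P = "\<lambda>h. h ` cube_boundary q \<subseteq> {x0}"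
  have "f \<in> spheroids q X x0"
    using assms(2,3) by (auto simp: spheroids_def unit_cube_eq cube_boundary_eq)
  moreover have c: "(\<lambda>_. x0) \<in> spheroids q X x0"
    using x0 by (auto simp: spheroids_def)
  moreover obtain A where "carrier (homotopy_group q X x0) = {A}"
    using assms(1) by (auto simp: trivial_group_def)
  ultimately have "spheroid_class q X x0 f = spheroid_class q X x0 (\<lambda>_. x0)"
    by (simp add: homotopy_group_def) (metis image_eqI singletonD)
  moreover have "(\<lambda>_. x0) \<in> spheroid_class q X x0 (\<lambda>_. x0)"
    using c by (auto simp: spheroid_class_def spheroids_def homotopic_with_refl)
  ultimately have "homotopic_with ?P (unit_cube q) X f (\<lambda>_. x0)"
    by (auto simp: spheroid_class_def)
  then obtain H where H: "continuous_map (prod_topology (top_of_set {0..1::real}) (unit_cube q)) X H"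
    "\<forall>x. H (0, x) = f x" "\<forall>x. H (1, x) = x0" "\<forall>t\<in>{0..1}. ?P (\<lambda>x. H (t, x))"
    unfolding homotopic_with_def by blast
  show ?thesis
  proof (rule that [of H])
    show "continuous_map (top_of_set ({0..1} \<times> cub q)) X H"
      using H(1) by (simp add: prod_unit_cube_eq)
    show "H (t, x) = x0" if "t \<in> {0..1}" "x \<in> bdcub q" for t x
      using H(4) that unfolding cube_boundary_eq by blast
  qed (use H in auto)
qed

text \<open>The open box \<open>J\<close> of the cube is contractible, so \<open>g\<close> may be deformed to be constant on \<open>J\<close>
  (the deformation is \<open>G\<close>); on the remaining face the deformed map is a spheroid.\<close>

theorem cube_fill:
  assumes triv: "trivial_group (homotopy_group q X x0)" and x0: "x0 \<in> topspace X"
    and g: "continuous_map (top_of_set (bdcub (Suc q))) X g" and g0: "g (\<lambda>_. 0) = x0"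
  obtains h where "continuous_map (top_of_set (cub (Suc q))) X h" "\<And>x. x \<in> bdcub (Suc q) \<Longrightarrow> h x = g x"
proof -
  let ?I = "{0..1::real}"
  have obd: "openbox q \<subseteq> bdcub (Suc q)"
    by (auto simp: openbox_def bdcub_def intro: less_SucI)
  \<comment> \<open>The cube is star-shaped about the origin, so scaling to 0 followed by
    \<open>retr q\<close> contracts the open box to its point 0, where \<open>g\<close> takes the
    value \<open>x0\<close>.\<close>
  define G where "G = (\<lambda>(t, y :: nat \<Rightarrow> real). g (retr q (\<lambda>i. (1 - t) * y i)))"
  have scale: "(\<lambda>i. (1 - t) * y i) \<in> cub n" if "t \<in> ?I" "y \<in> cub n" for t n and y :: "nat \<Rightarrow> real"
    using that by (auto simp: cub_def mult_le_one)
  have gq: "continuous_map (top_of_set (cub (Suc q))) X (g \<circ> retr q)"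
  proof (rule openbox_fill)
    show "continuous_map (top_of_set (openbox q)) X g"
      using g obd continuous_map_from_subtopology_mono by blast
  qed
  have Gc: "continuous_map (top_of_set (?I \<times> cub (Suc q))) X G"
  proof (rule continuous_map_via [OF gq, where m = "\<lambda>z. (\<lambda>i. (1 - fst z) * snd z i)"])
    show "continuous_on (?I \<times> cub (Suc q)) (\<lambda>z. (\<lambda>i. (1 - fst z) * snd z i))"
      by (rule continuous_on_coordinatewise_then_product) (intro continuous_intros continuous_on_snd_coord)
    show "(\<lambda>z. (\<lambda>i. (1 - fst z) * snd z i)) \<in> ?I \<times> cub (Suc q) \<rightarrow> cub (Suc q)"
      using scale by auto
  qed (simp add: G_def split_def)
  have G0: "G (0, y) = g y" if "y \<in> openbox q" for y
    using that by (simp add: G_def retr_id)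
  have "(\<lambda>_. 0) \<in> openbox q" by (auto simp: openbox_def cub_def)
  then have G1: "G (1, y) = x0" for y
    using g0 by (simp add: G_def retr_id)
  \<comment> \<open>The bottom carries \<open>g\<close> on the face missing from the open box, the
    sides carry the deformation \<open>G\<close> of the boundary of that face. Filling this box
    extends the deformation over the face.\<close>
  define D where "D = (\<lambda>z :: nat \<Rightarrow> real. if z q = 0 then g (z(q := 1)) else G (z q, z(q := 1)))"
  have z1: "z(q := 1) \<in> bdcub (Suc q)" if "z \<in> cub (Suc q)" for z
    using that by (auto simp: bdcub_def cub_def)
  have side: "z(q := 1) \<in> openbox q" if "z \<in> cub (Suc q)" "\<exists>i<q. z i = 0 \<or> z i = 1" for z
    using that by (auto simp: openbox_def cub_def)
  have zI: "z q \<in> ?I" if "z \<in> cub (Suc q)" for z using that by (auto simp: cub_def)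
  have Dside: "D z = G (z q, z(q := 1))" if "z \<in> cub (Suc q)" "\<exists>i<q. z i = 0 \<or> z i = 1" for z
    using G0 [OF side [OF that]] by (simp add: D_def)
  have closed_cub: "closed (cub n)" for n by (intro compact_imp_closed compact_cub)
  have closed_side: "closed {z :: nat \<Rightarrow> real. \<exists>i<n. z i = 0 \<or> z i = 1}" for n
  proof -
    have "{z :: nat \<Rightarrow> real. \<exists>i<n. z i = 0 \<or> z i = 1} = (\<Union>i<n. {z. z i = 0} \<union> {z. z i = 1})" by auto
    then show ?thesis by (auto intro!: closed_coord)
  qed
  have cu: "continuous_on S (\<lambda>x :: nat \<Rightarrow> real. x(i := c))" for S i c
    by (intro continuous_on_fun_upd continuous_on_id continuous_on_const)
  have Dc: "continuous_map (top_of_set (openbox q)) X D"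
  proof -
    have "continuous_map (top_of_set (cub (Suc q) \<inter> {z. z q = 0})) X D"
      by (rule continuous_map_via [OF g cu [of _ q 1]]) (auto simp: D_def z1)
    moreover have "continuous_map (top_of_set (cub (Suc q) \<inter> {z. \<exists>i<q. z i = 0 \<or> z i = 1})) X D"
      by (rule continuous_map_via [OF Gc, where m = "\<lambda>z. (z q, z(q := 1))"])
        (use z1 zI in \<open>auto simp: Dside bdcub_def intro!: continuous_intros cu\<close>)
    moreover have "openbox q = (cub (Suc q) \<inter> {z. z q = 0}) \<union> (cub (Suc q) \<inter> {z. \<exists>i<q. z i = 0 \<or> z i = 1})"
      by (auto simp: openbox_def)
    ultimately show ?thesis
      by (simp only:) (intro continuous_map_closed_Un closed_Int closed_cub closed_coord closed_side)
  qed
  define L where "L = D \<circ> retr q"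
  have Lc: "continuous_map (top_of_set (cub (Suc q))) X L"
    unfolding L_def by (rule openbox_fill [OF Dc])
  have LD: "L z = D z" if "z \<in> openbox q" for z using that by (simp add: L_def retr_id)
  \<comment> \<open>The end of the extended deformation. On the boundary of the face the deformation
    has ended at \<open>x0\<close>, so \<open>f\<close> is a spheroid.\<close>
  define f where "f = (\<lambda>z. L (z(q := 1)))"
  have up1: "z(q := 1) \<in> cub (Suc q)" if "z \<in> cub q" for z
    using that by (auto simp: cub_def)
  have fc: "continuous_map (top_of_set (cub q)) X f"
    by (rule continuous_map_via [OF Lc cu [of _ q 1]]) (auto simp: f_def up1)
  have fb: "f z = x0" if "z \<in> bdcub q" for z
  proof -
    have "z(q := 1) \<in> openbox q" using that by (auto simp: bdcub_def openbox_def cub_def)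
    then show ?thesis by (simp add: f_def LD D_def G1)
  qed
  obtain H where Hc: "continuous_map (top_of_set (?I \<times> cub q)) X H"
    and H0: "\<And>x. x \<in> cub q \<Longrightarrow> H (0, x) = f x" and H1: "\<And>x. x \<in> cub q \<Longrightarrow> H (1, x) = x0"
    and Hb: "\<And>t x. \<lbrakk>t \<in> ?I; x \<in> bdcub q\<rbrakk> \<Longrightarrow> H (t, x) = x0"
    using spheroid_null [OF triv fc fb x0] by blast
  let ?N = "Suc q"
  \<comment> \<open>One dimension up, with \<open>x ?N\<close> as time. At the bottom, the null
    homotopy of \<open>f\<close> fills the deformed boundary map; the walls run the deformation
    backwards, by \<open>L\<close> over \<open>x q = 1\<close> and by \<open>G\<close> over the
    other faces, collected in \<open>S2\<close>. The missing top is then bounded by \<open>g\<close>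
    itself.\<close>
  define E where "E = (\<lambda>x :: nat \<Rightarrow> real. if x ?N = 0 then H (1 - x q, x(q := 0))
     else if x q = 1 then L (x(?N := 0, q := 1 - x ?N)) else G (1 - x ?N, x(?N := 0)))"
  define S2 where "S2 = {x :: nat \<Rightarrow> real. x q = 0 \<or> (\<exists>i<q. x i = 0 \<or> x i = 1)}"
  have xI: "x q \<in> ?I" "x ?N \<in> ?I" "1 - x q \<in> ?I" "1 - x ?N \<in> ?I" if "x \<in> cub (Suc ?N)" for x
    using that by (auto simp: cub_def)
  have xN: "x(?N := 0) \<in> cub ?N" if "x \<in> cub (Suc ?N)" for x
    using cub_drop [OF that] .
  have x0q: "x(q := 0) \<in> cub q" if "x \<in> cub (Suc ?N)" "x ?N = 0" for x
    using cub_drop [OF xN [OF that(1)]] that(2) by (simp add: fun_upd_idem)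
  have xL: "x(?N := 0, q := 1 - x ?N) \<in> cub ?N" if "x \<in> cub (Suc ?N)" for x
    by (rule cub_upd [OF xN [OF that]]) (use xI [OF that] in auto)
  have E0: "continuous_map (top_of_set (cub (Suc ?N) \<inter> {x. x ?N = 0})) X E"
    by (rule continuous_map_via [OF Hc, where m = "\<lambda>x. (1 - x q, x(q := 0))"])
      (use xI x0q in \<open>auto simp: E_def intro!: continuous_intros cu\<close>)
  have Eq: "E x = L (x(?N := 0, q := 1 - x ?N))" if "x \<in> cub (Suc ?N)" "x q = 1" for x
  proof (cases "x ?N = 0")
    case True
    then have "E x = f (x(q := 0))" using that x0q [OF that(1) True] by (simp add: E_def H0)
    also have "\<dots> = L (x(?N := 0, q := 1 - x ?N))" using True by (simp add: f_def fun_upd_idem)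
    finally show ?thesis .
  qed (use that in \<open>simp add: E_def\<close>)
  have E1: "continuous_map (top_of_set (cub (Suc ?N) \<inter> {x. x q = 1})) X E"
    by (rule continuous_map_via [OF Lc, where m = "\<lambda>x. x(?N := 0, q := 1 - x ?N)"])
      (use xL in \<open>auto simp: Eq intro!: continuous_on_fun_upd [OF cu] continuous_on_diff continuous_on_const continuous_on_coord\<close>)
  have ES: "E x = G (1 - x ?N, x(?N := 0))" if x: "x \<in> cub (Suc ?N)" "x \<in> S2" for x
  proof (cases "x ?N = 0")
    case True
    have "E x = x0"
    proof (cases "x q = 0")
      case True
      then show ?thesis using x0q [OF x(1) \<open>x ?N = 0\<close>] \<open>x ?N = 0\<close> by (simp add: E_def H1)
    next
      case False
      then have "x(q := 0) \<in> bdcub q"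
        using x x0q [OF x(1) True] by (auto simp: S2_def bdcub_def)
      then show ?thesis using True xI [OF x(1)] by (simp add: E_def Hb)
    qed
    then show ?thesis using True by (simp add: G1)
  next
    case N: False
    show ?thesis
    proof (cases "x q = 1")
      case True
      define z where "z = x(?N := 0, q := 1 - x ?N)"
      have zc: "z \<in> cub ?N" using xL [OF x(1)] by (simp only: z_def)
      have zi: "z i = x i" if "i < q" for i using that by (simp add: z_def)
      have "\<exists>i<q. x i = 0 \<or> x i = 1" using x(2) True by (auto simp: S2_def)
      then have s: "\<exists>i<q. z i = 0 \<or> z i = 1" using zi by auto
      have zb: "z \<in> openbox q" using zc s by (simp add: openbox_def)
      have "L z = G (z q, z(q := 1))" using LD [OF zb] Dside [OF zc s] by simp
      moreover have "z(q := 1) = x(?N := 0)" using True by (simp add: z_def fun_eq_iff)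
      moreover have "z q = 1 - x ?N" by (simp add: z_def)
      ultimately show ?thesis using Eq [OF x(1) True] by (simp add: z_def)
    qed (use N in \<open>simp add: E_def\<close>)
  qed
  have E2: "continuous_map (top_of_set (cub (Suc ?N) \<inter> S2)) X E"
    by (rule continuous_map_via [OF Gc, where m = "\<lambda>x. (1 - x ?N, x(?N := 0))"])
      (use xN xI in \<open>auto simp: ES intro!: continuous_intros cu\<close>)
  have clS2: "closed S2"
  proof -
    have "S2 = {x. x q = 0} \<union> {x. \<exists>i<q. x i = 0 \<or> x i = 1}" by (auto simp: S2_def)
    then show ?thesis by (simp add: closed_side closed_coord closed_Un)
  qed
  have "openbox ?N = (cub (Suc ?N) \<inter> {x. x ?N = 0}) \<union> ((cub (Suc ?N) \<inter> {x. x q = 1}) \<union> (cub (Suc ?N) \<inter> S2))"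
    by (auto simp: openbox_def S2_def less_Suc_eq)
  then have "continuous_map (top_of_set (openbox ?N)) X E"
    by (simp only:) (intro continuous_map_closed_Un closed_Un closed_Int closed_cub closed_coord clS2 E0 E1 E2)
  note fill = openbox_fill [OF this]
  have yN: "y(?N := 1) \<in> cub (Suc ?N)" if "y \<in> cub ?N" for y
    using that by (auto simp: cub_def)
  show ?thesis
  proof (rule that [of "\<lambda>y. (E \<circ> retr ?N) (y(?N := 1))"])
    show "continuous_map (top_of_set (cub ?N)) X (\<lambda>y. (E \<circ> retr ?N) (y(?N := 1)))"
      by (rule continuous_map_via [OF fill cu [of _ ?N 1]]) (auto simp: yN)
    fix y assume y: "y \<in> bdcub ?N"
    then have yc: "y \<in> cub ?N" and y0: "y ?N = 0" by (auto simp: bdcub_def cub_def)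
    obtain i where i: "i < ?N" "y i = 0 \<or> y i = 1" using y by (auto simp: bdcub_def)
    then have "(y(?N := 1)) i = 0 \<or> (y(?N := 1)) i = 1" by simp
    then have "y(?N := 1) \<in> openbox ?N"
      unfolding openbox_def using yN [OF yc] i(1) by blast
    then have r: "(E \<circ> retr ?N) (y(?N := 1)) = E (y(?N := 1))" by (simp add: retr_id)
    have yy: "y(?N := 1, ?N := 0) = y" using y0 by (auto simp: fun_eq_iff)
    show "(E \<circ> retr ?N) (y(?N := 1)) = g y"
    proof (cases "y q = 1")
      case True
      have "E (y(?N := 1)) = L (y(q := 0))"
        using Eq [OF yN [OF yc]] True y0 by (simp add: fun_upd_idem)
      also have "\<dots> = D (y(q := 0))"
        by (rule LD) (use cub_upd [OF yc, of q 0] in \<open>simp add: openbox_def\<close>)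
      also have "\<dots> = g y" using True by (simp add: D_def fun_upd_idem)
      finally show ?thesis using r by simp
    next
      case False
      have yS: "y q = 0 \<or> (\<exists>i<q. y i = 0 \<or> y i = 1)"
      proof (cases "i = q")
        case True
        then show ?thesis using i(2) False by simp
      next
        case False
        then have "i < q" using i(1) by simp
        then show ?thesis using i(2) by blast
      qed
      have "(y(?N := 1)) k = y k" if "k \<le> q" for k using that by simp
      then have "(y(?N := 1)) q = 0 \<or> (\<exists>i<q. (y(?N := 1)) i = 0 \<or> (y(?N := 1)) i = 1)"
        using yS by (metis le_refl less_imp_le)
      then have "y(?N := 1) \<in> S2" by (simp only: S2_def mem_Collect_eq)
      then have "E (y(?N := 1)) = G (0, y)"
        using ES [OF yN [OF yc]] y0 by (simp add: fun_upd_idem)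
      also have "\<dots> = g y"
        by (rule G0) (use yc yS in \<open>simp add: openbox_def\<close>)
      finally show ?thesis using r by simp
    qed
  qed
qed

subsection \<open>Loops\<close>

lemma Sq_transpose: "Sq X p q r t \<Longrightarrow> Sq X r t p q"
proof -
  assume "Sq X p q r t"
  then obtain h where h: "continuous_map (top_of_set ({0..1} \<times> {0..1})) X h"
    "\<forall>u\<in>{0..1}. h (u, 0) = p u \<and> h (u, 1) = q u \<and> h (0, u) = r u \<and> h (1, u) = t u"
    by (auto simp: Sq_def)
  have "continuous_map (top_of_set ({0..1} \<times> {0..1})) X (\<lambda>(u, v). h (v, u))"
    by (rule continuous_map_via [OF h(1), where m = "\<lambda>(u, v). (v, u)"])
      (auto simp: split_def intro!: continuous_intros)
  then show ?thesis unfolding Sq_def using h(2) by force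
qed

lemma Sq_reverse: "Sq X p q r t \<Longrightarrow> Sq X (\<lambda>u. p (1 - u)) (\<lambda>u. q (1 - u)) t r"
proof -
  assume "Sq X p q r t"
  then obtain h where h: "continuous_map (top_of_set ({0..1} \<times> {0..1})) X h"
    "\<forall>u\<in>{0..1}. h (u, 0) = p u \<and> h (u, 1) = q u \<and> h (0, u) = r u \<and> h (1, u) = t u"
    by (auto simp: Sq_def)
  have "continuous_map (top_of_set ({0..1} \<times> {0..1})) X (\<lambda>(u, v). h (1 - u, v))"
    by (rule continuous_map_via [OF h(1), where m = "\<lambda>(u, v). (1 - u, v)"])
      (auto simp: split_def intro!: continuous_intros)
  then show ?thesis unfolding Sq_def using h(2)
    by (intro exI [of _ "\<lambda>(u, v). h (1 - u, v)"]) auto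
qed

lemma Sq_const: "pathin X q \<Longrightarrow> Sq X q q (\<lambda>_. q 0) (\<lambda>_. q 1)"
  unfolding Sq_def pathin_def
  by (rule exI [of _ "\<lambda>(u, v). q u"])
    (auto simp: split_def intro!: continuous_map_via [where m = fst] continuous_intros)

lemma Sq_corners:
  assumes "Sq X p q r t"
  shows "p 0 = r 0" "p 1 = t 0" "q 0 = r 1" "q 1 = t 1"
proof -
  obtain h where h: "\<And>u. u \<in> {0..1} \<Longrightarrow> h (u, 0) = p u \<and> h (u, 1) = q u \<and> h (0, u) = r u \<and> h (1, u) = t u"
    using assms unfolding Sq_def by blast
  show "p 0 = r 0" "p 1 = t 0" "q 0 = r 1" "q 1 = t 1"
    using h [of 0] h [of 1] by auto
qed

lemma Sq_pathin:
  assumes "Sq X p q r t"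
  shows "pathin X p"
proof -
  obtain h where h: "continuous_map (top_of_set ({0..1} \<times> {0..1})) X h"
    "\<forall>u\<in>{0..1}. h (u, 0) = p u \<and> h (u, 1) = q u \<and> h (0, u) = r u \<and> h (1, u) = t u"
    using assms by (auto simp: Sq_def)
  show ?thesis unfolding pathin_def
    by (rule continuous_map_via [OF h(1), where m = "\<lambda>u. (u, 0)"])
      (use h in \<open>auto intro!: continuous_intros\<close>)
qed

definition loop :: "'a topology \<Rightarrow> 'a \<Rightarrow> (real \<Rightarrow> 'a) \<Rightarrow> bool" where
  "loop X x0 p \<longleftrightarrow> pathin X p \<and> p 0 = x0 \<and> p 1 = x0"

definition join :: "(real \<Rightarrow> 'a) \<Rightarrow> (real \<Rightarrow> 'a) \<Rightarrow> real \<Rightarrow> 'a" where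
  "join p q u = (if u \<le> 1/2 then p (2 * u) else q (2 * u - 1))"

definition sph :: "(real \<Rightarrow> 'a) \<Rightarrow> (nat \<Rightarrow> real) \<Rightarrow> 'a" where
  "sph p x = p (x 0)"

lemma spheroid_concat_sph: "spheroid_concat (sph p) (sph q) = sph (join p q)"
  by (auto simp: spheroid_concat_def sph_def join_def fun_eq_iff)

text \<open>The two halves of the boundary of a square are homotopic, by convexity of the square.\<close>

lemma Sq_join:
  assumes "Sq X p q r t" and c: "r 0 = x0" "q 1 = x0"
  shows "Sq X (join r q) (join p t) (\<lambda>_. x0) (\<lambda>_. x0)"
proof -
  obtain h where h: "continuous_map (top_of_set ({0..1} \<times> {0..1})) X h"
    "\<And>u. u \<in> {0..1} \<Longrightarrow> h (u, 0) = p u \<and> h (u, 1) = q u \<and> h (0, u) = r u \<and> h (1, u) = t u"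
    using assms(1) by (auto simp: Sq_def)
  \<comment> \<open>As \<open>u\<close> runs through the unit interval, \<open>(a u, b u)\<close>
    traverses the left side and then the top, and \<open>(b u, a u)\<close> the bottom and then the
    right side; \<open>m\<close> is the straight-line homotopy between them.\<close>
  define a b :: "real \<Rightarrow> real" where "a = (\<lambda>u. max 0 (2 * u - 1))" and "b = (\<lambda>u. min 1 (2 * u))"
  define m where "m = (\<lambda>(u, v). ((1 - v) * a u + v * b u, (1 - v) * b u + v * a u))"
  have ab: "a u \<in> {0..1}" "b u \<in> {0..1}" if "u \<in> {0..1}" for u using that by (auto simp: a_def b_def)
  have "continuous_map (top_of_set ({0..1} \<times> {0..1})) X (h \<circ> m)"
  proof (rule continuous_map_via [OF h(1)])
    show "continuous_on ({0..1} \<times> {0..1}) m"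
      unfolding m_def split_def a_def b_def by (intro continuous_intros)
    have "(1 - v) * x + v * y \<in> {0..1}" if "v \<in> {0..1}" "x \<in> {0..1}" "y \<in> {0..1}" for v x y :: real
      using that convex_bound_le [of x 1 y "1 - v" v] by auto
    then show "m \<in> {0..1} \<times> {0..1} \<rightarrow> {0..1} \<times> {0..1}"
      using ab by (auto simp: m_def simp del: atLeastAtMost_iff)
  qed simp
  moreover have "(h \<circ> m) (u, 0) = join r q u \<and> (h \<circ> m) (u, 1) = join p t u
      \<and> (h \<circ> m) (0, u) = x0 \<and> (h \<circ> m) (1, u) = x0" if u: "u \<in> {0..1}" for u
  proof -
    have "h (a u, b u) = join r q u"
    proof (cases "u \<le> 1/2")
      case True
      then have "a u = 0" "b u = 2 * u" "2 * u \<in> {0..1}" using u by (auto simp: a_def b_def)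
      then show ?thesis using h(2) [of "2 * u"] True by (simp add: join_def)
    next
      case False
      then have "a u = 2 * u - 1" "b u = 1" "2 * u - 1 \<in> {0..1}" using u by (auto simp: a_def b_def)
      then show ?thesis using h(2) [of "2 * u - 1"] False by (simp add: join_def)
    qed
    moreover have "h (b u, a u) = join p t u"
    proof (cases "u \<le> 1/2")
      case True
      then have "a u = 0" "b u = 2 * u" "2 * u \<in> {0..1}" using u by (auto simp: a_def b_def)
      then show ?thesis using h(2) [of "2 * u"] True by (simp add: join_def)
    next
      case False
      then have "a u = 2 * u - 1" "b u = 1" "2 * u - 1 \<in> {0..1}" using u by (auto simp: a_def b_def)
      then show ?thesis using h(2) [of "2 * u - 1"] False by (simp add: join_def)
    qed
    moreover have "(h \<circ> m) (0, u) = x0" "(h \<circ> m) (1, u) = x0"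
      using h(2) [of 0] h(2) [of 1] c by (auto simp: m_def a_def b_def)
    ultimately show ?thesis by (simp add: m_def)
  qed
  ultimately show ?thesis unfolding Sq_def by blast
qed

lemma join_pathin:
  assumes "pathin X p" "pathin X q" "p 1 = q 0"
  shows "pathin X (join p q)"
proof -
  have "continuous_map (top_of_set ({0..1/2} \<union> {1/2..1})) X (join p q)"
  proof (rule continuous_map_closed_Un)
    show "continuous_map (top_of_set {0..1/2}) X (join p q)"
      by (rule continuous_map_via [OF assms(1) [unfolded pathin_def], where m = "\<lambda>u. 2 * u"])
        (auto simp: join_def intro!: continuous_intros)
    have "join p q u = q (2 * u - 1)" if "u \<in> {1/2..1}" for u
    proof (cases "u = 1/2")
      case True
      then show ?thesis unfolding True join_def using assms(3) by simp
    qed (use that in \<open>auto simp: join_def\<close>)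
    then show "continuous_map (top_of_set {1/2..1}) X (join p q)"
      by (intro continuous_map_via [OF assms(2) [unfolded pathin_def], where m = "\<lambda>u. 2 * u - 1"])
        (auto intro!: continuous_intros)
  qed auto
  moreover have "{0..1/2} \<union> {1/2..1} = {0..1::real}" by auto
  ultimately show ?thesis by (simp add: pathin_def)
qed

lemma loop_join: "\<lbrakk>loop X x0 p; loop X x0 q\<rbrakk> \<Longrightarrow> loop X x0 (join p q)"
  by (auto simp: loop_def join_pathin) (auto simp: join_def)

lemma cub_1: "x \<in> cub 1 \<Longrightarrow> x = (\<lambda>_. 0)(0 := x 0)" "x \<in> cub 1 \<Longrightarrow> x 0 \<in> {0..1}"
  by (auto simp: cub_def fun_eq_iff)

lemma bdcub_1: "x \<in> bdcub 1 \<longleftrightarrow> x \<in> cub 1 \<and> (x 0 = 0 \<or> x 0 = 1)"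
  by (auto simp: bdcub_def)

lemma sph_spheroid:
  assumes "loop X x0 p"
  shows "sph p \<in> spheroids 1 X x0"
proof -
  have "continuous_map (top_of_set (cub 1)) X (sph p)"
    by (rule continuous_map_via [where f = p and T = "{0..1}" and m = "\<lambda>x. x 0"])
      (use assms cub_1 in \<open>auto simp: loop_def pathin_def sph_def intro!: continuous_intros\<close>)
  moreover have "sph p x = x0" if "x \<in> bdcub 1" for x
    using that assms unfolding bdcub_1 by (auto simp: sph_def loop_def)
  ultimately show ?thesis
    by (auto simp: spheroids_def unit_cube_eq cube_boundary_eq)
qed

lemma class_eq_iff:
  assumes "f \<in> spheroids n X x0"
  shows "spheroid_class n X x0 f = spheroid_class n X x0 g \<longleftrightarrow>
    homotopic_with (\<lambda>h. h ` cube_boundary n \<subseteq> {x0}) (unit_cube n) X f g"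
proof
  let ?P = "\<lambda>h. h ` cube_boundary n \<subseteq> {x0}"
  assume eq: "spheroid_class n X x0 f = spheroid_class n X x0 g"
  have "f \<in> spheroid_class n X x0 f"
    using assms by (auto simp: spheroid_class_def spheroids_def homotopic_with_refl)
  then have "homotopic_with ?P (unit_cube n) X g f" by (simp add: eq) (simp add: spheroid_class_def)
  then show "homotopic_with ?P (unit_cube n) X f g" by (rule homotopic_with_symD)
next
  assume "homotopic_with (\<lambda>h. h ` cube_boundary n \<subseteq> {x0}) (unit_cube n) X f g"
  then show "spheroid_class n X x0 f = spheroid_class n X x0 g"
    unfolding spheroid_class_def
    by (auto intro: homotopic_with_trans homotopic_with_symD)
qed

text \<open>The bridge from spheroids to squares: the time of the homotopy becomes the second
  coordinate of the square, and the boundary condition becomes its two constant sides.\<close>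

lemma loop_class_eq_iff:
  assumes "loop X x0 p" "loop X x0 q"
  shows "spheroid_class 1 X x0 (sph p) = spheroid_class 1 X x0 (sph q) \<longleftrightarrow>
    Sq X p q (\<lambda>_. x0) (\<lambda>_. x0)"
  unfolding class_eq_iff [OF sph_spheroid [OF assms(1)]]
proof
  let ?P = "\<lambda>h. h ` cube_boundary 1 \<subseteq> {x0}"
  assume "homotopic_with ?P (unit_cube 1) X (sph p) (sph q)"
  then obtain H where H: "continuous_map (prod_topology (top_of_set {0..1::real}) (unit_cube 1)) X H"
    "\<forall>x. H (0, x) = sph p x" "\<forall>x. H (1, x) = sph q x" "\<forall>t\<in>{0..1}. ?P (\<lambda>x. H (t, x))"
    by (rule homotopic_withE)
  have Hc: "continuous_map (top_of_set ({0..1} \<times> cub 1)) X H"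
    using H(1) by (simp add: prod_unit_cube_eq)
  define e :: "real \<Rightarrow> nat \<Rightarrow> real" where "e = (\<lambda>u. (\<lambda>_. 0)(0 := u))"
  have e: "e u \<in> cub 1" if "u \<in> {0..1}" for u using that by (auto simp: e_def cub_def)
  have "continuous_map (top_of_set ({0..1} \<times> {0..1})) X (\<lambda>(u, v). H (v, e u))"
    by (rule continuous_map_via [OF Hc, where m = "\<lambda>(u, v). (v, e u)"])
      (use e in \<open>auto simp: split_def e_def intro!: continuous_on_Pair continuous_on_fun_upd continuous_on_const
        continuous_on_fst continuous_on_snd continuous_on_id\<close>)
  moreover have "H (v, e 0) = x0 \<and> H (v, e 1) = x0" if "v \<in> {0..1}" for v
  proof -
    have "e 0 \<in> cube_boundary 1" "e 1 \<in> cube_boundary 1"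
      unfolding cube_boundary_eq bdcub_1 using e [of 0] e [of 1] by (simp_all add: e_def)
    then show ?thesis using H(4) that by blast
  qed
  ultimately show "Sq X p q (\<lambda>_. x0) (\<lambda>_. x0)"
    unfolding Sq_def using H(2,3)
    by (intro exI [of _ "\<lambda>(u, v). H (v, e u)"]) (auto simp: sph_def e_def)
next
  let ?P = "\<lambda>h. h ` cube_boundary 1 \<subseteq> {x0}"
  assume "Sq X p q (\<lambda>_. x0) (\<lambda>_. x0)"
  then obtain h where h: "continuous_map (top_of_set ({0..1} \<times> {0..1})) X h"
    "\<And>u. u \<in> {0..1} \<Longrightarrow> h (u, 0) = p u \<and> h (u, 1) = q u \<and> h (0, u) = x0 \<and> h (1, u) = x0"
    by (auto simp: Sq_def)
  define H where "H = (\<lambda>(v :: real, x :: nat \<Rightarrow> real). h (x 0, v))"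
  have "continuous_map (top_of_set ({0..1} \<times> cub 1)) X H"
    by (rule continuous_map_via [OF h(1), where m = "\<lambda>(v, x). (x 0, v)"])
      (use cub_1 in \<open>auto simp: H_def split_def intro!: continuous_on_Pair continuous_on_snd_coord continuous_on_fst continuous_on_id\<close>)
  then have "continuous_map (prod_topology (top_of_set {0..1}) (unit_cube 1)) X H"
    by (simp add: prod_unit_cube_eq)
  moreover have "H (0, x) = sph p x" "H (1, x) = sph q x" if "x \<in> topspace (unit_cube 1)" for x
    using h(2) [of "x 0"] cub_1(2) [of x] that by (auto simp: unit_cube_eq H_def sph_def)
  moreover have "?P (\<lambda>x. H (v, x))" if "v \<in> {0..1}" for v
    using h(2) [OF that] unfolding cube_boundary_eq by (auto simp: H_def bdcub_1 [unfolded One_nat_def])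
  moreover have "?P h \<longleftrightarrow> ?P k" if "\<And>x. x \<in> topspace (unit_cube 1) \<Longrightarrow> h x = k x" for h k
    using that by (auto simp: cube_boundary_def)
  ultimately show "homotopic_with ?P (unit_cube 1) X (sph p) (sph q)"
    by (subst homotopic_with) blast+
qed

lemma spheroid_eq_sph:
  assumes "f \<in> spheroids 1 X x0"
  obtains p where "loop X x0 p" "spheroid_class 1 X x0 f = spheroid_class 1 X x0 (sph p)"
proof -
  define e :: "real \<Rightarrow> nat \<Rightarrow> real" where "e = (\<lambda>u. (\<lambda>_. 0)(0 := u))"
  have e: "e u \<in> cub 1" if "u \<in> {0..1}" for u using that by (auto simp: e_def cub_def)
  define p where "p = (\<lambda>u. f (e u))"
  have fc: "continuous_map (top_of_set (cub 1)) X f" and fb: "f ` bdcub 1 \<subseteq> {x0}"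
    using assms by (auto simp: spheroids_def unit_cube_eq cube_boundary_eq)
  have "pathin X p"
    unfolding pathin_def
    by (rule continuous_map_via [OF fc, where m = e])
      (use e in \<open>auto simp: p_def e_def intro!: continuous_on_fun_upd continuous_on_const continuous_on_id\<close>)
  moreover have "e 0 \<in> bdcub 1" "e 1 \<in> bdcub 1"
    unfolding bdcub_1 using e [of 0] e [of 1] by (simp_all add: e_def)
  ultimately have lp: "loop X x0 p" using fb by (auto simp: loop_def p_def)
  moreover have "homotopic_with (\<lambda>h. h ` cube_boundary 1 \<subseteq> {x0}) (unit_cube 1) X f (sph p)"
  proof (rule homotopic_with_equal)
    show "f x = sph p x" if "x \<in> topspace (unit_cube 1)" for x
      using that cub_1(1) [of x] by (auto simp: unit_cube_eq sph_def p_def e_def)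
  qed (use assms sph_spheroid [OF lp] in \<open>auto simp: spheroids_def\<close>)
  ultimately show ?thesis using that class_eq_iff [OF assms] by blast
qed

text \<open>All that is used about the fundamental group afterwards. In a square, left followed by
  top is homotopic to bottom followed by right, hence the product formula. The unit needs its own
  clause because its chosen loop is only homotopic to the constant one.\<close>

theorem fundamental_group_labels:
  fixes P :: "'p monoid"
  assumes P: "group P" and iso: "P \<cong> homotopy_group 1 X x0" and x0: "x0 \<in> topspace X"
  obtains lp where "\<And>a. a \<in> carrier P \<Longrightarrow> loop X x0 (lp a)"
    "\<And>p. loop X x0 p \<Longrightarrow> \<exists>a \<in> carrier P. Sq X p (lp a) (\<lambda>_. x0) (\<lambda>_. x0)"
    "\<And>a b c d. \<lbrakk>a \<in> carrier P; b \<in> carrier P; c \<in> carrier P; d \<in> carrier P\<rbrakk> \<Longrightarrow>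
       Sq X (lp a) (lp b) (lp c) (lp d) \<longleftrightarrow> c \<otimes>\<^bsub>P\<^esub> b = a \<otimes>\<^bsub>P\<^esub> d"
    "Sq X (lp \<one>\<^bsub>P\<^esub>) (\<lambda>_. x0) (\<lambda>_. x0) (\<lambda>_. x0)"
proof -
  interpret group P by (rule P)
  let ?G = "homotopy_group 1 X x0"
  let ?cl = "\<lambda>p. spheroid_class 1 X x0 (sph p)"
  obtain \<theta> where \<theta>: "\<theta> \<in> iso P ?G" using iso by (auto simp: is_iso_def)
  then have hom: "\<And>a b. \<lbrakk>a \<in> carrier P; b \<in> carrier P\<rbrakk> \<Longrightarrow> \<theta> (a \<otimes>\<^bsub>P\<^esub> b) = \<theta> a \<otimes>\<^bsub>?G\<^esub> \<theta> b"
    and bij: "bij_betw \<theta> (carrier P) (carrier ?G)"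
    by (auto simp: iso_def hom_def)
  have carr: "\<exists>p. loop X x0 p \<and> A = ?cl p" if A: "A \<in> carrier ?G" for A
  proof -
    obtain f where "f \<in> spheroids 1 X x0" "A = spheroid_class 1 X x0 f"
      using A by (auto simp: homotopy_group_def)
    then show ?thesis using spheroid_eq_sph by metis
  qed
  have "\<exists>p. loop X x0 p \<and> \<theta> a = ?cl p" if "a \<in> carrier P" for a
    using carr [of "\<theta> a"] bij that by (auto simp: bij_betw_def)
  then obtain lp where lp: "\<And>a. a \<in> carrier P \<Longrightarrow> loop X x0 (lp a) \<and> \<theta> a = ?cl (lp a)"
    by metis
  have mult: "\<theta> (a \<otimes>\<^bsub>P\<^esub> b) = ?cl (join u v)"
    if ab: "a \<in> carrier P" "b \<in> carrier P" and uv: "loop X x0 u" "loop X x0 v" "\<theta> a = ?cl u" "\<theta> b = ?cl v" for a b u v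
  proof -
    obtain p where p: "loop X x0 p" "\<theta> (a \<otimes>\<^bsub>P\<^esub> b) = ?cl p"
      using lp [of "a \<otimes>\<^bsub>P\<^esub> b"] ab by auto
    have mem: "f \<in> spheroid_class 1 X x0 f" if "f \<in> spheroids 1 X x0" for f
      using that by (auto simp: spheroid_class_def spheroids_def homotopic_with_refl)
    \<comment> \<open>The product in \<open>homotopy_group\<close> is a union of classes over
      representatives. It is known to be a single class, since \<open>\<theta>\<close> is a
      homomorphism, so one explicit member identifies it.\<close>
    have "sph (join u v) \<in> \<theta> a \<otimes>\<^bsub>?G\<^esub> \<theta> b"
    proof -
      have "sph u \<in> \<theta> a" "sph v \<in> \<theta> b"
        using uv mem sph_spheroid by metis+
      moreover have "sph (join u v) \<in> spheroid_class 1 X x0 (spheroid_concat (sph u) (sph v))"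
        unfolding spheroid_concat_sph using uv by (intro mem sph_spheroid loop_join) auto
      ultimately show ?thesis by (auto simp: homotopy_group_def)
    qed
    then have "sph (join u v) \<in> ?cl p" using hom [OF ab] p(2) by simp
    then have "?cl p = ?cl (join u v)"
      unfolding class_eq_iff [OF sph_spheroid [OF p(1)]] by (simp add: spheroid_class_def)
    then show ?thesis using p(2) by simp
  qed
  have onto: "\<exists>a \<in> carrier P. Sq X p (lp a) (\<lambda>_. x0) (\<lambda>_. x0)" if "loop X x0 p" for p
  proof -
    have "?cl p \<in> carrier ?G" using sph_spheroid [OF that] by (auto simp: homotopy_group_def)
    then obtain a where a: "a \<in> carrier P" "?cl p = \<theta> a" using bij by (auto simp: bij_betw_def)
    then have "Sq X p (lp a) (\<lambda>_. x0) (\<lambda>_. x0)"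
      using lp [of a] loop_class_eq_iff [OF that, of "lp a"] by metis
    then show ?thesis using a(1) by blast
  qed
  have imp: "c \<otimes>\<^bsub>P\<^esub> b = a \<otimes>\<^bsub>P\<^esub> d" if c: "a \<in> carrier P" "b \<in> carrier P" "c \<in> carrier P" "d \<in> carrier P"
    and sq: "Sq X (lp a) (lp b) (lp c) (lp d)" for a b c d
  proof -
    have "Sq X (join (lp c) (lp b)) (join (lp a) (lp d)) (\<lambda>_. x0) (\<lambda>_. x0)"
      by (rule Sq_join [OF sq]) (use lp c in \<open>auto simp: loop_def\<close>)
    then have "\<theta> (c \<otimes>\<^bsub>P\<^esub> b) = \<theta> (a \<otimes>\<^bsub>P\<^esub> d)"
      using mult [OF c(3,2), of "lp c" "lp b"] mult [OF c(1,4), of "lp a" "lp d"] lp c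
        loop_class_eq_iff [OF loop_join loop_join, of X x0 "lp c" "lp b" "lp a" "lp d"] by simp
    then show ?thesis using bij c by (auto simp: bij_betw_def inj_on_def)
  qed
  \<comment> \<open>The other three sides always extend to a square whose bottom is some loop; after
    labelling it by \<open>a'\<close>, the implication already proved and cancellation force
    \<open>a' = a\<close>.\<close>
  have conv: "Sq X (lp a) (lp b) (lp c) (lp d)" if c: "a \<in> carrier P" "b \<in> carrier P" "c \<in> carrier P" "d \<in> carrier P"
    and eq: "c \<otimes>\<^bsub>P\<^esub> b = a \<otimes>\<^bsub>P\<^esub> d" for a b c d
  proof -
    have l: "loop X x0 (lp a)" "loop X x0 (lp b)" "loop X x0 (lp c)" "loop X x0 (lp d)" using lp c by auto
    then obtain p where p: "Sq X p (lp b) (lp c) (lp d)"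
      using Sq_open [of X "lp b" "lp c" "lp d"] by (auto simp: loop_def)
    have "loop X x0 p"
      using Sq_pathin [OF p] Sq_corners [OF p] l by (simp add: loop_def)
    then obtain a' where a': "a' \<in> carrier P" "Sq X p (lp a') (\<lambda>_. x0) (\<lambda>_. x0)" using onto by blast
    have k: "Sq X (\<lambda>_. x0) (\<lambda>_. x0) q q" if "loop X x0 q" for q
      using Sq_transpose [OF Sq_const [of X q]] that by (simp add: loop_def)
    have sq: "Sq X (lp a') (lp b) (lp c) (lp d)"
      by (rule Sq_box [OF p Sq_transpose [OF a'(2)] k [OF l(2)] k [OF l(3)] k [OF l(4)]])
    then have "a' \<otimes>\<^bsub>P\<^esub> d = a \<otimes>\<^bsub>P\<^esub> d" using imp a'(1) c eq by metis
    then have "a' = a" using a'(1) c by simp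
    then show ?thesis using sq by simp
  qed
  show ?thesis
  proof (rule that [of lp])
    show "loop X x0 (lp a)" if "a \<in> carrier P" for a using lp [OF that] ..
    show "\<exists>a \<in> carrier P. Sq X p (lp a) (\<lambda>_. x0) (\<lambda>_. x0)" if "loop X x0 p" for p
      by (rule onto [OF that])
    show "Sq X (lp a) (lp b) (lp c) (lp d) \<longleftrightarrow> c \<otimes>\<^bsub>P\<^esub> b = a \<otimes>\<^bsub>P\<^esub> d"
      if "a \<in> carrier P" "b \<in> carrier P" "c \<in> carrier P" "d \<in> carrier P" for a b c d
      using imp [OF that] conv [OF that] by (rule iffI)
    have lc: "loop X x0 (\<lambda>_. x0)" using x0 by (simp add: loop_def pathin_const)
    have "?cl (\<lambda>_. x0) \<in> carrier ?G" using sph_spheroid [OF lc] by (auto simp: homotopy_group_def)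
    then have "?cl (\<lambda>_. x0) \<in> \<theta> ` carrier P" using bij by (simp add: bij_betw_def)
    then obtain e where e: "e \<in> carrier P" "\<theta> e = ?cl (\<lambda>_. x0)" by (metis imageE)
    \<comment> \<open>The class of the constant loop is idempotent, and an idempotent of a group is
      the unit.\<close>
    have "join (\<lambda>_. x0) (\<lambda>_. x0) = (\<lambda>_. x0)" by (auto simp: join_def)
    then have "\<theta> (e \<otimes>\<^bsub>P\<^esub> e) = \<theta> e" using mult [OF e(1) e(1) lc lc e(2) e(2)] e(2) by simp
    then have "e \<otimes>\<^bsub>P\<^esub> e = e" using bij e(1) by (auto simp: bij_betw_def inj_on_def)
    then have "e = \<one>\<^bsub>P\<^esub>" using e(1) by simp
    then show "Sq X (lp \<one>\<^bsub>P\<^esub>) (\<lambda>_. x0) (\<lambda>_. x0) (\<lambda>_. x0)"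
      using loop_class_eq_iff [OF _ lc, of "lp \<one>\<^bsub>P\<^esub>"] lp [of "\<one>\<^bsub>P\<^esub>"] e by simp
  qed
qed

section \<open>Filling simplices\<close>

lemma singular_simplex_iff:
  "singular_simplex p X f \<longleftrightarrow>
   continuous_map (top_of_set (standard_simplex p)) X f \<and> f \<in> extensional (standard_simplex p)"
  by (simp add: singular_simplex_def powertop_real_euclidean)

text \<open>The collapse of the cube onto the simplex that is injective over the interior.\<close>

definition qmap :: "(nat \<Rightarrow> real) \<Rightarrow> nat \<Rightarrow> real" where
  "qmap x j = (\<Prod>i<j. x i) - (\<Prod>i<Suc j. x i)"

lemma qmap_alt: "qmap x j = (\<Prod>i<j. x i) * (1 - x j)"
  by (simp add: qmap_def algebra_simps)

lemma sum_qmap: "(\<Sum>j<n. qmap x j) = 1 - (\<Prod>i<n. x i)"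
  by (induction n) (auto simp: qmap_def)

lemma cub_bounds: "x \<in> cub p \<Longrightarrow> 0 \<le> x i \<and> x i \<le> 1"
  by (cases "i < p") (auto simp: cub_def)

lemma qmap_simplex:
  assumes "x \<in> cub p"
  shows "qmap x \<in> standard_simplex p"
proof -
  have xp: "x i = 0" if "i \<ge> p" for i using assms that by (auto simp: cub_def)
  have "0 \<le> (\<Prod>i<j. x i)" "(\<Prod>i<j. x i) \<le> 1" for j
    using cub_bounds [OF assms] by (auto intro: prod_nonneg prod_le_1)
  then have "0 \<le> qmap x j \<and> qmap x j \<le> 1" for j
    using cub_bounds [OF assms, of j] by (simp add: qmap_alt mult_le_one)
  moreover have "qmap x j = 0" if "j > p" for j
    using that xp [of p] by (auto simp: qmap_alt intro: prod_zero)
  moreover have "(\<Sum>j\<le>p. qmap x j) = 1"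
    using xp [of p] sum_qmap [of x "Suc p"] by (simp add: lessThan_Suc_atMost [symmetric])
  ultimately show ?thesis by (simp add: standard_simplex_def)
qed

lemma continuous_on_qmap: "continuous_on S qmap"
proof (rule continuous_on_coordinatewise_then_product)
  show "continuous_on S (\<lambda>x. qmap x i)" for i
    unfolding qmap_def by (intro continuous_intros)
qed

text \<open>Stick breaking: the partial products of \<open>x\<close> have to be the tail sums
  \<open>s\<close> of \<open>t\<close>, so the coordinates of \<open>x\<close> are quotients of
  consecutive tail sums.\<close>

lemma qmap_onto:
  assumes t: "t \<in> standard_simplex p"
  obtains x where "x \<in> cub p" "qmap x = t"
proof -
  define s where "s = (\<lambda>j. \<Sum>i\<in>{j..p}. t i)"
  have t0: "0 \<le> t i" and tp: "i > p \<Longrightarrow> t i = 0" and t1: "(\<Sum>i\<le>p. t i) = 1" for i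
    using t by (auto simp: standard_simplex_def)
  have s0: "s 0 = 1" using t1 by (simp add: s_def atLeast0AtMost)
  have sS: "s j = t j + s (Suc j)" for j
  proof (cases "j \<le> p")
    case True then show ?thesis by (simp add: s_def sum.atLeast_Suc_atMost)
  next
    case False then show ?thesis using tp [of j] by (simp add: s_def)
  qed
  have snn: "0 \<le> s j" for j by (auto simp: s_def intro: sum_nonneg t0)
  define x where "x = (\<lambda>j. s (Suc j) / s j)"
  \<comment> \<open>Where \<open>s j = 0\<close> the quotient is 0 by convention; this is harmless
    because later tail sums vanish too.\<close>
  have pr: "(\<Prod>i<j. x i) = s j" for j
  proof (induction j)
    case (Suc j)
    show ?case
    proof (cases "s j = 0")
      case True
      then have "s (Suc j) = 0" using sS [of j] t0 [of j] snn [of "Suc j"] by linarith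
      then show ?thesis using True by (simp only: prod.lessThan_Suc Suc.IH mult_zero_left)
    qed (use Suc in \<open>simp add: x_def\<close>)
  qed (simp add: s0)
  have "x \<in> cub p"
  proof -
    have "0 \<le> x i" for i by (simp add: x_def snn)
    moreover have "x i \<le> 1" for i
      using snn [of i] snn [of "Suc i"] sS [of i] t0 [of i]
      by (cases "s i = 0") (simp_all add: x_def divide_le_eq)
    moreover have "x i = 0" if "i \<ge> p" for i
    proof -
      have "s (Suc i) = 0" using that by (simp add: s_def)
      then show ?thesis by (simp add: x_def)
    qed
    ultimately show ?thesis by (simp add: cub_def)
  qed
  moreover have "qmap x = t"
  proof
    show "qmap x j = t j" for j unfolding qmap_def pr using sS [of j] by linarith
  qed
  ultimately show ?thesis by (rule that)
qed

definition bdsimp :: "nat \<Rightarrow> (nat \<Rightarrow> real) set" where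
  "bdsimp p = {t \<in> standard_simplex p. \<exists>i\<le>p. t i = 0}"

lemma qmap_boundary:
  assumes "x \<in> cub p"
  shows "qmap x \<in> bdsimp p \<longleftrightarrow> x \<in> bdcub p"
proof
  assume "qmap x \<in> bdsimp p"
  then obtain j where j: "j \<le> p" "qmap x j = 0" by (auto simp: bdsimp_def)
  then consider i where "i < j" "x i = 0" | "x j = 1" by (auto simp: qmap_alt)
  then show "x \<in> bdcub p"
  proof cases
    case 1 then show ?thesis using j assms by (auto simp: bdcub_def intro: exI [of _ i])
  next
    case 2
    then have "j \<noteq> p" using assms by (auto simp: cub_def)
    then show ?thesis using 2 j assms by (auto simp: bdcub_def intro: exI [of _ j])
  qed
next
  assume "x \<in> bdcub p"
  then obtain i where i: "i < p" "x i = 0 \<or> x i = 1" by (auto simp: bdcub_def)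
  from i(2) have "\<exists>j\<le>p. qmap x j = 0"
  proof
    assume "x i = 0"
    then have "qmap x (Suc i) = 0" by (simp add: qmap_alt)
    then show ?thesis using i(1) Suc_leI by blast
  next
    assume "x i = 1"
    then have "qmap x i = 0" by (simp add: qmap_alt)
    then show ?thesis using i(1) less_imp_le by blast
  qed
  then show "qmap x \<in> bdsimp p" using qmap_simplex [OF assms] by (simp add: bdsimp_def)
qed

text \<open>Sums of the coordinates of \<open>qmap x\<close> recover the partial products of
  \<open>x\<close>, and these determine \<open>x\<close> as long as none of the factors below
  \<open>p\<close> is zero.\<close>

lemma qmap_inj:
  assumes x: "x \<in> cub p" "x \<notin> bdcub p" and y: "y \<in> cub p" and eq: "qmap x = qmap y"
  shows "x = y"
proof
  fix j
  have pr: "(\<Prod>i<n. x i) = (\<Prod>i<n. y i)" for n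
    using sum_qmap [of x n] sum_qmap [of y n] eq by simp
  show "x j = y j"
  proof (cases "j < p")
    case True
    then have "(\<Prod>i<j. x i) \<noteq> 0" using x by (auto simp: bdcub_def)
    then show ?thesis using pr [of j] pr [of "Suc j"] by simp
  qed (use x y in \<open>auto simp: cub_def\<close>)
qed

text \<open>A continuous map from a compact space to a Hausdorff space is closed, so closed
  preimages in \<open>T\<close> can be tested upstairs.\<close>

lemma continuous_map_quotient:
  fixes m :: "'c::topological_space \<Rightarrow> 'd::t2_space"
  assumes "compact S" "continuous_on S m" "m ` S = T" "continuous_map (top_of_set S) X h"
    "\<And>x. x \<in> S \<Longrightarrow> h x = k (m x)"
  shows "continuous_map (top_of_set T) X k"
  unfolding continuous_map_closedin
proof (intro conjI allI impI)
  show "k \<in> topspace (top_of_set T) \<rightarrow> topspace X"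
  proof
    fix t assume "t \<in> topspace (top_of_set T)"
    then obtain x where x: "x \<in> S" "t = m x" using assms(3) by auto
    then have "h x \<in> topspace X" using continuous_map_image_subset_topspace [OF assms(4)] by auto
    then show "k t \<in> topspace X" using x assms(5) by simp
  qed
  fix C assume "closedin X C"
  then have "closedin (top_of_set S) {x \<in> topspace (top_of_set S). h x \<in> C}"
    using assms(4) unfolding continuous_map_closedin by blast
  then have "compact {x \<in> S. h x \<in> C}"
    using closedin_compact [OF assms(1)] by simp
  then have "compact (m ` {x \<in> S. h x \<in> C})"
    using assms(2) by (intro compact_continuous_image) (auto intro: continuous_on_subset)
  moreover have "{t \<in> topspace (top_of_set T). k t \<in> C} = m ` {x \<in> S. h x \<in> C}"
    using assms(3,5) by auto
  ultimately show "closedin (top_of_set T) {t \<in> topspace (top_of_set T). k t \<in> C}"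
    by (intro closed_subset) (auto dest: compact_imp_closed)
qed

text \<open>\<open>qmap\<close> identifies points only on the boundary of the cube, and there
  \<open>h\<close> factors through \<open>qmap\<close> by assumption; so \<open>h\<close> descends
  to the simplex.\<close>

lemma simplex_fill:
  assumes h: "continuous_map (top_of_set (cub p)) X h" and hg: "\<And>x. x \<in> bdcub p \<Longrightarrow> h x = g (qmap x)"
  obtains k where "continuous_map (top_of_set (standard_simplex p)) X k" "\<And>t. t \<in> bdsimp p \<Longrightarrow> k t = g t"
proof -
  define c where "c = (\<lambda>t. SOME x. x \<in> cub p \<and> qmap x = t)"
  have c: "c t \<in> cub p" "qmap (c t) = t" if "t \<in> standard_simplex p" for t
    using someI_ex [of "\<lambda>x. x \<in> cub p \<and> qmap x = t"] qmap_onto [OF that] unfolding c_def by metis+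
  have "h x = h (c (qmap x))" if x: "x \<in> cub p" for x
  proof (cases "x \<in> bdcub p")
    case True
    have "c (qmap x) \<in> bdcub p"
      using qmap_boundary [OF x] qmap_boundary [OF c(1) [OF qmap_simplex [OF x]]] c(2) [OF qmap_simplex [OF x]] True
      by simp
    then show ?thesis using hg True c(2) [OF qmap_simplex [OF x]] by simp
  next
    case False
    then show ?thesis using qmap_inj [OF x False c(1) [OF qmap_simplex [OF x]]] c(2) [OF qmap_simplex [OF x]] by simp
  qed
  moreover have "qmap ` cub p = standard_simplex p"
    using qmap_simplex qmap_onto by (auto simp: image_iff) metis
  ultimately have "continuous_map (top_of_set (standard_simplex p)) X (h \<circ> c)"
    by (intro continuous_map_quotient [OF compact_cub continuous_on_qmap _ h]) auto
  moreover have "(h \<circ> c) t = g t" if "t \<in> bdsimp p" for t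
  proof -
    have t: "t \<in> standard_simplex p" using that by (simp add: bdsimp_def)
    then have "c t \<in> bdcub p" using qmap_boundary [OF c(1) [OF t]] c(2) [OF t] that by simp
    then show ?thesis using hg c(2) [OF t] by simp
  qed
  ultimately show ?thesis by (rule that)
qed

section \<open>Gluing compatible faces to a map on the boundary of a simplex\<close>

definition drop_coord :: "nat \<Rightarrow> (nat \<Rightarrow> real) \<Rightarrow> nat \<Rightarrow> real" where
  "drop_coord i t j = (if j < i then t j else t (Suc j))"

lemma face_drop: "t i = 0 \<Longrightarrow> simplical_face i (drop_coord i t) = t"
  by (auto simp: simplical_face_def drop_coord_def fun_eq_iff)

lemma drop_face: "drop_coord i (simplical_face i t) = t"
  by (auto simp: simplical_face_def drop_coord_def fun_eq_iff)

lemma drop_simplex: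
  assumes "t \<in> standard_simplex (Suc p)" "t i = 0" "i \<le> Suc p"
  shows "drop_coord i t \<in> standard_simplex p"
proof -
  have "{..p} = {..<i} \<union> {i..p}" using assms(3) by auto
  then have "(\<Sum>j\<le>p. drop_coord i t j) = (\<Sum>j<i. drop_coord i t j) + (\<Sum>j=i..p. drop_coord i t j)"
    by (simp add: sum.union_disjoint ivl_disj_int)
  also have "\<dots> = (\<Sum>j<i. t j) + (\<Sum>j=i..p. t (Suc j))"
    by (simp add: drop_coord_def)
  also have "\<dots> = (\<Sum>j<i. t j) + (\<Sum>j=Suc i..Suc p. t j)"
    by (simp only: sum.shift_bounds_cl_Suc_ivl)
  also have "\<dots> = (\<Sum>j\<le>Suc p. t j)"
  proof -
    have "{..Suc p} = {..<i} \<union> ({i} \<union> {Suc i..Suc p})" using assms(3) by auto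
    then have "(\<Sum>j\<le>Suc p. t j) = (\<Sum>j<i. t j) + (\<Sum>j\<in>{i} \<union> {Suc i..Suc p}. t j)"
      by (simp only:) (subst sum.union_disjoint, auto)
    then show ?thesis using assms(2) by (simp add: sum.union_disjoint)
  qed
  finally show ?thesis using assms by (auto simp: standard_simplex_def drop_coord_def)
qed

lemma continuous_on_drop_coord: "continuous_on S (drop_coord i)"
proof (rule continuous_on_coordinatewise_then_product)
  show "continuous_on S (\<lambda>t. drop_coord i t j)" for j
    by (cases "j < i") (simp_all add: drop_coord_def continuous_on_coord)
qed

lemma closed_simplex: "closed (standard_simplex p)"
  using closedin_standard_simplex [of p] by (simp add: powertop_real_euclidean)

lemma continuous_map_closed_UN:
  fixes S :: "'i \<Rightarrow> 'c::topological_space set"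
  assumes "finite I" "\<And>i. i \<in> I \<Longrightarrow> closed (S i)" "\<And>i. i \<in> I \<Longrightarrow> continuous_map (top_of_set (S i)) X f"
  shows "continuous_map (top_of_set (\<Union>i\<in>I. S i)) X f"
  using assms
proof (induction I)
  case empty
  then show ?case by (simp add: continuous_map_def)
next
  case (insert i I)
  then have "continuous_map (top_of_set (S i \<union> (\<Union>i\<in>I. S i))) X f"
    by (intro continuous_map_closed_Un) auto
  then show ?case by simp
qed

text \<open>A boundary point may lie on several faces; the definition uses the first vanishing
  coordinate. Two faces \<open>i < j\<close> meet in a face of codimension 2, where
  \<open>compat\<close> is exactly the agreement of their values.\<close>

lemma glue_faces:
  assumes g: "\<And>i. i \<le> Suc p \<Longrightarrow> singular_simplex p X (g i)" and "1 \<le> p"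
    and compat: "\<And>i j. \<lbrakk>i < j; j \<le> Suc p\<rbrakk> \<Longrightarrow> singular_face p i (g j) = singular_face p (j - 1) (g i)"
  obtains k where "continuous_map (top_of_set (bdsimp (Suc p))) X k"
    "\<And>i u. \<lbrakk>i \<le> Suc p; u \<in> standard_simplex p\<rbrakk> \<Longrightarrow> k (simplical_face i u) = g i u"
proof -
  obtain q where p: "p = Suc q" using \<open>1 \<le> p\<close> by (cases p) auto
  define k where "k = (\<lambda>t. let i = (LEAST i. t i = 0) in g i (drop_coord i t))"
  have lt: "g i (drop_coord i t) = g j (drop_coord j t)"
    if "i < j" "j \<le> Suc p" "t \<in> standard_simplex (Suc p)" "t i = 0" "t j = 0" for i j t
  proof -
    define u where "u = drop_coord i (drop_coord j t)"
    have dj: "drop_coord j t \<in> standard_simplex p" by (rule drop_simplex) (use that in auto)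
    have di0: "drop_coord j t i = 0" using that by (simp add: drop_coord_def)
    have u: "u \<in> standard_simplex q"
      unfolding u_def by (rule drop_simplex) (use dj di0 that p in auto)
    have 1: "simplical_face i u = drop_coord j t" unfolding u_def by (rule face_drop [of "drop_coord j t" i, OF di0])
    have 2: "simplical_face (j - 1) u = drop_coord i t"
    proof
      fix m
      consider "m < i" | "i \<le> m" "m < j - 1" | "m = j - 1" | "j - 1 < m" using that(1) by linarith
      then show "simplical_face (j - 1) u m = drop_coord i t m"
        using that(1,5) by cases (auto simp: u_def simplical_face_def drop_coord_def)
    qed
    have "singular_face p i (g j) u = singular_face p (j - 1) (g i) u" using compat that by simp
    then have "g j (simplical_face i u) = g i (simplical_face (j - 1) u)"
      using u p by (simp add: singular_face_def)
    then show ?thesis by (simp only: 1 2)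
  qed
  have keq: "k t = g i (drop_coord i t)" if "i \<le> Suc p" "t \<in> standard_simplex (Suc p)" "t i = 0" for i t
  proof -
    let ?l = "LEAST i. t i = 0"
    have "t ?l = 0" by (rule LeastI) (rule that(3))
    moreover have "?l \<le> i" by (rule Least_le) (rule that(3))
    ultimately have "g ?l (drop_coord ?l t) = g i (drop_coord i t)"
      using lt [of ?l i t] that by (metis le_neq_implies_less)
    then show ?thesis by (simp add: k_def Let_def)
  qed
  have "continuous_map (top_of_set (\<Union>i\<in>{..Suc p}. standard_simplex (Suc p) \<inter> {t. t i = 0})) X k"
  proof (rule continuous_map_closed_UN)
    fix i assume "i \<in> {..Suc p}"
    then have i: "i \<le> Suc p" by simp
    show "closed (standard_simplex (Suc p) \<inter> {t. t i = 0})"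
      by (intro closed_Int closed_simplex closed_coord)
    show "continuous_map (top_of_set (standard_simplex (Suc p) \<inter> {t. t i = 0})) X k"
    proof (rule continuous_map_via [OF _ continuous_on_drop_coord])
      show "continuous_map (top_of_set (standard_simplex p)) X (g i)"
        using g [OF i] by (simp add: singular_simplex_iff)
    qed (use keq i drop_simplex in auto)
  qed simp
  moreover have "(\<Union>i\<in>{..Suc p}. standard_simplex (Suc p) \<inter> {t. t i = 0}) = bdsimp (Suc p)"
    by (auto simp: bdsimp_def)
  moreover have "k (simplical_face i u) = g i u" if "i \<le> Suc p" "u \<in> standard_simplex p" for i u
  proof -
    have "simplical_face i u \<in> standard_simplex (Suc p)"
      by (rule simplical_face_in_standard_simplex) (use that in auto)
    moreover have "simplical_face i u i = 0" by (simp add: simplical_face_def)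
    ultimately show ?thesis using keq [OF that(1)] by (simp add: drop_face)
  qed
  ultimately show ?thesis using that by simp
qed

lemma simplex_from_boundary:
  assumes k: "\<And>i u. \<lbrakk>i \<le> Suc p; u \<in> standard_simplex p\<rbrakk> \<Longrightarrow> k (simplical_face i u) = g i u"
    and g: "\<And>i. i \<le> Suc p \<Longrightarrow> singular_simplex p X (g i)"
    and h: "continuous_map (top_of_set (cub (Suc p))) X h" "\<And>x. x \<in> bdcub (Suc p) \<Longrightarrow> h x = k (qmap x)"
  obtains f where "singular_simplex (Suc p) X f" "\<And>i. i \<le> Suc p \<Longrightarrow> singular_face (Suc p) i f = g i"
proof -
  obtain f where f: "continuous_map (top_of_set (standard_simplex (Suc p))) X f"
    "\<And>t. t \<in> bdsimp (Suc p) \<Longrightarrow> f t = k t"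
    using simplex_fill [of "Suc p" X h k] h by blast
  let ?f = "restrict f (standard_simplex (Suc p))"
  show ?thesis
  proof (rule that [of ?f])
    show "singular_simplex (Suc p) X ?f"
      unfolding singular_simplex_iff
      by (intro conjI continuous_map_eq [OF f(1)]) auto
    fix i assume i: "i \<le> Suc p"
    show "singular_face (Suc p) i ?f = g i"
    proof (rule extensionalityI)
      show "singular_face (Suc p) i ?f \<in> extensional (standard_simplex p)"
        by (simp add: singular_face_def)
      show "g i \<in> extensional (standard_simplex p)" using g [OF i] by (simp add: singular_simplex_iff)
      fix u assume u: "u \<in> standard_simplex p"
      have s: "simplical_face i u \<in> standard_simplex (Suc p)"
        by (rule simplical_face_in_standard_simplex) (use u i in auto)
      then have "simplical_face i u \<in> bdsimp (Suc p)"
        using i by (auto simp: bdsimp_def simplical_face_def)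
      then show "singular_face (Suc p) i ?f u = g i u"
        using u s f(2) k [OF i u] by (simp add: singular_face_def)
    qed
  qed
qed

section \<open>A simplicial model of the classifying space in \<open>X\<close>\<close>

definition del :: "nat \<Rightarrow> 'v list \<Rightarrow> 'v list" where
  "del i l = take i l @ drop (Suc i) l"

lemma length_del [simp]: "i < length l \<Longrightarrow> length (del i l) = length l - 1"
  by (simp add: del_def)

lemma nth_del: "\<lbrakk>i < length l; k < length l - 1\<rbrakk> \<Longrightarrow> del i l ! k = (if k < i then l ! k else l ! Suc k)"
  by (simp add: del_def nth_append)

lemma del_del:
  assumes "i < j" "j < length l"
  shows "del i (del j l) = del (j - 1) (del i l)"
  by (rule nth_equalityI) (use assms in \<open>auto simp: nth_del\<close>)

lemma set_del: "set (del i l) \<subseteq> set l"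
  by (auto simp: del_def dest: in_set_takeD in_set_dropD)

lemma map_del: "map f (del i l) = del i (map f l)"
  by (simp add: del_def take_map drop_map)

section \<open>Straight lines in simplices and comparison of squares\<close>

definition vtx :: "nat \<Rightarrow> nat \<Rightarrow> real" where
  "vtx k = (\<lambda>j. if j = k then 1 else 0)"

definition line :: "(nat \<Rightarrow> real) \<Rightarrow> (nat \<Rightarrow> real) \<Rightarrow> real \<Rightarrow> nat \<Rightarrow> real" where
  "line y z u = (\<lambda>j. (1 - u) * y j + u * z j)"

lemma line_0 [simp]: "line y z 0 = y" and line_1 [simp]: "line y z 1 = z"
  by (simp_all add: line_def)

lemma vtx_simplex [simp]: "vtx k \<in> standard_simplex p \<longleftrightarrow> k \<le> p"
  unfolding vtx_def by (rule basis_in_standard_simplex)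

lemma simplex_coord: "t \<in> standard_simplex p \<Longrightarrow> t i \<in> {0..1}"
  by (simp add: standard_simplex_def)

lemma line_simplex:
  "\<lbrakk>y \<in> standard_simplex p; z \<in> standard_simplex p; u \<in> {0..1}\<rbrakk> \<Longrightarrow> line y z u \<in> standard_simplex p"
  unfolding line_def by (rule convex_standard_simplex) auto

lemma continuous_on_line [continuous_intros]:
  fixes f g :: "'c::topological_space \<Rightarrow> nat \<Rightarrow> real"
  assumes "continuous_on S f" "continuous_on S g" "continuous_on S u"
  shows "continuous_on S (\<lambda>x. line (f x) (g x) (u x))"
proof (rule continuous_on_coordinatewise_then_product)
  show "continuous_on S (\<lambda>x. line (f x) (g x) (u x) i)" for i
    unfolding line_def
    by (intro continuous_intros assms continuous_on_product_then_coordinatewise [OF assms(1)]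
        continuous_on_product_then_coordinatewise [OF assms(2)])
qed

lemma face_line: "simplical_face i (line y z u) = line (simplical_face i y) (simplical_face i z) u"
  by (auto simp: simplical_face_def line_def fun_eq_iff)

lemma face_vtx: "simplical_face i (vtx k) = vtx (if k < i then k else Suc k)"
  by (auto simp: simplical_face_def vtx_def fun_eq_iff)

lemma Sq_cong:
  assumes "Sq X p q r t"
    and "\<And>u. u \<in> {0..1} \<Longrightarrow> p u = p' u" "\<And>u. u \<in> {0..1} \<Longrightarrow> q u = q' u"
      "\<And>u. u \<in> {0..1} \<Longrightarrow> r u = r' u" "\<And>u. u \<in> {0..1} \<Longrightarrow> t u = t' u"
  shows "Sq X p' q' r' t'"
  using assms unfolding Sq_def by metis

text \<open>\<open>Sq_box\<close> started from the square at the far ends of the four homotopies,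
  which are therefore run backwards. Typical use: two loops, each joined to a path by its own
  square, are compared when the paths are connected by a square.\<close>

lemma Sq_compare:
  assumes "Sq X \<sigma> \<sigma>' \<gamma> \<delta>" "Sq X p \<sigma> \<alpha> \<beta>" "Sq X p' \<sigma>' \<alpha>' \<beta>'" "Sq X \<epsilon> \<gamma> \<alpha> \<alpha>'" "Sq X \<zeta> \<delta> \<beta> \<beta>'"
  shows "Sq X p p' \<epsilon> \<zeta>"
proof -
  have flip: "Sq X (\<lambda>u. r (1 - u)) (\<lambda>u. t (1 - u)) q p" if "Sq X p q r t" for p q r t
    by (rule Sq_reverse [OF Sq_transpose [OF that]])
  show ?thesis
    by (rule Sq_box [OF assms(1) flip [OF assms(2)] flip [OF assms(3)] flip [OF assms(4)] flip [OF assms(5)]])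
qed

lemma Sq_hom:
  assumes "continuous_map (top_of_set T) X f" "continuous_on ({0..1} \<times> {0..1}) m"
    "\<And>u v. \<lbrakk>u \<in> {0..1}; v \<in> {0..1}\<rbrakk> \<Longrightarrow> m (u, v) \<in> T"
  shows "Sq X (\<lambda>u. f (m (u, 0))) (\<lambda>u. f (m (u, 1))) (\<lambda>u. f (m (0, u))) (\<lambda>u. f (m (1, u)))"
proof -
  have "continuous_map (top_of_set ({0..1} \<times> {0..1})) X (\<lambda>z. f (m z))"
    by (rule continuous_map_via [OF assms(1,2)]) (use assms(3) in auto)
  then show ?thesis unfolding Sq_def by blast
qed

text \<open>Dimensions 1 and 2 are governed by \<open>lp\<close> and the product formula; the
  vanishing of higher homotopy groups enters only as \<open>fill\<close>, for cubes of dimension at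
  least 3. The condition at the origin is present because the vanishing is used at the base point
  \<open>x0\<close>.\<close>

locale aspherical_space =
  fixes X :: "'a topology" and x0 :: 'a and P :: "'p monoid" and lp :: "'p \<Rightarrow> real \<Rightarrow> 'a"
  assumes grp: "group P" and x0: "x0 \<in> topspace X"
    and lp_loop: "a \<in> carrier P \<Longrightarrow> loop X x0 (lp a)"
    and lp_onto: "loop X x0 p \<Longrightarrow> \<exists>a \<in> carrier P. Sq X p (lp a) (\<lambda>_. x0) (\<lambda>_. x0)"
    and lp_Sq: "\<lbrakk>a \<in> carrier P; b \<in> carrier P; c \<in> carrier P; d \<in> carrier P\<rbrakk> \<Longrightarrow>
       Sq X (lp a) (lp b) (lp c) (lp d) \<longleftrightarrow> c \<otimes>\<^bsub>P\<^esub> b = a \<otimes>\<^bsub>P\<^esub> d"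
    and lp_one: "Sq X (lp \<one>\<^bsub>P\<^esub>) (\<lambda>_. x0) (\<lambda>_. x0) (\<lambda>_. x0)"
    and fill: "\<lbrakk>2 \<le> q; continuous_map (top_of_set (bdcub (Suc q))) X g; g (\<lambda>_. 0) = x0\<rbrakk> \<Longrightarrow>
       \<exists>h. continuous_map (top_of_set (cub (Suc q))) X h \<and> (\<forall>x \<in> bdcub (Suc q). h x = g x)"
begin

sublocale P: group P by (rule grp)

lemma Sq_still: "Sq X (\<lambda>_. p 0) (\<lambda>_. p 1) p p" if "pathin X p" for p
  by (rule Sq_transpose [OF Sq_const [OF that]])

lemma lp_still: "Sq X (\<lambda>_. x0) (\<lambda>_. x0) (lp a) (lp a)" if "a \<in> carrier P" for a
  using Sq_still [of "lp a"] lp_loop [OF that] by (simp add: loop_def)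

text \<open>Replacing both constant sides by the loop of the unit turns the homotopy into a square
  to which the product formula applies.\<close>

lemma lp_unique:
  assumes "w \<in> carrier P" "w' \<in> carrier P" "Sq X (lp w) (lp w') (\<lambda>_. x0) (\<lambda>_. x0)"
  shows "w = w'"
proof -
  have one: "Sq X (\<lambda>_. x0) (\<lambda>_. x0) (\<lambda>_. x0) (lp \<one>\<^bsub>P\<^esub>)"
    using Sq_reverse [OF Sq_transpose [OF lp_one]] by simp
  have "Sq X (lp w) (lp w') (lp \<one>\<^bsub>P\<^esub>) (lp \<one>\<^bsub>P\<^esub>)"
    by (rule Sq_box [OF assms(3) lp_still [OF assms(1)] lp_still [OF assms(2)] one one])
  then show ?thesis using lp_Sq [of w w' "\<one>\<^bsub>P\<^esub>" "\<one>\<^bsub>P\<^esub>"] assms by simp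
qed

text \<open>Realisation of the simplices of the bar construction.  The predicate under the choice operator depends
  on \<open>l\<close> only through the faces, so by induction \<open>cell\<close> is automatically invariant under left translation.\<close>

fun cell :: "nat \<Rightarrow> 'p list \<Rightarrow> (nat \<Rightarrow> real) \<Rightarrow> 'a" where
  "cell 0 l = (\<lambda>t \<in> standard_simplex 0. x0)"
| "cell (Suc 0) l = (\<lambda>t \<in> standard_simplex 1. lp (inv\<^bsub>P\<^esub> (l ! 0) \<otimes>\<^bsub>P\<^esub> l ! 1) (t 1))"
| "cell (Suc (Suc p)) l = (SOME h. singular_simplex (Suc (Suc p)) X h \<and>
     (\<forall>i \<le> Suc (Suc p). singular_face (Suc (Suc p)) i h = cell (Suc p) (del i l)))"

definition word :: "nat \<Rightarrow> 'p list \<Rightarrow> bool" where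
  "word p l \<longleftrightarrow> length l = Suc p \<and> set l \<subseteq> carrier P"

lemma word_del: "\<lbrakk>word (Suc p) l; i \<le> Suc p\<rbrakk> \<Longrightarrow> word p (del i l)"
  using set_del [of i l] by (auto simp: word_def)

lemma word_nth: "\<lbrakk>word p l; i \<le> p\<rbrakk> \<Longrightarrow> l ! i \<in> carrier P"
  unfolding word_def by (metis le_imp_less_Suc nth_mem subsetD)

text \<open>The invariant of the recursive construction. The value at vertex 0 is carried along
  because \<open>fill\<close> asks for the base point, and later because the rays start
  there.\<close>

definition good :: "nat \<Rightarrow> 'p list \<Rightarrow> bool" where
  "good p l \<longleftrightarrow> singular_simplex p X (cell p l) \<and> cell p l (vtx 0) = x0 \<and>
     (\<forall>q. p = Suc q \<longrightarrow> (\<forall>i \<le> p. singular_face p i (cell p l) = cell q (del i l)))"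

lemma good_0: "good 0 l"
  using x0 by (simp add: good_def singular_simplex_iff)

lemma simplex_0: "u \<in> standard_simplex 0 \<Longrightarrow> u = vtx 0"
  by (simp add: standard_simplex_0 vtx_def)

lemma good_1:
  assumes "word (Suc 0) l"
  shows "good (Suc 0) l"
proof -
  define a where "a = inv\<^bsub>P\<^esub> (l ! 0) \<otimes>\<^bsub>P\<^esub> l ! 1"
  have a: "a \<in> carrier P" unfolding a_def using word_nth [OF assms, of 0] word_nth [OF assms, of 1] by simp
  have c: "cell (Suc 0) l = (\<lambda>t \<in> standard_simplex 1. lp a (t 1))" by (simp add: a_def)
  have lp: "pathin X (lp a)" "lp a 0 = x0" "lp a 1 = x0" using lp_loop [OF a] by (auto simp: loop_def)
  have "continuous_map (top_of_set (standard_simplex 1)) X (\<lambda>t. lp a (t 1))"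
    by (rule continuous_map_via [OF lp(1) [unfolded pathin_def], where m = "\<lambda>t. t 1"])
      (use simplex_coord in \<open>simp_all add: continuous_on_coord\<close>)
  then have "continuous_map (top_of_set (standard_simplex 1)) X (\<lambda>t \<in> standard_simplex 1. lp a (t 1))"
    by (rule continuous_map_eq) simp
  then have "singular_simplex (Suc 0) X (cell (Suc 0) l)"
    unfolding c singular_simplex_iff by simp
  moreover have "cell (Suc 0) l (vtx 0) = x0"
    unfolding c using lp(2) by (simp add: vtx_def)
  moreover have "singular_face (Suc 0) i (cell (Suc 0) l) = cell 0 (del i l)" if "i \<le> Suc 0" for i
  proof
    fix u
    show "singular_face (Suc 0) i (cell (Suc 0) l) u = cell 0 (del i l) u"
    proof (cases "u \<in> standard_simplex 0")
      case True
      then have u: "simplical_face i u = vtx (if i = 0 then 1 else 0)"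
        using simplex_0 [OF True] face_vtx [of i 0] by auto
      have "vtx (if i = 0 then 1 else 0) \<in> standard_simplex 1" by simp
      then have "cell (Suc 0) l (simplical_face i u) = x0"
        unfolding c u using lp by (auto simp: vtx_def)
      then show ?thesis using True by (simp add: singular_face_def del: cell.simps(2))
    qed (simp add: singular_face_def del: cell.simps(2))
  qed
  ultimately show ?thesis by (simp add: good_def del: cell.simps)
qed

text \<open>Vertex 0 lies on the last face, so its value is inherited from there.\<close>

lemma good_step:
  assumes l: "word (Suc (Suc p)) l" and g: "\<And>i. i \<le> Suc (Suc p) \<Longrightarrow> good (Suc p) (del i l)"
    and ex: "\<exists>h. singular_simplex (Suc (Suc p)) X h \<and>
       (\<forall>i \<le> Suc (Suc p). singular_face (Suc (Suc p)) i h = cell (Suc p) (del i l))"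
  shows "good (Suc (Suc p)) l"
proof -
  have *: "singular_simplex (Suc (Suc p)) X (cell (Suc (Suc p)) l)"
    "\<And>i. i \<le> Suc (Suc p) \<Longrightarrow> singular_face (Suc (Suc p)) i (cell (Suc (Suc p)) l) = cell (Suc p) (del i l)"
    using someI_ex [OF ex] unfolding cell.simps(3) by blast+
  have "cell (Suc (Suc p)) l (vtx 0) = cell (Suc (Suc p)) l (simplical_face (Suc (Suc p)) (vtx 0))"
    by (simp add: face_vtx del: cell.simps)
  also have "\<dots> = singular_face (Suc (Suc p)) (Suc (Suc p)) (cell (Suc (Suc p)) l) (vtx 0)"
    by (simp add: singular_face_def del: cell.simps)
  also have "\<dots> = x0" using *(2) [of "Suc (Suc p)"] g [of "Suc (Suc p)"] by (simp add: good_def del: cell.simps)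
  finally show ?thesis using * unfolding good_def by (simp del: cell.simps)
qed

lemma cell_compat:
  assumes l: "word (Suc (Suc p)) l" and g: "\<And>i. i \<le> Suc (Suc p) \<Longrightarrow> good (Suc p) (del i l)"
    and ij: "i < j" "j \<le> Suc (Suc p)"
  shows "singular_face (Suc p) i (cell (Suc p) (del j l)) = singular_face (Suc p) (j - 1) (cell (Suc p) (del i l))"
proof -
  have "singular_face (Suc p) i (cell (Suc p) (del j l)) = cell p (del i (del j l))"
    using g [OF ij(2)] ij by (simp add: good_def del: cell.simps)
  also have "del i (del j l) = del (j - 1) (del i l)"
    by (rule del_del) (use ij l in \<open>auto simp: word_def\<close>)
  also have "cell p (del (j - 1) (del i l)) = singular_face (Suc p) (j - 1) (cell (Suc p) (del i l))"
    using g [of i] ij by (simp add: good_def del: cell.simps)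
  finally show ?thesis .
qed

definition edge :: "real \<Rightarrow> nat \<Rightarrow> real" where
  "edge u = line (vtx 0) (vtx 1) u"

lemma edge_simplex: "u \<in> {0..1} \<Longrightarrow> 1 \<le> p \<Longrightarrow> edge u \<in> standard_simplex p"
  unfolding edge_def by (rule line_simplex) auto

lemma cell_edge_1: "u \<in> {0..1} \<Longrightarrow> cell (Suc 0) l (edge u) = lp (inv\<^bsub>P\<^esub> (l ! 0) \<otimes>\<^bsub>P\<^esub> l ! 1) u"
  using edge_simplex [of u 1] by (simp add: edge_def line_def vtx_def)

text \<open>The edges multiply correctly, (a\<inverse> b)(b\<inverse> c) = a\<inverse> c, so there
  is a square with these three sides and the unit on the left; through \<open>qmap\<close> it
  becomes a filling of the triangle.\<close>

lemma triangle_fill: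
  assumes l: "word 2 l"
    and k: "\<And>i u. \<lbrakk>i \<le> 2; u \<in> standard_simplex 1\<rbrakk> \<Longrightarrow> k (simplical_face i u) = cell 1 (del i l) u"
  obtains h where "continuous_map (top_of_set (cub 2)) X h" "\<And>x. x \<in> bdcub 2 \<Longrightarrow> h x = k (qmap x)"
proof -
  define a b c where "a = l ! 0" and "b = l ! 1" and "c = l ! 2"
  have abc: "a \<in> carrier P" "b \<in> carrier P" "c \<in> carrier P"
    unfolding a_def b_def c_def using word_nth [OF l] by auto
  have len: "length l = 3" using l by (simp add: word_def)
  have L: "inv\<^bsub>P\<^esub> a \<otimes>\<^bsub>P\<^esub> b \<in> carrier P" "inv\<^bsub>P\<^esub> a \<otimes>\<^bsub>P\<^esub> c \<in> carrier P" "inv\<^bsub>P\<^esub> b \<otimes>\<^bsub>P\<^esub> c \<in> carrier P"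
    using abc by auto
  have "b \<otimes>\<^bsub>P\<^esub> (inv\<^bsub>P\<^esub> b \<otimes>\<^bsub>P\<^esub> c) = c" using abc by (simp flip: P.m_assoc)
  then have "\<one>\<^bsub>P\<^esub> \<otimes>\<^bsub>P\<^esub> (inv\<^bsub>P\<^esub> a \<otimes>\<^bsub>P\<^esub> c) = inv\<^bsub>P\<^esub> a \<otimes>\<^bsub>P\<^esub> b \<otimes>\<^bsub>P\<^esub> (inv\<^bsub>P\<^esub> b \<otimes>\<^bsub>P\<^esub> c)"
    using abc by (simp add: P.m_assoc)
  then have sq: "Sq X (lp (inv\<^bsub>P\<^esub> a \<otimes>\<^bsub>P\<^esub> b)) (lp (inv\<^bsub>P\<^esub> a \<otimes>\<^bsub>P\<^esub> c)) (lp \<one>\<^bsub>P\<^esub>) (lp (inv\<^bsub>P\<^esub> b \<otimes>\<^bsub>P\<^esub> c))"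
    using lp_Sq [OF L(1,2) P.one_closed L(3)] by simp
  \<comment> \<open>The left side must be constant and not merely null homotopic, because
    \<open>qmap\<close> collapses the side \<open>x 0 = 0\<close> to vertex 0.\<close>
  have "Sq X (lp (inv\<^bsub>P\<^esub> a \<otimes>\<^bsub>P\<^esub> b)) (lp (inv\<^bsub>P\<^esub> a \<otimes>\<^bsub>P\<^esub> c)) (\<lambda>_. x0) (lp (inv\<^bsub>P\<^esub> b \<otimes>\<^bsub>P\<^esub> c))"
    by (rule Sq_box [OF sq lp_still [OF L(1)] lp_still [OF L(2)] Sq_transpose [OF lp_one] lp_still [OF L(3)]])
  then obtain h where h: "continuous_map (top_of_set ({0..1} \<times> {0..1})) X h"
    "\<And>u. u \<in> {0..1} \<Longrightarrow> h (u, 0) = lp (inv\<^bsub>P\<^esub> a \<otimes>\<^bsub>P\<^esub> b) u \<and> h (u, 1) = lp (inv\<^bsub>P\<^esub> a \<otimes>\<^bsub>P\<^esub> c) u \<and>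
       h (0, u) = x0 \<and> h (1, u) = lp (inv\<^bsub>P\<^esub> b \<otimes>\<^bsub>P\<^esub> c) u"
    unfolding Sq_def by blast
  have q: "qmap x j = (if j = 0 then 1 - x 0 else if j = 1 then x 0 * (1 - x 1) else if j = 2 then x 0 * x 1 else 0)"
    if "x \<in> cub 2" for x j
  proof -
    have x: "x 2 = 0" using that by (simp add: cub_def)
    consider "j = 0" | "j = 1" | "j = 2" | "j > 2" by linarith
    then show ?thesis
    proof cases
      case 4
      then have "(\<Prod>i<j. x i) = 0" using x by (intro prod_zero) auto
      then show ?thesis using 4 by (simp add: qmap_alt)
    qed (use x in \<open>simp_all add: qmap_alt numeral_2_eq_2\<close>)
  qed
  have v: "k t = lp (inv\<^bsub>P\<^esub> (del i l ! 0) \<otimes>\<^bsub>P\<^esub> del i l ! 1) u"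
    if "i \<le> 2" "u \<in> {0..1}" "t = simplical_face i (edge u)" for i u t
    using k [OF that(1) edge_simplex [of u 1]] that cell_edge_1 [OF that(2), of "del i l"]
    by (simp del: cell.simps)
  show ?thesis
  proof (rule that [of "\<lambda>x. h (x 0, x 1)"])
    show "continuous_map (top_of_set (cub 2)) X (\<lambda>x. h (x 0, x 1))"
      by (rule continuous_map_via [OF h(1), where m = "\<lambda>x. (x 0, x 1)"])
        (auto simp: cub_def intro!: continuous_on_Pair continuous_on_coord)
    fix x assume "x \<in> bdcub 2"
    then have x: "x \<in> cub 2" and "\<exists>i<2. x i = 0 \<or> x i = 1" by (auto simp: bdcub_def)
    then consider "x 1 = 0" | "x 1 = 1" | "x 0 = 0" | "x 0 = 1"
      by (auto simp: less_2_cases_iff)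
    moreover have xI: "x 0 \<in> {0..1}" "x 1 \<in> {0..1}" using cub_bounds [OF x] by auto
    ultimately show "h (x 0, x 1) = k (qmap x)"
    proof cases
      case 1
      have "qmap x = simplical_face 2 (edge (x 0))"
        using 1 by (auto simp: fun_eq_iff q [OF x] simplical_face_def edge_def line_def vtx_def)
      then have "k (qmap x) = lp (inv\<^bsub>P\<^esub> a \<otimes>\<^bsub>P\<^esub> b) (x 0)"
        using v [of 2 "x 0"] xI len by (simp add: nth_del a_def b_def)
      then show ?thesis using h(2) [OF xI(1)] 1 by simp
    next
      case 2
      have "qmap x = simplical_face 1 (edge (x 0))"
        using 2 by (auto simp: fun_eq_iff q [OF x] simplical_face_def edge_def line_def vtx_def)
      then have "k (qmap x) = lp (inv\<^bsub>P\<^esub> a \<otimes>\<^bsub>P\<^esub> c) (x 0)"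
        using v [of 1 "x 0"] xI len by (simp add: nth_del a_def c_def numeral_2_eq_2)
      then show ?thesis using h(2) [OF xI(1)] 2 by simp
    next
      case 3
      have "qmap x = simplical_face 2 (edge 0)"
        using 3 by (auto simp: fun_eq_iff q [OF x] simplical_face_def edge_def line_def vtx_def)
      then have "k (qmap x) = lp (inv\<^bsub>P\<^esub> a \<otimes>\<^bsub>P\<^esub> b) 0"
        using v [of 2 0] len by (simp add: nth_del a_def b_def)
      then show ?thesis using h(2) [OF xI(2)] 3 lp_loop [OF L(1)] by (simp add: loop_def)
    next
      case 4
      have "qmap x = simplical_face 0 (edge (x 1))"
        using 4 by (auto simp: fun_eq_iff q [OF x] simplical_face_def edge_def line_def vtx_def)
      then have "k (qmap x) = lp (inv\<^bsub>P\<^esub> b \<otimes>\<^bsub>P\<^esub> c) (x 1)"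
        using v [of 0 "x 1"] xI len by (simp add: nth_del b_def c_def numeral_2_eq_2)
      then show ?thesis using h(2) [OF xI(2)] 4 by simp
    qed
  qed
qed

lemma qmap_zero: "qmap (\<lambda>_. 0) = vtx 0"
  by (auto simp: qmap_alt vtx_def fun_eq_iff)

text \<open>The faces fit together by the simplicial identities and are glued to a boundary map.
  Pulled back to a cube along \<open>qmap\<close>, it is filled by \<open>triangle_fill\<close> in
  dimension 2 and by \<open>fill\<close> above, and the filling descends to the simplex.\<close>

lemma cell_good: "word p l \<Longrightarrow> good p l"
proof (induction p arbitrary: l)
  case 0
  show ?case by (rule good_0)
next
  case (Suc p)
  show ?case
  proof (cases p)
    case 0
    then show ?thesis using good_1 Suc.prems by simp
  next
    case p: (Suc p')
    let ?g = "\<lambda>i. cell (Suc p') (del i l)"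
    have l: "word (Suc (Suc p')) l" using Suc.prems p by simp
    have gd: "good (Suc p') (del i l)" if "i \<le> Suc (Suc p')" for i
      using Suc.IH [of "del i l"] word_del [OF l that] p by simp
    have gs: "singular_simplex (Suc p') X (?g i)" if "i \<le> Suc (Suc p')" for i
      using gd [OF that] by (simp add: good_def del: cell.simps)
    have compat: "singular_face (Suc p') i (?g j) = singular_face (Suc p') (j - 1) (?g i)"
      if "i < j" "j \<le> Suc (Suc p')" for i j
      by (rule cell_compat [OF l gd that])
    have "\<exists>k. continuous_map (top_of_set (bdsimp (Suc (Suc p')))) X k \<and>
      (\<forall>i \<le> Suc (Suc p'). \<forall>u \<in> standard_simplex (Suc p'). k (simplical_face i u) = ?g i u)"
    proof (rule glue_faces [of "Suc p'" X ?g])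
      fix k
      assume "continuous_map (top_of_set (bdsimp (Suc (Suc p')))) X k"
        "\<And>i u. \<lbrakk>i \<le> Suc (Suc p'); u \<in> standard_simplex (Suc p')\<rbrakk> \<Longrightarrow> k (simplical_face i u) = ?g i u"
      then show ?thesis by blast
    qed (use gs compat in simp_all)
    then obtain k where k: "continuous_map (top_of_set (bdsimp (Suc (Suc p')))) X k"
      "\<And>i u. \<lbrakk>i \<le> Suc (Suc p'); u \<in> standard_simplex (Suc p')\<rbrakk> \<Longrightarrow> k (simplical_face i u) = ?g i u"
      by blast
    have "\<exists>h. continuous_map (top_of_set (cub (Suc (Suc p')))) X h \<and> (\<forall>x \<in> bdcub (Suc (Suc p')). h x = k (qmap x))"
    proof (cases "p' = 0")
      case True
      have l2: "word 2 l" using l True by (simp add: numeral_2_eq_2)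
      have k2: "k (simplical_face i u) = cell 1 (del i l) u" if "i \<le> 2" "u \<in> standard_simplex 1" for i u
        using k(2) [of i u] that True by (simp add: numeral_2_eq_2 del: cell.simps)
      have "\<exists>h. continuous_map (top_of_set (cub 2)) X h \<and> (\<forall>x \<in> bdcub 2. h x = k (qmap x))"
        by (rule triangle_fill [OF l2, of k]) (use k2 in blast)+
      then show ?thesis unfolding True numeral_2_eq_2 by simp
    next
      case False
      have "continuous_map (top_of_set (bdcub (Suc (Suc p')))) X (k \<circ> qmap)"
        by (rule continuous_map_via [OF k(1) continuous_on_qmap])
          (use qmap_boundary in \<open>auto simp: bdcub_def\<close>)
      moreover have "(k \<circ> qmap) (\<lambda>_. 0) = x0"
        using k(2) [of "Suc (Suc p')" "vtx 0"] gd [of "Suc (Suc p')"]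
        by (simp add: qmap_zero face_vtx good_def del: cell.simps)
      ultimately show ?thesis using fill [of "Suc p'" "k \<circ> qmap"] False by auto
    qed
    then obtain h where h: "continuous_map (top_of_set (cub (Suc (Suc p')))) X h"
      "\<And>x. x \<in> bdcub (Suc (Suc p')) \<Longrightarrow> h x = k (qmap x)" by blast
    have "\<exists>f. singular_simplex (Suc (Suc p')) X f \<and>
        (\<forall>i \<le> Suc (Suc p'). singular_face (Suc (Suc p')) i f = ?g i)"
      by (rule simplex_from_boundary [of "Suc p'" k ?g X h]) (use k(2) gs h in blast)+
    from good_step [OF l _ this] gd have "good (Suc (Suc p')) l" by blast
    then show ?thesis using p by simp
  qed
qed

declare cell.simps [simp del]

lemma cell_translate:
  "\<lbrakk>word p l; g \<in> carrier P\<rbrakk> \<Longrightarrow> cell p (map (\<lambda>x. g \<otimes>\<^bsub>P\<^esub> x) l) = cell p l"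
proof (induction p l rule: cell.induct)
  case (2 l)
  have "length l = 2" using 2 by (simp add: word_def)
  moreover have "inv\<^bsub>P\<^esub> (g \<otimes>\<^bsub>P\<^esub> l ! 0) \<otimes>\<^bsub>P\<^esub> (g \<otimes>\<^bsub>P\<^esub> l ! 1) = inv\<^bsub>P\<^esub> (l ! 0) \<otimes>\<^bsub>P\<^esub> l ! 1"
    using word_nth [OF 2(1), of 0] word_nth [OF 2(1), of 1] 2(2)
    by (simp add: P.inv_mult_group P.m_assoc) (simp flip: P.m_assoc)
  ultimately show ?case by (simp add: cell.simps)
next
  case (3 p l)
  have "cell (Suc p) (del i (map (\<lambda>x. g \<otimes>\<^bsub>P\<^esub> x) l)) = cell (Suc p) (del i l)" if "i \<le> Suc (Suc p)" for i
    using 3 that word_del [OF 3(2) that] by (simp flip: map_del)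
  then show ?case by (simp add: cell.simps cong: conj_cong)
qed (simp add: cell.simps)

lemma cell_continuous: "word p l \<Longrightarrow> continuous_map (top_of_set (standard_simplex p)) X (cell p l)"
  using cell_good [of p l] by (simp add: good_def singular_simplex_iff)

lemma cell_base: "word p l \<Longrightarrow> cell p l (vtx 0) = x0"
  using cell_good [of p l] by (simp add: good_def)

lemma cell_face:
  assumes "word (Suc p) l" "i \<le> Suc p" "u \<in> standard_simplex p"
  shows "cell (Suc p) l (simplical_face i u) = cell p (del i l) u"
proof -
  have "singular_face (Suc p) i (cell (Suc p) l) = cell p (del i l)"
    using cell_good [OF assms(1)] assms(2) by (simp add: good_def)
  then have "singular_face (Suc p) i (cell (Suc p) l) u = cell p (del i l) u" by simp
  then show ?thesis using assms(3) by (simp add: singular_face_def)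
qed

text \<open>The edge from 0 to 1 survives removal of the last vertex, so the claim reduces to
  dimension 1. This edge is what changes when face 0 replaces the base vertex.\<close>

lemma cell_edge:
  "\<lbrakk>word (Suc p) l; u \<in> {0..1}\<rbrakk> \<Longrightarrow> cell (Suc p) l (edge u) = lp (inv\<^bsub>P\<^esub> (l ! 0) \<otimes>\<^bsub>P\<^esub> l ! 1) u"
proof (induction p arbitrary: l)
  case 0
  then show ?case using cell_edge_1 by simp
next
  case (Suc p)
  have "simplical_face (Suc (Suc p)) (edge u) = edge u"
    by (simp add: edge_def face_line face_vtx)
  then have "cell (Suc (Suc p)) l (edge u) = cell (Suc p) (del (Suc (Suc p)) l) (edge u)"
    using cell_face [OF Suc.prems(1), of "Suc (Suc p)" "edge u"] edge_simplex [OF Suc.prems(2), of "Suc p"] by simp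
  also have "\<dots> = lp (inv\<^bsub>P\<^esub> (l ! 0) \<otimes>\<^bsub>P\<^esub> l ! 1) u"
    using Suc.IH [OF word_del [OF Suc.prems(1)] Suc.prems(2), of "Suc (Suc p)"] Suc.prems(1)
    by (simp add: nth_del word_def)
  finally show ?case .
qed

end

section \<open>Labels from path sections\<close>

text \<open>One half of the exponential law; it rests on the local compactness of the unit
  interval.\<close>

lemma path_eval_continuous:
  fixes D :: "'c::topological_space set"
  assumes s: "continuous_map (subtopology (prod_topology X X) U) (path_space X) s"
    and m: "continuous_map (top_of_set D) (prod_topology X X) m" "\<And>z. z \<in> D \<Longrightarrow> m z \<in> U"
  shows "continuous_map (top_of_set (D \<times> {0..1::real})) X (\<lambda>(z, u). s (m z) u)"
proof -
  have sm: "continuous_map (top_of_set D) (path_space X) (s \<circ> m)"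
    by (rule continuous_map_compose [OF _ s]) (use m in \<open>auto simp: continuous_map_in_subtopology\<close>)
  have path: "pathin X (s (m z))" if "z \<in> D" for z
  proof -
    have "s (m z) \<in> topspace (path_space X)"
      using continuous_map_image_subset_topspace [OF sm] that by auto
    then show ?thesis by (auto simp: path_space_def topology_generated_by_topspace path_set_def)
  qed
  show ?thesis
    unfolding continuous_map_def
  proof (intro conjI allI impI)
    show "(\<lambda>(z, u). s (m z) u) \<in> topspace (top_of_set (D \<times> {0..1::real})) \<rightarrow> topspace X"
    proof
      fix x assume "x \<in> topspace (top_of_set (D \<times> {0..1::real}))"
      then obtain z u where x: "x = (z, u)" "z \<in> D" "u \<in> {0..1::real}" by auto
      have "s (m z) u \<in> topspace X"
        using path [OF x(2)] x(3) unfolding pathin_def continuous_map_def by auto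
      then show "(case x of (z, u) \<Rightarrow> s (m z) u) \<in> topspace X" using x(1) by simp
    qed
    fix V assume V: "openin X V"
    let ?S = "{x \<in> topspace (top_of_set (D \<times> {0..1::real})). (case x of (z, u) \<Rightarrow> s (m z) u) \<in> V}"
    show "openin (top_of_set (D \<times> {0..1::real})) ?S"
    proof (subst openin_subopen, intro ballI)
      fix x assume "x \<in> ?S"
      then obtain z0 u0 where x: "x = (z0, u0)" "z0 \<in> D" "u0 \<in> {0..1::real}" "s (m z0) u0 \<in> V" by auto
      have "openin (top_of_set {0..1::real}) {u \<in> topspace (top_of_set {0..1::real}). s (m z0) u \<in> V}"
        using path [OF x(2)] V unfolding pathin_def continuous_map by blast
      then obtain e where e: "e > 0" "\<And>u. \<lbrakk>u \<in> {0..1::real}; dist u u0 < e\<rbrakk> \<Longrightarrow> s (m z0) u \<in> V"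
        using x(3,4) unfolding openin_euclidean_subtopology_iff by fastforce
      \<comment> \<open>A compact neighbourhood of \<open>u0\<close> mapped into \<open>V\<close>;
        \<open>W\<close> is then a subbasic open set of the compact-open topology. The radius
        \<open>e / 2\<close> keeps the closed ball inside the open one of radius
        \<open>e\<close>.\<close>
      define C where "C = {0..1::real} \<inter> cball u0 (e / 2)"
      define W where "W = {\<gamma> \<in> path_set X. \<gamma> ` C \<subseteq> V}"
      have "compact C" "C \<subseteq> {0..1::real}" by (auto simp: C_def intro: compact_Int)
      then have "openin (path_space X) W"
        unfolding path_space_def W_def using V by (intro topology_generated_by_Basis) blast
      then have N: "openin (top_of_set D) {z \<in> topspace (top_of_set D). (s \<circ> m) z \<in> W}"
        using sm unfolding continuous_map by blast
      define T where "T = {z \<in> D. s (m z) \<in> W} \<times> ({0..1::real} \<inter> ball u0 (e / 2))"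
      have "openin (top_of_set {0..1::real}) ({0..1::real} \<inter> ball u0 (e / 2))"
        by (intro openin_open_Int) simp
      then have "openin (prod_topology (top_of_set D) (top_of_set {0..1::real})) T"
        unfolding T_def openin_prod_Times_iff using N by simp
      then have "openin (top_of_set (D \<times> {0..1::real})) T" by simp
      moreover have "x \<in> T"
      proof -
        have "s (m z0) u \<in> V" if "u \<in> C" for u
          by (rule e(2)) (use that e(1) in \<open>auto simp: C_def dist_commute\<close>)
        moreover have "s (m z0) \<in> path_set X"
          using continuous_map_image_subset_topspace [OF sm] x(2)
          by (auto simp: path_space_def topology_generated_by_topspace)
        ultimately have "s (m z0) \<in> W" by (auto simp: W_def)
        then show ?thesis using x e(1) by (simp add: T_def)
      qed
      moreover have "T \<subseteq> ?S"
      proof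
        fix y assume "y \<in> T"
        then obtain z u where y: "y = (z, u)" "z \<in> D" "s (m z) \<in> W" "u \<in> {0..1::real} \<inter> ball u0 (e / 2)"
          by (auto simp: T_def)
        then have "u \<in> C" by (auto simp: C_def)
        then have "s (m z) u \<in> V" using y(3) unfolding W_def by blast
        then show "y \<in> ?S" using y by simp
      qed
      ultimately show "\<exists>T. openin (top_of_set (D \<times> {0..1::real})) T \<and> x \<in> T \<and> T \<subseteq> ?S" by blast
    qed
  qed
qed

locale motion_planner = aspherical_space X x0 P lp
  for X :: "'a topology" and x0 :: 'a and P :: "'p monoid" and lp :: "'p \<Rightarrow> real \<Rightarrow> 'a" +
  fixes k :: nat and U :: "nat \<Rightarrow> ('a \<times> 'a) set" and sec :: "nat \<Rightarrow> 'a \<times> 'a \<Rightarrow> real \<Rightarrow> 'a"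
  assumes U_open: "i \<le> k \<Longrightarrow> openin (prod_topology X X) (U i)"
    and sec_cont: "i \<le> k \<Longrightarrow> continuous_map (subtopology (prod_topology X X) (U i)) (path_space X) (sec i)"
    and sec_ends: "\<lbrakk>i \<le> k; z \<in> U i\<rbrakk> \<Longrightarrow> sec i z 0 = fst z \<and> sec i z 1 = snd z"
    and U_cover: "(\<Union>i\<le>k. U i) = topspace (prod_topology X X)"
begin

definition pt :: "nat \<Rightarrow> 'p list \<Rightarrow> 'p list \<Rightarrow> (nat \<Rightarrow> real) \<Rightarrow> 'a \<times> 'a" where
  "pt p a b z = (cell p a z, cell p b z)"

lemma pt_continuous:
  "\<lbrakk>word p a; word p b\<rbrakk> \<Longrightarrow> continuous_map (top_of_set (standard_simplex p)) (prod_topology X X) (pt p a b)"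
  unfolding pt_def by (intro continuous_map_pairedI cell_continuous)

definition ray :: "nat \<Rightarrow> 'p list \<Rightarrow> (nat \<Rightarrow> real) \<Rightarrow> real \<Rightarrow> 'a" where
  "ray p a z u = cell p a (line (vtx 0) z u)"

text \<open>\<open>w\<close> is the class of the loop that follows the ray of \<open>a\<close>, then
  the section, then the ray of \<open>b\<close> backwards. The square says this without
  concatenating or reversing paths.\<close>

definition winds :: "nat \<Rightarrow> nat \<Rightarrow> 'p list \<Rightarrow> 'p list \<Rightarrow> (nat \<Rightarrow> real) \<Rightarrow> 'p \<Rightarrow> bool" where
  "winds i p a b z w \<longleftrightarrow> w \<in> carrier P \<and> Sq X (lp w) (sec i (pt p a b z)) (ray p a z) (ray p b z)"

text \<open>\<open>label i p a b\<close> is the locally constant equivariant function on the preimage of \<open>U i\<close> in the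
  universal cover of \<open>X \<times> X\<close>, in the chart given by the simplex \<open>(a, b)\<close>.\<close>

definition label :: "nat \<Rightarrow> nat \<Rightarrow> 'p list \<Rightarrow> 'p list \<Rightarrow> (nat \<Rightarrow> real) \<Rightarrow> 'p" where
  "label i p a b z = a ! 0 \<otimes>\<^bsub>P\<^esub> (SOME w. winds i p a b z w) \<otimes>\<^bsub>P\<^esub> inv\<^bsub>P\<^esub> (b ! 0)"

lemma ray_pathin:
  assumes "word p a" "z \<in> standard_simplex p"
  shows "pathin X (ray p a z)" "ray p a z 0 = x0" "ray p a z 1 = cell p a z"
proof -
  show "pathin X (ray p a z)"
    unfolding pathin_def ray_def
    by (rule continuous_map_via [OF cell_continuous [OF assms(1)], where m = "line (vtx 0) z"])
      (use assms(2) line_simplex in \<open>auto intro!: continuous_on_line continuous_on_const continuous_on_id\<close>)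
qed (simp_all add: ray_def cell_base [OF assms(1)])

lemma sec_pathin:
  assumes "i \<le> k" "x \<in> U i"
  shows "pathin X (sec i x)"
proof -
  have "x \<in> topspace (subtopology (prod_topology X X) (U i))"
    using assms openin_subset [OF U_open [OF assms(1)]] by auto
  then have "sec i x \<in> topspace (path_space X)"
    using continuous_map_image_subset_topspace [OF sec_cont [OF assms(1)]] by blast
  then show ?thesis by (auto simp: path_space_def topology_generated_by_topspace path_set_def)
qed

text \<open>\<open>Sq_open\<close> closes the two rays and the section by some loop, and
  \<open>lp_onto\<close> deforms that loop to a chosen one.\<close>

lemma winds_exists:
  assumes a: "word p a" and b: "word p b" and z: "z \<in> standard_simplex p" and i: "i \<le> k" and zU: "pt p a b z \<in> U i"
  shows "\<exists>w. winds i p a b z w"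
proof -
  have se: "sec i (pt p a b z) 0 = cell p a z" "sec i (pt p a b z) 1 = cell p b z"
    using sec_ends [OF i zU] by (auto simp: pt_def)
  obtain p' where p': "Sq X p' (sec i (pt p a b z)) (ray p a z) (ray p b z)"
    using Sq_open [OF sec_pathin [OF i zU] ray_pathin(1) [OF a z] ray_pathin(1) [OF b z]]
      ray_pathin(3) [OF a z] ray_pathin(3) [OF b z] se by metis
  have "loop X x0 p'"
    using Sq_pathin [OF p'] Sq_corners(1,2) [OF p'] ray_pathin(2) [OF a z] ray_pathin(2) [OF b z]
    by (simp add: loop_def)
  then obtain w where w: "w \<in> carrier P" "Sq X p' (lp w) (\<lambda>_. x0) (\<lambda>_. x0)" using lp_onto by blast
  have r: "Sq X (\<lambda>_. x0) (\<lambda>_. cell p a z) (ray p a z) (ray p a z)"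
    "Sq X (\<lambda>_. x0) (\<lambda>_. cell p b z) (ray p b z) (ray p b z)"
    using Sq_still [OF ray_pathin(1) [OF a z]] Sq_still [OF ray_pathin(1) [OF b z]]
      ray_pathin(2,3) [OF a z] ray_pathin(2,3) [OF b z] by simp_all
  have s: "Sq X (\<lambda>_. cell p a z) (\<lambda>_. cell p b z) (sec i (pt p a b z)) (sec i (pt p a b z))"
    using Sq_still [OF sec_pathin [OF i zU]] se by simp
  have "Sq X (lp w) (sec i (pt p a b z)) (ray p a z) (ray p b z)"
    by (rule Sq_box [OF p' Sq_transpose [OF w(2)] s r])
  then show ?thesis using w(1) unfolding winds_def by blast
qed

text \<open>Two such squares over the same three sides are compared along the constant
  family.\<close>

lemma winds_unique:
  assumes a: "word p a" and b: "word p b" and z: "z \<in> standard_simplex p" and i: "i \<le> k" and zU: "pt p a b z \<in> U i"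
    and w: "winds i p a b z w" and w': "winds i p a b z w'"
  shows "w = w'"
proof (rule lp_unique)
  have se: "sec i (pt p a b z) 0 = cell p a z" "sec i (pt p a b z) 1 = cell p b z"
    using sec_ends [OF i zU] by (auto simp: pt_def)
  have s: "Sq X (sec i (pt p a b z)) (sec i (pt p a b z)) (\<lambda>_. cell p a z) (\<lambda>_. cell p b z)"
    using Sq_const [OF sec_pathin [OF i zU]] se by simp
  have r: "Sq X (\<lambda>_. x0) (\<lambda>_. cell p a z) (ray p a z) (ray p a z)"
    "Sq X (\<lambda>_. x0) (\<lambda>_. cell p b z) (ray p b z) (ray p b z)"
    using Sq_still [OF ray_pathin(1) [OF a z]] Sq_still [OF ray_pathin(1) [OF b z]]
      ray_pathin(2,3) [OF a z] ray_pathin(2,3) [OF b z] by simp_all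
  show "Sq X (lp w) (lp w') (\<lambda>_. x0) (\<lambda>_. x0)"
    using Sq_compare [OF s _ _ r] w w' unfolding winds_def by blast
qed (use w w' in \<open>auto simp: winds_def\<close>)

lemma label_eq:
  assumes "word p a" "word p b" "z \<in> standard_simplex p" "i \<le> k" "pt p a b z \<in> U i" "winds i p a b z w"
  shows "label i p a b z = a ! 0 \<otimes>\<^bsub>P\<^esub> w \<otimes>\<^bsub>P\<^esub> inv\<^bsub>P\<^esub> (b ! 0)"
proof -
  have "winds i p a b z (SOME w. winds i p a b z w)" using assms(6) by (rule someI)
  then have "(SOME w. winds i p a b z w) = w" using winds_unique [OF assms(1-5)] assms(6) by blast
  then show ?thesis by (simp add: label_def)
qed

lemma label_closed:
  assumes "word p a" "word p b" "z \<in> standard_simplex p" "i \<le> k" "pt p a b z \<in> U i"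
  shows "label i p a b z \<in> carrier P"
proof -
  obtain w where w: "winds i p a b z w" using winds_exists [OF assms] by blast
  then show ?thesis
    using label_eq [OF assms w] word_nth [OF assms(1), of 0] word_nth [OF assms(2), of 0]
    by (simp add: winds_def)
qed

lemma translate_ray:
  "\<lbrakk>word p a; g \<in> carrier P\<rbrakk> \<Longrightarrow> ray p (map (\<lambda>x. g \<otimes>\<^bsub>P\<^esub> x) a) z = ray p a z"
  by (simp add: ray_def cell_translate fun_eq_iff)

lemma translate_pt:
  "\<lbrakk>word p a; word p b; g \<in> carrier P; h \<in> carrier P\<rbrakk> \<Longrightarrow>
   pt p (map (\<lambda>x. g \<otimes>\<^bsub>P\<^esub> x) a) (map (\<lambda>x. h \<otimes>\<^bsub>P\<^esub> x) b) = pt p a b"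
  by (simp add: pt_def cell_translate fun_eq_iff)

lemma word_translate: "\<lbrakk>word p a; g \<in> carrier P\<rbrakk> \<Longrightarrow> word p (map (\<lambda>x. g \<otimes>\<^bsub>P\<^esub> x) a)"
  by (auto simp: word_def)

text \<open>Cells are invariant under translation, hence so are the rays, the point and
  \<open>w\<close>; only the outer factors \<open>a ! 0\<close> and \<open>b ! 0\<close>
  change.\<close>

lemma label_translate:
  assumes a: "word p a" and b: "word p b" and z: "z \<in> standard_simplex p" and i: "i \<le> k" and zU: "pt p a b z \<in> U i"
    and g: "g \<in> carrier P" and h: "h \<in> carrier P"
  shows "label i p (map (\<lambda>x. g \<otimes>\<^bsub>P\<^esub> x) a) (map (\<lambda>x. h \<otimes>\<^bsub>P\<^esub> x) b) z
    = g \<otimes>\<^bsub>P\<^esub> label i p a b z \<otimes>\<^bsub>P\<^esub> inv\<^bsub>P\<^esub> h"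
proof -
  obtain w where w: "winds i p a b z w" using winds_exists [OF a b z i zU] by blast
  then have w': "winds i p (map (\<lambda>x. g \<otimes>\<^bsub>P\<^esub> x) a) (map (\<lambda>x. h \<otimes>\<^bsub>P\<^esub> x) b) z w"
    unfolding winds_def translate_ray [OF a g] translate_ray [OF b h] translate_pt [OF a b g h] .
  have len: "0 < length a" "0 < length b" using a b by (auto simp: word_def)
  have mem: "a ! 0 \<in> carrier P" "b ! 0 \<in> carrier P" "w \<in> carrier P"
    using word_nth [OF a, of 0] word_nth [OF b, of 0] w by (auto simp: winds_def)
  have zU': "pt p (map (\<lambda>x. g \<otimes>\<^bsub>P\<^esub> x) a) (map (\<lambda>x. h \<otimes>\<^bsub>P\<^esub> x) b) z \<in> U i"
    using zU by (simp only: translate_pt [OF a b g h])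
  show ?thesis
    unfolding label_eq [OF a b z i zU w]
      label_eq [OF word_translate [OF a g] word_translate [OF b h] z i zU' w']
    using len mem g h by (simp add: P.inv_mult_group P.m_assoc)
qed

text \<open>A face with \<open>j > 0\<close> keeps vertex 0, so its rays are those of the whole
  simplex.\<close>

lemma winds_face_Suc:
  assumes a: "word (Suc p) a" and b: "word (Suc p) b" and z: "z \<in> standard_simplex p"
    and j: "0 < j" "j \<le> Suc p"
  shows "winds i (Suc p) a b (simplical_face j z) w \<longleftrightarrow> winds i p (del j a) (del j b) z w"
proof -
  have v: "vtx 0 = simplical_face j (vtx 0)" using j by (simp add: face_vtx)
  have r: "ray (Suc p) l (simplical_face j z) u = ray p (del j l) z u"
    if "word (Suc p) l" "u \<in> {0..1}" for l u
  proof -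
    have "line (vtx 0) (simplical_face j z) u = simplical_face j (line (vtx 0) z u)"
      unfolding face_line using v by simp
    moreover have "line (vtx 0) z u \<in> standard_simplex p"
      by (rule line_simplex) (use z that in auto)
    ultimately show ?thesis unfolding ray_def using cell_face [OF that(1) j(2)] by simp
  qed
  have "pt (Suc p) a b (simplical_face j z) = pt p (del j a) (del j b) z"
    using cell_face [OF a j(2) z] cell_face [OF b j(2) z] by (simp add: pt_def)
  then show ?thesis
    unfolding winds_def
    using Sq_cong [of X "lp w" _ "ray (Suc p) a (simplical_face j z)" "ray (Suc p) b (simplical_face j z)" "lp w" _
        "ray p (del j a) z" "ray p (del j b) z"]
      Sq_cong [of X "lp w" _ "ray p (del j a) z" "ray p (del j b) z" "lp w" _
        "ray (Suc p) a (simplical_face j z)" "ray (Suc p) b (simplical_face j z)"] r a b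
    by metis
qed

text \<open>The triangle spanned by vertices 0, 1 and the given point of face 0, written as a square
  with constant top. It compares the rays from the old and the new base vertex.\<close>

lemma edge_triangle:
  assumes a: "word (Suc p) a" and z: "z \<in> standard_simplex p"
  shows "Sq X (lp (inv\<^bsub>P\<^esub> (a ! 0) \<otimes>\<^bsub>P\<^esub> a ! 1)) (\<lambda>_. cell p (del 0 a) z)
     (ray (Suc p) a (simplical_face 0 z)) (ray p (del 0 a) z)"
proof -
  let ?Z = "simplical_face 0 z"
  have Z: "?Z \<in> standard_simplex (Suc p)"
    by (rule simplical_face_in_standard_simplex) (use z in auto)
  have "Sq X (\<lambda>u. cell (Suc p) a (line (edge u) ?Z 0)) (\<lambda>u. cell (Suc p) a (line (edge u) ?Z 1))
     (\<lambda>v. cell (Suc p) a (line (edge 0) ?Z v)) (\<lambda>v. cell (Suc p) a (line (edge 1) ?Z v))"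
    using Sq_hom [OF cell_continuous [OF a], of "\<lambda>(u, v). line (edge u) ?Z v"]
      line_simplex [OF edge_simplex Z]
    by (simp add: split_def edge_def continuous_on_line continuous_on_fst continuous_on_snd continuous_on_id
        continuous_on_const)
  then show ?thesis
  proof (rule Sq_cong)
    fix u :: real assume u: "u \<in> {0..1}"
    show "cell (Suc p) a (line (edge u) ?Z 0) = lp (inv\<^bsub>P\<^esub> (a ! 0) \<otimes>\<^bsub>P\<^esub> a ! 1) u"
      using cell_edge [OF a u] by simp
    show "cell (Suc p) a (line (edge u) ?Z 1) = cell p (del 0 a) z"
      using cell_face [OF a, of 0 z] z by simp
    show "cell (Suc p) a (line (edge 0) ?Z u) = ray (Suc p) a ?Z u"
      by (simp add: edge_def ray_def)
    have "line (edge 1) ?Z u = simplical_face 0 (line (vtx 0) z u)"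
      unfolding face_line by (simp add: edge_def face_vtx)
    moreover have "line (vtx 0) z u \<in> standard_simplex p"
      by (rule line_simplex) (use z u in auto)
    ultimately show "cell (Suc p) a (line (edge 1) ?Z u) = ray p (del 0 a) z u"
      unfolding ray_def using cell_face [OF a, of 0] by simp
  qed
qed

lemma pt_face:
  assumes "word (Suc p) a" "word (Suc p) b" "z \<in> standard_simplex p" "j \<le> Suc p"
  shows "pt (Suc p) a b (simplical_face j z) = pt p (del j a) (del j b) z"
  using cell_face [OF assms(1,4,3)] cell_face [OF assms(2,4,3)] by (simp add: pt_def)

text \<open>Only \<open>j = 0\<close> changes the base vertex. By the two edge triangles,
  \<open>w\<close> is then multiplied on both sides by the classes of the edges from 0 to 1, and the
  outer factors in \<open>label\<close> change from \<open>a ! 0\<close>, \<open>b ! 0\<close> to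
  \<open>a ! 1\<close>, \<open>b ! 1\<close> so as to compensate.\<close>

lemma label_face:
  assumes a: "word (Suc p) a" and b: "word (Suc p) b" and z: "z \<in> standard_simplex p"
    and j: "j \<le> Suc p" and i: "i \<le> k" and zU: "pt p (del j a) (del j b) z \<in> U i"
  shows "label i (Suc p) a b (simplical_face j z) = label i p (del j a) (del j b) z"
proof -
  let ?Z = "simplical_face j z"
  have Z: "?Z \<in> standard_simplex (Suc p)"
    by (rule simplical_face_in_standard_simplex) (use z j in auto)
  have ZU: "pt (Suc p) a b ?Z \<in> U i" using zU pt_face [OF a b z j] by simp
  have wa: "word p (del j a)" and wb: "word p (del j b)" using word_del a b j by auto
  obtain w where w: "winds i (Suc p) a b ?Z w" using winds_exists [OF a b Z i ZU] by blast
  obtain w' where w': "winds i p (del j a) (del j b) z w'" using winds_exists [OF wa wb z i zU] by blast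
  have len: "length a = Suc (Suc p)" "length b = Suc (Suc p)" using a b by (auto simp: word_def)
  show ?thesis
  proof (cases "j = 0")
    case False
    then have "winds i p (del j a) (del j b) z w"
      using winds_face_Suc [OF a b z _ j] w by simp
    moreover have "del j a ! 0 = a ! 0" "del j b ! 0 = b ! 0" using False j len by (auto simp: nth_del)
    ultimately show ?thesis
      using label_eq [OF a b Z i ZU w] label_eq [OF wa wb z i zU] by simp
  next
    case True
    have mem: "a ! 0 \<in> carrier P" "a ! 1 \<in> carrier P" "b ! 0 \<in> carrier P" "b ! 1 \<in> carrier P"
      using word_nth [OF a, of 0] word_nth [OF a, of 1] word_nth [OF b, of 0] word_nth [OF b, of 1] by auto
    have wP: "w \<in> carrier P" "w' \<in> carrier P" using w w' by (auto simp: winds_def)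
    have se: "sec i (pt p (del 0 a) (del 0 b) z) 0 = cell p (del 0 a) z"
      "sec i (pt p (del 0 a) (del 0 b) z) 1 = cell p (del 0 b) z"
      using sec_ends [OF i zU] True by (auto simp: pt_def)
    have s: "Sq X (sec i (pt p (del 0 a) (del 0 b) z)) (sec i (pt p (del 0 a) (del 0 b) z))
        (\<lambda>_. cell p (del 0 a) z) (\<lambda>_. cell p (del 0 b) z)"
      using Sq_const [OF sec_pathin [OF i zU]] se True by simp
    have "pt (Suc p) a b (simplical_face 0 z) = pt p (del 0 a) (del 0 b) z"
      using pt_face [OF a b z j] True by simp
    then have w1: "Sq X (lp w) (sec i (pt p (del 0 a) (del 0 b) z)) (ray (Suc p) a (simplical_face 0 z))
        (ray (Suc p) b (simplical_face 0 z))"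
      using w True unfolding winds_def by simp
    have w2: "Sq X (lp w') (sec i (pt p (del 0 a) (del 0 b) z)) (ray p (del 0 a) z) (ray p (del 0 b) z)"
      using w' True unfolding winds_def by simp
    have "Sq X (lp w) (lp w') (lp (inv\<^bsub>P\<^esub> (a ! 0) \<otimes>\<^bsub>P\<^esub> a ! 1)) (lp (inv\<^bsub>P\<^esub> (b ! 0) \<otimes>\<^bsub>P\<^esub> b ! 1))"
      by (rule Sq_compare [OF s w1 w2 edge_triangle [OF a z] edge_triangle [OF b z]])
    then have eq: "inv\<^bsub>P\<^esub> (a ! 0) \<otimes>\<^bsub>P\<^esub> a ! 1 \<otimes>\<^bsub>P\<^esub> w' = w \<otimes>\<^bsub>P\<^esub> (inv\<^bsub>P\<^esub> (b ! 0) \<otimes>\<^bsub>P\<^esub> b ! 1)"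
      using lp_Sq [OF wP] mem by simp
    have "a ! 1 \<otimes>\<^bsub>P\<^esub> w' = a ! 0 \<otimes>\<^bsub>P\<^esub> (inv\<^bsub>P\<^esub> (a ! 0) \<otimes>\<^bsub>P\<^esub> a ! 1 \<otimes>\<^bsub>P\<^esub> w')"
      using mem wP by (simp flip: P.m_assoc)
    also have "\<dots> = a ! 0 \<otimes>\<^bsub>P\<^esub> (w \<otimes>\<^bsub>P\<^esub> (inv\<^bsub>P\<^esub> (b ! 0) \<otimes>\<^bsub>P\<^esub> b ! 1))"
      by (simp only: eq)
    also have "\<dots> = a ! 0 \<otimes>\<^bsub>P\<^esub> w \<otimes>\<^bsub>P\<^esub> inv\<^bsub>P\<^esub> (b ! 0) \<otimes>\<^bsub>P\<^esub> b ! 1"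
      using mem wP by (simp add: P.m_assoc)
    finally have "a ! 1 \<otimes>\<^bsub>P\<^esub> w' \<otimes>\<^bsub>P\<^esub> inv\<^bsub>P\<^esub> (b ! 1) = a ! 0 \<otimes>\<^bsub>P\<^esub> w \<otimes>\<^bsub>P\<^esub> inv\<^bsub>P\<^esub> (b ! 0)"
      using mem wP by (simp add: P.m_assoc)
    moreover have "del j a ! 0 = a ! 1" "del j b ! 0 = b ! 1" using True len by (auto simp: nth_del)
    ultimately show ?thesis
      using label_eq [OF a b Z i ZU w] label_eq [OF wa wb z i zU w'] by simp
  qed
qed

text \<open>Along the segment from \<open>y\<close> to \<open>y'\<close> the section varies
  continuously and sweeps out a square, and the rays sweep out two triangles.
  \<open>Sq_compare\<close> assembles them into a homotopy between the two loops.\<close>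

lemma label_constant:
  assumes a: "word p a" and b: "word p b" and i: "i \<le> k"
    and \<tau>: "continuous_on (standard_simplex q) \<tau>" "\<And>y. y \<in> standard_simplex q \<Longrightarrow> \<tau> y \<in> standard_simplex p"
    and sub: "\<And>y. y \<in> standard_simplex q \<Longrightarrow> pt p a b (\<tau> y) \<in> U i"
    and y: "y \<in> standard_simplex q" "y' \<in> standard_simplex q"
  shows "label i p a b (\<tau> y) = label i p a b (\<tau> y')"
proof -
  let ?I = "{0..1::real}"
  define c where "c = (\<lambda>v. \<tau> (line y y' v))"
  have cs: "c v \<in> standard_simplex p" "pt p a b (c v) \<in> U i" if "v \<in> ?I" for v
    unfolding c_def using line_simplex [OF y that] \<tau>(2) sub by auto
  have cc: "continuous_on ?I c"
    unfolding c_def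
    by (rule continuous_on_compose2 [OF \<tau>(1)])
      (use line_simplex [OF y] in \<open>auto intro!: continuous_on_line continuous_on_const continuous_on_id\<close>)
  obtain w where w: "winds i p a b (c 0) w" using winds_exists [OF a b cs(1) i cs(2)] by force
  have m: "continuous_map (top_of_set ?I) (prod_topology X X) (\<lambda>v. pt p a b (c v))"
    by (rule continuous_map_via [OF pt_continuous [OF a b] cc]) (use cs in auto)
  have "continuous_map (top_of_set (?I \<times> ?I)) X (\<lambda>(v, u). sec i (pt p a b (c v)) u)"
    by (rule path_eval_continuous [OF sec_cont [OF i] m]) (use cs in auto)
  then have "Sq X (\<lambda>v. sec i (pt p a b (c v)) 0) (\<lambda>v. sec i (pt p a b (c v)) 1)
      (sec i (pt p a b (c 0))) (sec i (pt p a b (c 1)))"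
    using Sq_hom [of "?I \<times> ?I" X _ "\<lambda>z. z"] continuous_on_id by fastforce
  then have s: "Sq X (sec i (pt p a b (c 0))) (sec i (pt p a b (c 1))) (\<lambda>v. cell p a (c v)) (\<lambda>v. cell p b (c v))"
  proof (rule Sq_cong [OF Sq_transpose])
    fix v :: real assume "v \<in> ?I"
    then show "sec i (pt p a b (c v)) 0 = cell p a (c v)" "sec i (pt p a b (c v)) 1 = cell p b (c v)"
      using sec_ends [OF i cs(2)] by (auto simp: pt_def)
  qed auto
  have r: "Sq X (\<lambda>_. x0) (\<lambda>v. cell p l (c v)) (ray p l (c 0)) (ray p l (c 1))" if l: "word p l" for l
  proof -
    have "Sq X (\<lambda>v. cell p l (line (vtx 0) (c v) 0)) (\<lambda>v. cell p l (line (vtx 0) (c v) 1))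
      (\<lambda>u. cell p l (line (vtx 0) (c 0) u)) (\<lambda>u. cell p l (line (vtx 0) (c 1) u))"
      using Sq_hom [OF cell_continuous [OF l], of "\<lambda>x. line (vtx 0) (c (fst x)) (snd x)"]
        line_simplex [OF _ cs(1)] continuous_on_line [OF continuous_on_const
          continuous_on_compose2 [OF cc continuous_on_fst [OF continuous_on_id]]
          continuous_on_snd [OF continuous_on_id], of "?I \<times> ?I"]
      by simp
    then show ?thesis by (rule Sq_cong) (simp_all add: ray_def cell_base [OF l])
  qed
  have w1: "w \<in> carrier P" "Sq X (lp w) (sec i (pt p a b (c 0))) (ray p a (c 0)) (ray p b (c 0))"
    using w by (auto simp: winds_def)
  obtain w' where w': "winds i p a b (c 1) w'" using winds_exists [OF a b cs(1) i cs(2)] by force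
  then have w2: "w' \<in> carrier P" "Sq X (lp w') (sec i (pt p a b (c 1))) (ray p a (c 1)) (ray p b (c 1))"
    by (auto simp: winds_def)
  have "Sq X (lp w) (lp w') (\<lambda>_. x0) (\<lambda>_. x0)"
    by (rule Sq_compare [OF s w1(2) w2(2) r [OF a] r [OF b]])
  then have "w = w'" by (rule lp_unique [OF w1(1) w2(1)])
  then show ?thesis
    using label_eq [OF a b cs(1) i cs(2) w] label_eq [OF a b cs(1) i cs(2) w'] by (simp add: c_def)
qed

end

section \<open>Small chains\<close>

text \<open>The cancellation behind the square of a boundary being zero: \<open>(j, i)\<close> with
  \<open>i < j\<close> is paired with \<open>(i, j - 1)\<close>, whose sign is opposite.\<close>

lemma frag_alternating_sum_zero:
  assumes "\<And>i j. \<lbrakk>i < j; j \<le> Suc p\<rbrakk> \<Longrightarrow> c j i = c i (j - 1)"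
  shows "(\<Sum>j\<le>Suc p. \<Sum>i\<le>p. frag_cmul ((-1) ^ (j + i)) (c j i)) = 0"
proof -
  let ?f = "\<lambda>(j, i). frag_cmul ((-1) ^ (j + i)) (c j i)"
  define A where "A = {(j, i). j \<le> Suc p \<and> i \<le> p \<and> i < j}"
  define B where "B = {(j, i). j \<le> Suc p \<and> i \<le> p \<and> j \<le> i}"
  have AB: "{..Suc p} \<times> {..p} = A \<union> B" "A \<inter> B = {}" by (auto simp: A_def B_def)
  have fin: "finite A" "finite B"
    by (rule finite_subset [of _ "{..Suc p} \<times> {..p}"]; force simp: A_def B_def)+
  have "sum ?f A = sum (\<lambda>x. - ?f x) B"
  proof (rule sum.reindex_bij_witness [where i = "\<lambda>(j, i). (Suc i, j)" and j = "\<lambda>(j, i). (i, j - 1)"])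
    fix x assume "x \<in> A"
    then obtain j i where x: "x = (j, i)" "j \<le> Suc p" "i < j" by (auto simp: A_def)
    then obtain m where m: "j = Suc m" by (cases j) auto
    show "- ?f (case x of (j, i) \<Rightarrow> (i, j - 1)) = ?f x"
      using assms [OF x(3,2)] by (simp add: x(1) m add.commute)
  qed (auto simp: A_def B_def)
  moreover have "(\<Sum>j\<le>Suc p. \<Sum>i\<le>p. frag_cmul ((-1) ^ (j + i)) (c j i)) = sum ?f (A \<union> B)"
    unfolding AB(1) [symmetric] by (rule sum.cartesian_product)
  ultimately show ?thesis
    using fin AB(2) by (simp add: sum.union_disjoint sum_negf)
qed

text \<open>The augmentation takes values in multiples of the empty simplex, where \<open>bd\<close>
  also ends, so that both complexes share their lowest term.\<close>

definition aug :: "('c \<Rightarrow>\<^sub>0 int) \<Rightarrow> ('v list \<Rightarrow>\<^sub>0 int)" where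
  "aug = frag_extend (\<lambda>_. frag_of [])"

definition small_chain :: "'c set set \<Rightarrow> nat \<Rightarrow> 'c topology \<Rightarrow> 'c chain \<Rightarrow> bool" where
  "small_chain \<C> q Y c \<longleftrightarrow> singular_chain q Y c \<and>
     (\<forall>f \<in> Poly_Mapping.keys c. \<exists>V\<in>\<C>. f ` standard_simplex q \<subseteq> V)"

lemma small_chain_iff:
  "small_chain \<C> q Y c \<longleftrightarrow>
   Poly_Mapping.keys c \<subseteq> {f. singular_simplex q Y f \<and> (\<exists>V\<in>\<C>. f ` standard_simplex q \<subseteq> V)}"
  by (auto simp: small_chain_def singular_chain_def)

lemma small_chain_diff: "\<lbrakk>small_chain \<C> q Y a; small_chain \<C> q Y b\<rbrakk> \<Longrightarrow> small_chain \<C> q Y (a - b)"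
  unfolding small_chain_iff using keys_diff [of a b] by blast

lemma singular_subdivision_power_chain:
  "singular_chain q Y c \<Longrightarrow> singular_chain q Y ((singular_subdivision q ^^ m) c)"
  by (induction m) (auto intro: singular_chain_singular_subdivision)

lemma boundary_subdivision_power:
  "singular_chain (Suc q) Y c \<Longrightarrow>
   chain_boundary (Suc q) ((singular_subdivision (Suc q) ^^ m) c)
     = (singular_subdivision q ^^ m) (chain_boundary (Suc q) c)"
proof (induction m)
  case (Suc m)
  have "chain_boundary (Suc q) (singular_subdivision (Suc q) ((singular_subdivision (Suc q) ^^ m) c))
     = singular_subdivision (Suc q - Suc 0) (chain_boundary (Suc q) ((singular_subdivision (Suc q) ^^ m) c))"
    by (rule chain_boundary_singular_subdivision [OF singular_subdivision_power_chain [OF Suc.prems]])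
  then show ?case using Suc by simp
qed simp

text \<open>The contraction makes the cycle homologous to its image under a constant map. For
  \<open>q > 0\<close> that image is a cycle in a point and bounds; for \<open>q = 0\<close> it is
  determined by the augmentation and vanishes.\<close>

lemma contractible_cycle_boundary:
  assumes Y: "contractible_space Y" and c: "singular_chain q Y c" "chain_boundary q c = 0"
    and aug: "q = 0 \<Longrightarrow> aug c = (0 :: 'v list \<Rightarrow>\<^sub>0 int)"
  obtains b where "singular_chain (Suc q) Y b" "chain_boundary (Suc q) b = c"
proof -
  obtain a where a: "homotopic_with (\<lambda>_. True) Y Y id (\<lambda>_. a)"
    using Y by (auto simp: contractible_space_def)
  have cyc: "singular_relcycle q Y {} c" using c by (simp add: singular_cycle)
  have "homologous_rel q Y {} (chain_map q id c) (chain_map q (\<lambda>_. a) c)"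
    by (rule homotopic_imp_homologous_rel_chain_maps [where T = "{}" and V = "{}" and S = Y])
      (use a cyc in simp_all)
  then have hom: "homologous_rel q Y {} c (chain_map q (\<lambda>_. a) c)"
    using chain_map_ident [OF c(1)] by simp
  have "singular_relboundary q Y {} (chain_map q (\<lambda>_. a) c)"
  proof (cases "c = 0")
    case False
    then obtain f where "f \<in> Poly_Mapping.keys c" by fastforce
    then have "topspace Y \<noteq> {}"
      using c(1) singular_simplex_empty [of Y q f] by (auto simp: singular_chain_def)
    moreover have am: "continuous_map Y Y (\<lambda>_. a)" using homotopic_with_imp_continuous_maps [OF a] by blast
    ultimately have aY: "a \<in> topspace Y" by (auto simp: continuous_map_def)
    let ?S = "subtopology Y {a}"
    have tS: "topspace ?S = {a}" using aY by auto
    have cm: "continuous_map Y ?S (\<lambda>_. a)" using am by (simp add: continuous_map_in_subtopology)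
    show ?thesis
    proof (cases "q = 0")
      case True
      \<comment> \<open>Under a constant map all simplices of a chain become the same one, so only
        the sum of the coefficients, that is \<open>aug c\<close>, is left.\<close>
      have "chain_map q (\<lambda>_. a) c = frag_extend (\<lambda>_. frag_of (\<lambda>_ \<in> standard_simplex q. a)) c"
        by (simp add: chain_map_def simplex_map_def comp_def)
      also have "\<dots> = frag_extend (\<lambda>_ :: 'v list. frag_of (\<lambda>_ \<in> standard_simplex q. a)) (aug c)"
        unfolding aug_def by (induction c rule: frag_induct_all) (auto simp: frag_extend_diff)
      finally show ?thesis using aug [OF True] by simp
    next
      case False
      have "singular_relcycle q ?S {} (chain_map q (\<lambda>_. a) c)"
        by (rule singular_relcycle_chain_map [OF cyc cm]) simp
      then have "singular_relboundary q ?S {} (chain_map q (\<lambda>_. a) c)"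
        using singular_boundary_eq_cycle_singleton [OF tS] False by simp
      then show ?thesis
        using singular_boundary_mono [of "{a}" UNIV q Y] by simp
    qed
  qed simp
  then have "singular_relboundary q Y {} (c - chain_map q (\<lambda>_. a) c + chain_map q (\<lambda>_. a) c)"
    using hom unfolding homologous_rel_def by (rule singular_relboundary_add [rotated])
  then have "singular_relboundary q Y {} c" by simp
  then show ?thesis using that by (auto simp: singular_boundary)
qed

text \<open>A bounding chain becomes small after \<open>m\<close> subdivisions, but then bounds the
  subdivided cycle. Subtracting \<open>h q c\<close>, where \<open>h\<close> is the chain homotopy
  between subdivision and identity, restores the boundary \<open>c\<close>.\<close>

lemma small_cycle_boundary:
  fixes Y :: "'c topology"
  assumes Y: "contractible_space Y" and \<C>: "\<And>V. V \<in> \<C> \<Longrightarrow> openin Y V" "topspace Y \<subseteq> \<Union>\<C>"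
    and c: "small_chain \<C> q Y c" "chain_boundary q c = 0"
    and aug: "q = 0 \<Longrightarrow> aug c = (0 :: 'v list \<Rightarrow>\<^sub>0 int)"
  shows "\<exists>b. small_chain \<C> (Suc q) Y b \<and> chain_boundary (Suc q) b = c"
proof -
  have sc: "singular_chain q Y c" using c(1) by (simp add: small_chain_def)
  obtain b where b: "singular_chain (Suc q) Y b" "chain_boundary (Suc q) b = c"
    using contractible_cycle_boundary [OF Y sc c(2) aug] by blast
  obtain m where m: "\<And>f. f \<in> Poly_Mapping.keys ((singular_subdivision (Suc q) ^^ m) b) \<Longrightarrow>
      \<exists>V\<in>\<C>. f ` standard_simplex (Suc q) \<subseteq> V"
  proof -
    obtain n where n: "\<And>m f. \<lbrakk>n \<le> m; f \<in> Poly_Mapping.keys ((singular_subdivision (Suc q) ^^ m) b)\<rbrakk>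
        \<Longrightarrow> \<exists>V \<in> \<C>. f \<in> standard_simplex (Suc q) \<rightarrow> V"
      using sufficient_iterated_singular_subdivision_exists [OF \<C> b(1)] by auto
    show thesis
      by (rule that [of n]) (use n [OF order_refl] in \<open>auto simp: image_subset_iff_funcset\<close>)
  qed
  have "\<exists>h. (\<forall>p. h p 0 = (0 :: 'c chain)) \<and> (\<forall>p c1 c2. h p (c1 - c2) = h p c1 - h p c2) \<and>
     (\<forall>p X c. singular_chain p X c \<longrightarrow> singular_chain (Suc p) X (h p c)) \<and>
     (\<forall>p X c. singular_chain p X c \<longrightarrow>
       chain_boundary (Suc p) (h p c) + h (p - Suc 0) (chain_boundary p c) = (singular_subdivision p ^^ m) c - c)"
  proof (rule chain_homotopic_iterated_singular_subdivision [where n = m])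
    fix h
    assume "\<And>p. h p 0 = (0 :: 'c chain)" "\<And>p c1 c2. h p (c1 - c2) = h p c1 - h p c2"
      "\<And>p X c. singular_chain p X c \<Longrightarrow> singular_chain (Suc p) X (h p c)"
      "\<And>p X c. singular_chain p X c \<Longrightarrow>
       chain_boundary (Suc p) (h p c) + h (p - Suc 0) (chain_boundary p c) = (singular_subdivision p ^^ m) c - c"
    then show ?thesis by (intro exI [of _ h] conjI allI impI)
  qed
  then obtain h where h0: "\<forall>p. h p 0 = (0 :: 'c chain)"
    and hd: "\<forall>p c1 c2. h p (c1 - c2) = h p c1 - h p c2"
    and hs: "\<forall>p X c. singular_chain p X c \<longrightarrow> singular_chain (Suc p) X (h p c)"
    and hb: "\<forall>p X c. singular_chain p X c \<longrightarrow>
       chain_boundary (Suc p) (h p c) + h (p - Suc 0) (chain_boundary p c) = (singular_subdivision p ^^ m) c - c"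
    by (elim exE conjE)
  have "small_chain \<C> (Suc q) Y (h q c)"
    using c(1) unfolding small_chain_iff [of \<C> q]
  proof (induction rule: frag_induction)
    case zero
    then show ?case by (simp add: h0 small_chain_def)
  next
    case (one f)
    then obtain V where V: "singular_simplex q Y f" "V \<in> \<C>" "f ` standard_simplex q \<subseteq> V" by blast
    \<comment> \<open>The homotopy preserves chains of every space, in particular of the subspace
      \<open>V\<close>; this is why \<open>h\<close> keeps small simplices inside the same member of
      the cover.\<close>
    then have "singular_chain q (subtopology Y V) (frag_of f)"
      by (simp add: singular_chain_of singular_simplex_subtopology)
    then have "singular_chain (Suc q) (subtopology Y V) (h q (frag_of f))" using hs by blast
    then show ?case using V(2) by (auto simp: singular_chain_subtopology small_chain_def)
  next
    case (diff a b)
    then show ?case by (simp add: hd small_chain_diff)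
  qed
  moreover have "small_chain \<C> (Suc q) Y ((singular_subdivision (Suc q) ^^ m) b)"
    using m singular_subdivision_power_chain [OF b(1)] by (simp add: small_chain_def)
  ultimately have "small_chain \<C> (Suc q) Y ((singular_subdivision (Suc q) ^^ m) b - h q c)"
    by (intro small_chain_diff)
  moreover have "chain_boundary (Suc q) ((singular_subdivision (Suc q) ^^ m) b - h q c) = c"
    using hb [rule_format, OF sc] by (simp add: chain_boundary_diff boundary_subdivision_power [OF b(1)] b(2) c(2) h0)
  ultimately show ?thesis by blast
qed

lemma contractible_simplex: "contractible_space (top_of_set (standard_simplex p))"
proof -
  have "continuous_map (top_of_set ({0..1} \<times> standard_simplex p)) (top_of_set (standard_simplex p))
     (\<lambda>x. line (snd x) (vtx 0) (fst x))"
  proof -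
    have "continuous_on ({0..1} \<times> standard_simplex p) (\<lambda>x. line (snd x) (vtx 0) (fst x))"
      by (intro continuous_on_line continuous_on_snd continuous_on_fst continuous_on_id continuous_on_const)
    moreover have "line (snd x) (vtx 0) (fst x) \<in> standard_simplex p" if "x \<in> {0..1} \<times> standard_simplex p" for x
      by (rule line_simplex) (use that in auto)
    ultimately show ?thesis by (auto simp: continuous_map_in_subtopology)
  qed
  then have "homotopic_with (\<lambda>_. True) (top_of_set (standard_simplex p)) (top_of_set (standard_simplex p)) id (\<lambda>_. vtx 0)"
    unfolding homotopic_with_def
    by (intro exI [of _ "\<lambda>x. line (snd x) (vtx 0) (fst x)"]) simp
  then show ?thesis unfolding contractible_space_def by blast
qed

section \<open>Flags of small simplices\<close>

text \<open>If every simplex carries a vertex \<open>v\<close>, increasing along inclusions of faces, then the flags of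
  faces of a simplex span a chain; \<open>ev\<close> sums them up recursively, appending the vertex of the whole simplex.\<close>

primrec ev :: "(nat \<Rightarrow> ((nat \<Rightarrow> real) \<Rightarrow> 'c) \<Rightarrow> nat \<times> 's) \<Rightarrow> nat \<Rightarrow> 'c chain \<Rightarrow> ((nat \<times> 's) list \<Rightarrow>\<^sub>0 int)" where
  "ev v 0 = frag_extend (\<lambda>\<tau>. frag_of [v 0 \<tau>])"
| "ev v (Suc q) = frag_extend (\<lambda>\<tau>. frag_cmul ((-1) ^ Suc q)
     (snoc (v (Suc q) \<tau>) (ev v q (chain_boundary (Suc q) (frag_of \<tau>)))))"

lemma ev_0 [simp]: "ev v q 0 = 0" by (cases q) auto
lemma ev_diff: "ev v q (a - b) = ev v q a - ev v q b" by (cases q) (auto simp: frag_extend_diff)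
lemma ev_cmul: "ev v q (frag_cmul m a) = frag_cmul m (ev v q a)" by (cases q) (auto simp: frag_extend_cmul)
lemma ev_sum: "finite I \<Longrightarrow> ev v q (sum f I) = (\<Sum>i\<in>I. ev v q (f i))"
  by (cases q) (simp_all add: frag_extend_sum comp_def)

lemma keys_frag_extend_of:
  "Poly_Mapping.keys (frag_extend g c) \<subseteq> (\<Union>x\<in>Poly_Mapping.keys c. Poly_Mapping.keys (frag_extend g (frag_of x)))"
  by (simp add: keys_frag_extend)

lemma keys_ev: "Poly_Mapping.keys (ev v q c) \<subseteq> (\<Union>\<tau>\<in>Poly_Mapping.keys c. Poly_Mapping.keys (ev v q (frag_of \<tau>)))"
  by (cases q) (simp_all only: ev.simps keys_frag_extend_of)

lemma chain_boundary_Suc: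
  "chain_boundary (Suc q) (frag_of \<tau>) = (\<Sum>k\<le>Suc q. frag_cmul ((-1) ^ k) (frag_of (singular_face (Suc q) k \<tau>)))"
  unfolding chain_boundary_of by (rule if_not_P) simp

lemma keys_chain_boundary_of:
  assumes "\<sigma> \<in> Poly_Mapping.keys (chain_boundary (Suc q) (frag_of \<tau>))"
  obtains j where "j \<le> Suc q" "\<sigma> = singular_face (Suc q) j \<tau>"
proof -
  have "Poly_Mapping.keys (chain_boundary (Suc q) (frag_of \<tau>))
      \<subseteq> (\<Union>k\<in>{..Suc q}. Poly_Mapping.keys (frag_cmul ((-1) ^ k) (frag_of (singular_face (Suc q) k \<tau>))))"
    unfolding chain_boundary_Suc by (rule keys_sum)
  then obtain j where j: "j \<in> {..Suc q}" "\<sigma> \<in> Poly_Mapping.keys (frag_cmul ((-1) ^ j) (frag_of (singular_face (Suc q) j \<tau>)))"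
    using assms by blast
  then have "\<sigma> \<in> Poly_Mapping.keys (frag_of (singular_face (Suc q) j \<tau>))" using keys_cmul by blast
  then show ?thesis using that [of j] j(1) by simp
qed

text \<open>The alternative in \<open>v_face\<close>, strictly smaller copy or the very same vertex,
  is what makes the flags of the faces \<open>appendable\<close> to the vertex of the
  simplex.\<close>

locale flag_vertices =
  fixes Y :: "'c topology" and \<S> :: "nat \<Rightarrow> ((nat \<Rightarrow> real) \<Rightarrow> 'c) set"
    and v :: "nat \<Rightarrow> ((nat \<Rightarrow> real) \<Rightarrow> 'c) \<Rightarrow> nat \<times> 's" and S :: "'s set"
  assumes sing: "\<tau> \<in> \<S> q \<Longrightarrow> singular_simplex q Y \<tau>"
    and face: "\<lbrakk>\<tau> \<in> \<S> (Suc q); j \<le> Suc q\<rbrakk> \<Longrightarrow> singular_face (Suc q) j \<tau> \<in> \<S> q"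
    and v_S: "\<tau> \<in> \<S> q \<Longrightarrow> snd (v q \<tau>) \<in> S"
    and v_face: "\<lbrakk>\<tau> \<in> \<S> (Suc q); j \<le> Suc q\<rbrakk> \<Longrightarrow> fst (v q (singular_face (Suc q) j \<tau>)) < fst (v (Suc q) \<tau>) \<or>
       v q (singular_face (Suc q) j \<tau>) = v (Suc q) \<tau>"
begin

lemma boundary_keys: "\<tau> \<in> \<S> (Suc q) \<Longrightarrow> Poly_Mapping.keys (chain_boundary (Suc q) (frag_of \<tau>)) \<subseteq> \<S> q"
proof
  fix \<sigma> assume "\<tau> \<in> \<S> (Suc q)" "\<sigma> \<in> Poly_Mapping.keys (chain_boundary (Suc q) (frag_of \<tau>))"
  then show "\<sigma> \<in> \<S> q" using face keys_chain_boundary_of by metis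
qed

text \<open>The last vertex of a flag belongs to the face itself, and earlier ones lie in smaller
  copies, so \<open>v_face\<close> controls the whole flag. The premise \<open>keys\<close> is the
  induction hypothesis of \<open>ev_keys_of\<close>, which lets the lemma serve inside that
  induction.\<close>

lemma ev_keys_appendable:
  assumes keys: "\<And>\<sigma>. \<sigma> \<in> \<S> q \<Longrightarrow> Poly_Mapping.keys (ev v q (frag_of \<sigma>)) \<subseteq> {l \<in> ordered_simplices S (Suc q). last l = v q \<sigma>}"
    and \<tau>: "\<tau> \<in> \<S> (Suc q)"
  shows "Poly_Mapping.keys (ev v q (chain_boundary (Suc q) (frag_of \<tau>)))
    \<subseteq> {l \<in> appendable (v (Suc q) \<tau>). length l = Suc q \<and> snd ` set l \<subseteq> S}"
proof
  fix l assume "l \<in> Poly_Mapping.keys (ev v q (chain_boundary (Suc q) (frag_of \<tau>)))"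
  then obtain \<sigma> where \<sigma>: "\<sigma> \<in> Poly_Mapping.keys (chain_boundary (Suc q) (frag_of \<tau>))"
    "l \<in> Poly_Mapping.keys (ev v q (frag_of \<sigma>))"
    using keys_ev by blast
  then obtain j where j: "j \<le> Suc q" "\<sigma> = singular_face (Suc q) j \<tau>" using keys_chain_boundary_of by metis
  then have l: "l \<in> ordered_simplices S (Suc q)" "last l = v q \<sigma>"
    using keys [of \<sigma>] face [OF \<tau>] \<sigma>(2) by auto
  then obtain l' w where lw: "l = l' @ [w]" by (cases l rule: rev_cases) (auto simp: ordered_simplices_def)
  then have w: "fst w < fst (v (Suc q) \<tau>) \<or> w = v (Suc q) \<tau>"
    using v_face [OF \<tau> j(1)] l(2) j(2) by simp
  have "fst x < fst w" if "x \<in> set l'" for x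
    using l(1) that by (auto simp: lw ordered_simplices_def sorted_wrt_append)
  then have "\<forall>x\<in>set l. fst x < fst (v (Suc q) \<tau>) \<or> x = v (Suc q) \<tau>"
    using w lw by force
  then show "l \<in> {l \<in> appendable (v (Suc q) \<tau>). length l = Suc q \<and> snd ` set l \<subseteq> S}"
    using l(1) by (auto simp: appendable_def ordered_simplices_def)
qed

lemma ev_keys_of:
  "\<tau> \<in> \<S> q \<Longrightarrow> Poly_Mapping.keys (ev v q (frag_of \<tau>)) \<subseteq> {l \<in> ordered_simplices S (Suc q). last l = v q \<tau>}"
proof (induction q arbitrary: \<tau>)
  case 0
  then show ?case using v_S by (simp add: ordered_simplices_def)
next
  case (Suc q)
  let ?c = "ev v q (chain_boundary (Suc q) (frag_of \<tau>))"
  have c: "Poly_Mapping.keys ?c \<subseteq> {l \<in> appendable (v (Suc q) \<tau>). length l = Suc q \<and> snd ` set l \<subseteq> S}"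
    by (rule ev_keys_appendable [OF Suc.IH Suc.prems])
  show ?case
  proof
    fix l assume "l \<in> Poly_Mapping.keys (ev v (Suc q) (frag_of \<tau>))"
    then have "l \<in> Poly_Mapping.keys (snoc (v (Suc q) \<tau>) ?c)" by simp
    then obtain l' where l': "l = l' @ [v (Suc q) \<tau>]" "l' \<in> Poly_Mapping.keys ?c"
      "l' \<noteq> [] \<longrightarrow> fst (last l') \<noteq> fst (v (Suc q) \<tau>)"
      using keys_snoc by blast
    then have ap: "l' \<in> appendable (v (Suc q) \<tau>)" "length l' = Suc q" "snd ` set l' \<subseteq> S" using c by auto
    then obtain l'' w where lw: "l' = l'' @ [w]" by (cases l' rule: rev_cases) auto
    have "fst x < fst (v (Suc q) \<tau>)" if "x \<in> set l'" for x
    proof -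
      have "fst w < fst (v (Suc q) \<tau>)" using ap(1) l'(3) by (auto simp: lw appendable_def)
      moreover have "fst x \<le> fst w"
        using ap(1) that by (auto simp: lw appendable_def sorted_wrt_append less_imp_le)
      ultimately show ?thesis by simp
    qed
    then show "l \<in> {l \<in> ordered_simplices S (Suc (Suc q)). last l = v (Suc q) \<tau>}"
      using ap v_S [OF Suc.prems] by (auto simp: l'(1) ordered_simplices_def appendable_def sorted_wrt_append)
  qed
qed

lemma bd_ev_0: "bd (ev v 0 c) = aug c"
  unfolding aug_def
  by (induction c rule: frag_induct_all) (auto simp: frag_extend_diff bd_diff, simp add: bd_of)

lemma aug_boundary: "aug (chain_boundary (Suc 0) (frag_of \<tau>)) = 0"
  by (simp add: aug_def chain_boundary_of frag_extend_diff)

text \<open>The chain being coned is a cycle: by induction in higher degrees, and in degree 0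
  because the two ends of an edge have the same augmentation. The cone formula then gives it back as
  the boundary.\<close>

lemma bd_ev_of: "\<tau> \<in> \<S> (Suc q) \<Longrightarrow> bd (ev v (Suc q) (frag_of \<tau>)) = ev v q (chain_boundary (Suc q) (frag_of \<tau>))"
proof (induction q arbitrary: \<tau>)
  case (0 \<tau>)
  let ?c = "ev v 0 (chain_boundary (Suc 0) (frag_of \<tau>))"
  have "bd ?c = 0" using aug_boundary by (simp only: bd_ev_0)
  moreover have "Poly_Mapping.keys ?c \<subseteq> {l \<in> appendable (v (Suc 0) \<tau>). length l = Suc 0}"
    using ev_keys_appendable [OF ev_keys_of 0] by blast
  then have "bd (snoc (v (Suc 0) \<tau>) ?c) = snoc (v (Suc 0) \<tau>) (bd ?c) + frag_cmul ((-1) ^ Suc 0) ?c"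
    by (rule bd_snoc)
  moreover have "ev v (Suc 0) (frag_of \<tau>) = frag_cmul ((-1) ^ Suc 0) (snoc (v (Suc 0) \<tau>) ?c)"
    by (simp only: ev.simps frag_extend_of)
  ultimately show ?case by (simp add: bd_minus del: ev.simps)
next
  case (Suc q \<tau>)
  let ?c = "ev v (Suc q) (chain_boundary (Suc (Suc q)) (frag_of \<tau>))"
  have lin: "bd (ev v (Suc q) c) = ev v q (chain_boundary (Suc q) c)" if "Poly_Mapping.keys c \<subseteq> \<S> (Suc q)" for c
    using that
  proof (induction rule: frag_induction)
    case (diff a b)
    then show ?case by (simp only: ev_diff bd_diff chain_boundary_diff)
  qed (simp_all add: Suc.IH del: ev.simps)
  have "chain_boundary (Suc q) (chain_boundary (Suc (Suc q)) (frag_of \<tau>)) = 0"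
    by (rule chain_boundary_boundary_alt [of "Suc q" Y]) (use sing [OF Suc.prems] in \<open>simp add: singular_chain_of\<close>)
  then have b0: "bd ?c = 0" using lin [OF boundary_keys [OF Suc.prems]] by simp
  have "Poly_Mapping.keys ?c \<subseteq> {l \<in> appendable (v (Suc (Suc q)) \<tau>). length l = Suc (Suc q)}"
    using ev_keys_appendable [OF ev_keys_of Suc.prems] by blast
  then have "bd (snoc (v (Suc (Suc q)) \<tau>) ?c) = snoc (v (Suc (Suc q)) \<tau>) (bd ?c) + frag_cmul ((-1) ^ Suc (Suc q)) ?c"
    by (rule bd_snoc)
  moreover have "ev v (Suc (Suc q)) (frag_of \<tau>) = frag_cmul ((-1) ^ Suc (Suc q)) (snoc (v (Suc (Suc q)) \<tau>) ?c)"
    by (simp only: ev.simps frag_extend_of)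
  ultimately show ?case
    by (simp add: b0 bd_cmul flip: power_mult_distrib del: ev.simps)
qed

lemma bd_ev:
  assumes "Poly_Mapping.keys c \<subseteq> \<S> (Suc q)"
  shows "bd (ev v (Suc q) c) = ev v q (chain_boundary (Suc q) c)"
  using assms
proof (induction rule: frag_induction)
  case (diff a b)
  then show ?case by (simp only: ev_diff bd_diff chain_boundary_diff)
qed (simp_all add: bd_ev_of del: ev.simps)

lemma ev_keys:
  assumes "Poly_Mapping.keys c \<subseteq> \<S> q" "\<And>\<tau>. \<tau> \<in> \<S> q \<Longrightarrow> fst (v q \<tau>) \<le> k"
  shows "Poly_Mapping.keys (ev v q c) \<subseteq> {l \<in> ordered_simplices S (Suc q). \<forall>x\<in>set l. fst x \<le> k}"
proof
  fix l assume "l \<in> Poly_Mapping.keys (ev v q c)"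
  then obtain \<tau> where \<tau>: "\<tau> \<in> Poly_Mapping.keys c" "l \<in> Poly_Mapping.keys (ev v q (frag_of \<tau>))"
    using keys_ev by blast
  then have l: "l \<in> ordered_simplices S (Suc q)" "last l = v q \<tau>" using ev_keys_of assms(1) by blast+
  then obtain l' w where lw: "l = l' @ [w]" by (cases l rule: rev_cases) (auto simp: ordered_simplices_def)
  have "fst w \<le> k" using assms l(2) \<tau>(1) lw by auto
  moreover have "fst x < fst w" if "x \<in> set l'" for x
    using l(1) that by (auto simp: lw ordered_simplices_def sorted_wrt_append)
  ultimately show "l \<in> {l \<in> ordered_simplices S (Suc q). \<forall>x\<in>set l. fst x \<le> k}"
    using l(1) lw by force
qed

text \<open>\<open>ev\<close> sees a simplex only through the vertices of its iterated faces, so it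
  is natural. It is applied to face inclusions with the identity on vertices, and to the identity on
  simplices with a translation on vertices.\<close>

lemma ev_chain_map:
  assumes "Poly_Mapping.keys c \<subseteq> \<S> q"
    and w: "\<And>q \<tau>. \<tau> \<in> \<S> q \<Longrightarrow> w q (simplex_map q g \<tau>) = map_prod id u (v q \<tau>)"
  shows "ev w q (chain_map q g c) = join_map u (ev v q c)"
  using assms(1)
proof (induction q arbitrary: c)
  case 0
  then show ?case
  proof (induction rule: frag_induction)
    case (one \<tau>)
    then show ?case using w [of \<tau> 0] by simp
  qed (simp_all add: chain_map_diff ev_diff join_map_diff del: ev.simps)
next
  case (Suc q)
  have of_case: "ev w (Suc q) (frag_of (simplex_map (Suc q) g \<tau>)) = join_map u (ev v (Suc q) (frag_of \<tau>))"
    if \<tau>: "\<tau> \<in> \<S> (Suc q)" for \<tau>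
  proof -
    have "chain_boundary (Suc q) (frag_of (simplex_map (Suc q) g \<tau>)) = chain_map q g (chain_boundary (Suc q) (frag_of \<tau>))"
      using chain_boundary_chain_map [of "Suc q" Y "frag_of \<tau>" g] sing [OF \<tau>] by (simp add: singular_chain_of)
    then show ?thesis
      using Suc.IH [OF boundary_keys [OF \<tau>]] w [OF \<tau>]
      by (simp only: ev.simps frag_extend_of snoc_join_map join_map_cmul)
  qed
  from Suc.prems show ?case
  proof (induction rule: frag_induction)
    case (one \<tau>)
    then show ?case using of_case by (simp del: ev.simps)
  qed (simp_all add: chain_map_diff ev_diff join_map_diff del: ev.simps)
qed

end

section \<open>The chain map into the finite join\<close>

lemma continuous_map_face:
  assumes "j \<le> Suc p"
  shows "continuous_map (top_of_set (standard_simplex p)) (top_of_set (standard_simplex (Suc p))) (simplical_face j)"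
proof -
  have "continuous_on (standard_simplex p) (simplical_face j :: (nat \<Rightarrow> real) \<Rightarrow> nat \<Rightarrow> real)"
  proof (rule continuous_on_coordinatewise_then_product)
    fix i
    consider "i < j" | "i = j" | "j < i" by linarith
    then show "continuous_on (standard_simplex p) (\<lambda>x. simplical_face j x i :: real)"
      by cases (simp_all add: simplical_face_def continuous_on_coord continuous_on_const)
  qed
  moreover have "simplical_face j x \<in> standard_simplex (Suc p)" if "x \<in> standard_simplex p" for x
    by (rule simplical_face_in_standard_simplex) (use assms that in auto)
  ultimately show ?thesis by (auto simp: continuous_map_in_subtopology)
qed

lemma face_face:
  assumes "i < j"
  shows "simplical_face j \<circ> simplical_face i = simplical_face i \<circ> (simplical_face (j - 1) :: (nat \<Rightarrow> real) \<Rightarrow> _)"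
proof (intro ext)
  fix x :: "nat \<Rightarrow> real" and m
  obtain j' where j: "j = Suc j'" using assms by (cases j) auto
  consider "m < i" | "m = i" | "i < m" "m < j" | "m = j" | "j < m" using assms by linarith
  then show "(simplical_face j \<circ> simplical_face i) x m = (simplical_face i \<circ> simplical_face (j - 1)) x m"
    using assms j by cases (auto simp: simplical_face_def)
qed

section \<open>Small pieces, their vertices and the fundamental chains\<close>

context motion_planner
begin

abbreviation "\<Delta> p \<equiv> top_of_set (standard_simplex p)"

definition cover :: "nat \<Rightarrow> 'p list \<Rightarrow> 'p list \<Rightarrow> (nat \<Rightarrow> real) set set" where
  "cover p a b = (\<lambda>i. {z \<in> standard_simplex p. pt p a b z \<in> U i}) ` {..k}"

definition sm :: "nat \<Rightarrow> 'p list \<Rightarrow> 'p list \<Rightarrow> nat \<Rightarrow> ((nat \<Rightarrow> real) \<Rightarrow> nat \<Rightarrow> real) set" where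
  "sm p a b q = {\<tau>. singular_simplex q (\<Delta> p) \<tau> \<and> (\<exists>V\<in>cover p a b. \<tau> ` standard_simplex q \<subseteq> V)}"

definition idx :: "nat \<Rightarrow> 'p list \<Rightarrow> 'p list \<Rightarrow> nat \<Rightarrow> ((nat \<Rightarrow> real) \<Rightarrow> nat \<Rightarrow> real) \<Rightarrow> nat" where
  "idx p a b q \<tau> = (LEAST i. i \<le> k \<and> (\<forall>y\<in>standard_simplex q. pt p a b (\<tau> y) \<in> U i))"

text \<open>Any point of the piece would give the same label, by \<open>label_constant\<close>;
  vertex 0 is a definite choice.\<close>

definition vv :: "nat \<Rightarrow> 'p list \<Rightarrow> 'p list \<Rightarrow> nat \<Rightarrow> ((nat \<Rightarrow> real) \<Rightarrow> nat \<Rightarrow> real) \<Rightarrow> nat \<times> 'p" where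
  "vv p a b q \<tau> = (idx p a b q \<tau>, label (idx p a b q \<tau>) p a b (\<tau> (vtx 0)))"

text \<open>A compatible and translation invariant choice of fundamental chains of the simplices, made up of small
  singular simplices.\<close>

primrec theta :: "nat \<Rightarrow> 'p list \<Rightarrow> 'p list \<Rightarrow> (nat \<Rightarrow> real) chain" where
  "theta 0 a b = frag_of (restrict id (standard_simplex 0))"
| "theta (Suc p) a b = (SOME c. small_chain (cover (Suc p) a b) (Suc p) (\<Delta> (Suc p)) c \<and>
     chain_boundary (Suc p) c
       = (\<Sum>j\<le>Suc p. frag_cmul ((-1) ^ j) (chain_map p (simplical_face j) (theta p (del j a) (del j b)))))"

lemma small_chain_sm: "small_chain (cover p a b) q (\<Delta> p) c \<longleftrightarrow> Poly_Mapping.keys c \<subseteq> sm p a b q"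
  by (simp add: small_chain_iff sm_def)

lemma sm_iff:
  "\<tau> \<in> sm p a b q \<longleftrightarrow> continuous_on (standard_simplex q) \<tau> \<and> (\<forall>y\<in>standard_simplex q. \<tau> y \<in> standard_simplex p)
     \<and> \<tau> \<in> extensional (standard_simplex q) \<and> (\<exists>i\<le>k. \<forall>y\<in>standard_simplex q. pt p a b (\<tau> y) \<in> U i)"
proof -
  have "(\<exists>V\<in>cover p a b. \<tau> ` standard_simplex q \<subseteq> V) \<longleftrightarrow>
     (\<exists>i\<le>k. \<forall>y\<in>standard_simplex q. \<tau> y \<in> standard_simplex p \<and> pt p a b (\<tau> y) \<in> U i)"
    unfolding cover_def by blast
  moreover have "singular_simplex q (\<Delta> p) \<tau> \<longleftrightarrow> continuous_on (standard_simplex q) \<tau> \<and>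
      (\<forall>y\<in>standard_simplex q. \<tau> y \<in> standard_simplex p) \<and> \<tau> \<in> extensional (standard_simplex q)"
    by (auto simp: singular_simplex_iff continuous_map_in_subtopology)
  ultimately show ?thesis unfolding sm_def mem_Collect_eq by blast
qed

lemma idx_props:
  assumes "\<tau> \<in> sm p a b q"
  shows "idx p a b q \<tau> \<le> k" "\<And>y. y \<in> standard_simplex q \<Longrightarrow> pt p a b (\<tau> y) \<in> U (idx p a b q \<tau>)"
proof -
  have "\<exists>i. i \<le> k \<and> (\<forall>y\<in>standard_simplex q. pt p a b (\<tau> y) \<in> U i)"
    using assms by (simp add: sm_iff)
  then have "idx p a b q \<tau> \<le> k \<and> (\<forall>y\<in>standard_simplex q. pt p a b (\<tau> y) \<in> U (idx p a b q \<tau>))"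
    unfolding idx_def by (rule LeastI_ex)
  then show "idx p a b q \<tau> \<le> k" "\<And>y. y \<in> standard_simplex q \<Longrightarrow> pt p a b (\<tau> y) \<in> U (idx p a b q \<tau>)"
    by blast+
qed

lemma sm_simplex: "\<tau> \<in> sm p a b q \<Longrightarrow> y \<in> standard_simplex q \<Longrightarrow> \<tau> y \<in> standard_simplex p"
  by (simp add: sm_iff)

lemma singular_face_apply:
  "y \<in> standard_simplex q \<Longrightarrow> singular_face (Suc q) j \<tau> y = \<tau> (simplical_face j y)"
  by (simp add: singular_face_def)

lemma face_simplex: "\<lbrakk>j \<le> Suc q; y \<in> standard_simplex q\<rbrakk> \<Longrightarrow> simplical_face j y \<in> standard_simplex (Suc q)"
  by (rule simplical_face_in_standard_simplex) auto

lemma sm_face: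
  assumes "\<tau> \<in> sm p a b (Suc q)" "j \<le> Suc q"
  shows "singular_face (Suc q) j \<tau> \<in> sm p a b q"
proof -
  have "singular_simplex q (\<Delta> p) (singular_face (Suc q) j \<tau>)"
    using singular_simplex_singular_face [of "Suc q" "\<Delta> p" \<tau> j] assms by (simp add: sm_def)
  moreover have "singular_face (Suc q) j \<tau> ` standard_simplex q \<subseteq> \<tau> ` standard_simplex (Suc q)"
    using face_simplex [OF assms(2)] by (auto simp: singular_face_apply)
  ultimately show ?thesis using assms(1) unfolding sm_def by blast
qed

lemma flags:
  assumes a: "word p a" and b: "word p b"
  shows "flag_vertices (\<Delta> p) (sm p a b) (vv p a b) (carrier P)"
proof
  fix \<tau> q
  assume \<tau>: "\<tau> \<in> sm p a b q"
  then show "singular_simplex q (\<Delta> p) \<tau>" by (simp add: sm_def)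
  show "snd (vv p a b q \<tau>) \<in> carrier P"
    using label_closed [OF a b sm_simplex [OF \<tau>] idx_props(1) [OF \<tau>] idx_props(2) [OF \<tau>], of "vtx 0"]
    by (simp add: vv_def)
next
  fix \<tau> q j
  assume \<tau>: "\<tau> \<in> sm p a b (Suc q)" and j: "j \<le> Suc q"
  then show "singular_face (Suc q) j \<tau> \<in> sm p a b q" by (rule sm_face)
  let ?i = "idx p a b (Suc q) \<tau>" and ?\<sigma> = "singular_face (Suc q) j \<tau>"
  have "?i \<le> k \<and> (\<forall>y\<in>standard_simplex q. pt p a b (?\<sigma> y) \<in> U ?i)"
    using idx_props [OF \<tau>] face_simplex [OF j] by (simp add: singular_face_apply)
  then have le: "idx p a b q ?\<sigma> \<le> ?i" unfolding idx_def [of p a b q] by (rule Least_le)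
  have "vv p a b q ?\<sigma> = vv p a b (Suc q) \<tau>" if eq: "idx p a b q ?\<sigma> = ?i"
  proof -
    \<comment> \<open>Vertex 0 of the face \<open>j = 0\<close> is vertex 1 of the piece, so the two
      labels are read off at different points.\<close>
    have "label ?i p a b (\<tau> (simplical_face j (vtx 0))) = label ?i p a b (\<tau> (vtx 0))"
      by (rule label_constant [OF a b idx_props(1) [OF \<tau>], where q = "Suc q"])
        (use \<tau> idx_props(2) [OF \<tau>] face_simplex [OF j] in \<open>auto simp: sm_iff\<close>)
    then show ?thesis by (simp add: vv_def eq singular_face_apply)
  qed
  then show "fst (vv p a b q ?\<sigma>) < fst (vv p a b (Suc q) \<tau>) \<or> vv p a b q ?\<sigma> = vv p a b (Suc q) \<tau>"
    using le by (auto simp: vv_def le_less)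
qed

text \<open>The index depends only on the image in the product, and the label is independent of the
  chart by \<open>label_face\<close>. So a piece has the same vertex in a face as in the whole
  simplex.\<close>

lemma sm_push:
  assumes a: "word (Suc p) a" and b: "word (Suc p) b" and j: "j \<le> Suc p"
    and \<tau>: "\<tau> \<in> sm p (del j a) (del j b) q"
  shows "simplex_map q (simplical_face j) \<tau> \<in> sm (Suc p) a b q"
    "vv (Suc p) a b q (simplex_map q (simplical_face j) \<tau>) = vv p (del j a) (del j b) q \<tau>"
proof -
  let ?\<sigma> = "simplex_map q (simplical_face j) \<tau>"
  have \<sigma>: "?\<sigma> y = simplical_face j (\<tau> y)" if "y \<in> standard_simplex q" for y
    using that by (simp add: simplex_map_def)
  have pt: "pt (Suc p) a b (?\<sigma> y) = pt p (del j a) (del j b) (\<tau> y)" if "y \<in> standard_simplex q" for y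
    unfolding \<sigma> [OF that] by (rule pt_face [OF a b sm_simplex [OF \<tau> that] j])
  have "singular_simplex q (\<Delta> (Suc p)) ?\<sigma>"
    by (rule singular_simplex_simplex_map [OF _ continuous_map_face [OF j]]) (use \<tau> in \<open>simp add: sm_def\<close>)
  moreover have "\<exists>V\<in>cover (Suc p) a b. ?\<sigma> ` standard_simplex q \<subseteq> V"
  proof -
    let ?i = "idx p (del j a) (del j b) q \<tau>"
    have "?\<sigma> ` standard_simplex q \<subseteq> {z \<in> standard_simplex (Suc p). pt (Suc p) a b z \<in> U ?i}"
      using idx_props(2) [OF \<tau>] face_simplex [OF j sm_simplex [OF \<tau>]] pt \<sigma> by auto
    then show ?thesis unfolding cover_def using idx_props(1) [OF \<tau>] by blast
  qed
  ultimately show "?\<sigma> \<in> sm (Suc p) a b q" by (simp add: sm_def)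
  have "idx (Suc p) a b q ?\<sigma> = idx p (del j a) (del j b) q \<tau>"
    unfolding idx_def using pt by (simp cong: ball_cong)
  moreover have "label i (Suc p) a b (?\<sigma> (vtx 0)) = label i p (del j a) (del j b) (\<tau> (vtx 0))"
    if "i = idx p (del j a) (del j b) q \<tau>" for i
    using label_face [OF a b sm_simplex [OF \<tau>] j idx_props(1) [OF \<tau>] idx_props(2) [OF \<tau>], of "vtx 0"] that
    by (simp add: \<sigma>)
  ultimately show "vv (Suc p) a b q ?\<sigma> = vv p (del j a) (del j b) q \<tau>" by (simp add: vv_def)
qed

lemma push_small:
  assumes a: "word (Suc p) a" and b: "word (Suc p) b" and j: "j \<le> Suc p"
    and c: "Poly_Mapping.keys c \<subseteq> sm p (del j a) (del j b) q"
  shows "Poly_Mapping.keys (chain_map q (simplical_face j) c) \<subseteq> sm (Suc p) a b q"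
proof -
  have "Poly_Mapping.keys (chain_map q (simplical_face j) c) \<subseteq> simplex_map q (simplical_face j) ` Poly_Mapping.keys c"
    unfolding chain_map_def using keys_frag_extend [of "frag_of \<circ> simplex_map q (simplical_face j)" c] by auto
  then show ?thesis using sm_push(1) [OF a b j] c by blast
qed

lemma cover_open:
  assumes a: "word p a" and b: "word p b"
  shows "V \<in> cover p a b \<Longrightarrow> openin (\<Delta> p) V" "topspace (\<Delta> p) \<subseteq> \<Union> (cover p a b)"
proof -
  show "openin (\<Delta> p) V" if V: "V \<in> cover p a b"
  proof -
    obtain i where i: "i \<le> k" "V = {z \<in> standard_simplex p. pt p a b z \<in> U i}"
      using V by (auto simp: cover_def)
    then show ?thesis
      using openin_continuous_map_preimage [OF pt_continuous [OF a b] U_open [OF i(1)]] by simp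
  qed
  show "topspace (\<Delta> p) \<subseteq> \<Union> (cover p a b)"
  proof
    fix z assume z: "z \<in> topspace (\<Delta> p)"
    then have "pt p a b z \<in> topspace (prod_topology X X)"
      using continuous_map_image_subset_topspace [OF pt_continuous [OF a b]] by blast
    then obtain i where "i \<le> k" "pt p a b z \<in> U i" using U_cover by blast
    then show "z \<in> \<Union> (cover p a b)" using z by (auto simp: cover_def)
  qed
qed

definition theta_bd :: "nat \<Rightarrow> 'p list \<Rightarrow> 'p list \<Rightarrow> (nat \<Rightarrow> real) chain" where
  "theta_bd p a b = (\<Sum>j\<le>Suc p. frag_cmul ((-1) ^ j) (chain_map p (simplical_face j) (theta p (del j a) (del j b))))"

definition theta_good :: "nat \<Rightarrow> 'p list \<Rightarrow> 'p list \<Rightarrow> bool" where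
  "theta_good p a b \<longleftrightarrow> Poly_Mapping.keys (theta p a b) \<subseteq> sm p a b p \<and>
     (p = 0 \<longrightarrow> aug (theta p a b) = (frag_of [] :: (nat \<times> 'p) list \<Rightarrow>\<^sub>0 int)) \<and>
     (\<forall>q. p = Suc q \<longrightarrow> chain_boundary p (theta p a b) = theta_bd q a b)"

lemma theta_good_0:
  assumes "word 0 a" "word 0 b"
  shows "theta_good 0 a b"
proof -
  let ?\<iota> = "restrict id (standard_simplex 0) :: (nat \<Rightarrow> real) \<Rightarrow> nat \<Rightarrow> real"
  have v: "vtx 0 \<in> topspace (\<Delta> 0)" by simp
  then obtain V where "V \<in> cover 0 a b" "vtx 0 \<in> V" using cover_open(2) [OF assms] by blast
  then obtain i where i: "i \<le> k" "pt 0 a b (vtx 0) \<in> U i" by (auto simp: cover_def)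
  have "pt 0 a b (?\<iota> y) \<in> U i" if "y \<in> standard_simplex 0" for y
    using simplex_0 [OF that] i(2) by simp
  moreover have "continuous_on (standard_simplex 0) ?\<iota>"
    using continuous_on_cong [OF refl, of "standard_simplex 0" ?\<iota> id] by (simp add: continuous_on_id')
  ultimately have "?\<iota> \<in> sm 0 a b 0" unfolding sm_iff using i(1) by auto
  then show ?thesis by (simp add: theta_good_def aug_def)
qed

lemma chain_map_sum_cmul:
  "finite I \<Longrightarrow> chain_map q g (\<Sum>i\<in>I. frag_cmul (m i) (c i)) = (\<Sum>i\<in>I. frag_cmul (m i) (chain_map q g (c i)))"
  by (simp add: chain_map_sum comp_def)

lemma chain_boundary_sum_cmul:
  "chain_boundary q (\<Sum>i\<in>I. frag_cmul (m i) (c i)) = (\<Sum>i\<in>I. frag_cmul (m i) (chain_boundary q (c i)))"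
  by (simp add: chain_boundary_sum comp_def chain_boundary_cmul)

lemma keys_sum_cmul:
  assumes "\<And>i. i \<in> I \<Longrightarrow> Poly_Mapping.keys (c i) \<subseteq> S"
  shows "Poly_Mapping.keys (\<Sum>i\<in>I. frag_cmul (m i) (c i)) \<subseteq> S"
proof -
  have "Poly_Mapping.keys (\<Sum>i\<in>I. frag_cmul (m i) (c i)) \<subseteq> (\<Union>i\<in>I. Poly_Mapping.keys (frag_cmul (m i) (c i)))"
    by (rule keys_sum)
  then show ?thesis using assms keys_cmul by blast
qed

text \<open>The simplicial identities hold for \<open>simplical_face\<close> and for
  \<open>del\<close> simultaneously, so the double sum cancels in pairs.\<close>

lemma theta_bd_cycle:
  assumes a: "word (Suc (Suc p)) a" and b: "word (Suc (Suc p)) b"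
    and good: "\<And>j. j \<le> Suc (Suc p) \<Longrightarrow> theta_good (Suc p) (del j a) (del j b)"
  shows "chain_boundary (Suc p) (theta_bd (Suc p) a b) = 0"
proof -
  let ?c = "\<lambda>j i. chain_map p (simplical_face j \<circ> simplical_face i) (theta p (del i (del j a)) (del i (del j b)))"
  have "chain_boundary (Suc p) (chain_map (Suc p) (simplical_face j) (theta (Suc p) (del j a) (del j b)))
      = (\<Sum>i\<le>Suc p. frag_cmul ((-1) ^ i) (?c j i))" if j: "j \<le> Suc (Suc p)" for j
  proof -
    have keys: "Poly_Mapping.keys (theta (Suc p) (del j a) (del j b)) \<subseteq> sm (Suc p) (del j a) (del j b) (Suc p)"
      and bd: "chain_boundary (Suc p) (theta (Suc p) (del j a) (del j b)) = theta_bd p (del j a) (del j b)"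
      using good [OF j] by (simp_all add: theta_good_def del: theta.simps)
    have "singular_chain (Suc p) (\<Delta> (Suc p)) (theta (Suc p) (del j a) (del j b))"
      using keys by (auto simp: singular_chain_def sm_def simp del: theta.simps)
    then have "chain_boundary (Suc p) (chain_map (Suc p) (simplical_face j) (theta (Suc p) (del j a) (del j b)))
       = chain_map p (simplical_face j) (theta_bd p (del j a) (del j b))"
      using chain_boundary_chain_map [of "Suc p" "\<Delta> (Suc p)" "theta (Suc p) (del j a) (del j b)" "simplical_face j"] bd
      by (simp del: theta.simps)
    also have "\<dots> = (\<Sum>i\<le>Suc p. frag_cmul ((-1) ^ i)
        (chain_map p (simplical_face j) (chain_map p (simplical_face i) (theta p (del i (del j a)) (del i (del j b))))))"
      unfolding theta_bd_def by (rule chain_map_sum_cmul) simp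
    also have "\<dots> = (\<Sum>i\<le>Suc p. frag_cmul ((-1) ^ i) (?c j i))"
      by (simp only: chain_map_compose comp_apply)
    finally show ?thesis .
  qed
  then have "chain_boundary (Suc p) (theta_bd (Suc p) a b)
     = (\<Sum>j\<le>Suc (Suc p). frag_cmul ((-1) ^ j) (\<Sum>i\<le>Suc p. frag_cmul ((-1) ^ i) (?c j i)))"
    unfolding theta_bd_def chain_boundary_sum_cmul by (intro sum.cong refl) (simp only: atMost_iff)
  also have "\<dots> = (\<Sum>j\<le>Suc (Suc p). \<Sum>i\<le>Suc p. frag_cmul ((-1) ^ (j + i)) (?c j i))"
    by (simp only: frag_cmul_sum frag_cmul_cmul power_add)
  also have "\<dots> = 0"
  proof (rule frag_alternating_sum_zero)
    fix i j assume ij: "i < j" "j \<le> Suc (Suc p)"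
    have "del i (del j a) = del (j - 1) (del i a)" "del i (del j b) = del (j - 1) (del i b)"
      by (rule del_del; use ij a b in \<open>simp add: word_def\<close>)+
    then show "?c j i = ?c i (j - 1)" by (simp only: face_face [OF ij(1)])
  qed
  finally show ?thesis .
qed

lemma theta_bd_small:
  assumes a: "word (Suc p) a" and b: "word (Suc p) b"
    and good: "\<And>j. j \<le> Suc p \<Longrightarrow> theta_good p (del j a) (del j b)"
  shows "Poly_Mapping.keys (theta_bd p a b) \<subseteq> sm (Suc p) a b p"
  unfolding theta_bd_def
proof (rule keys_sum_cmul)
  fix j assume "j \<in> {..Suc p}"
  then have j: "j \<le> Suc p" by simp
  show "Poly_Mapping.keys (chain_map p (simplical_face j) (theta p (del j a) (del j b))) \<subseteq> sm (Suc p) a b p"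
    by (rule push_small [OF a b j]) (use good [OF j] in \<open>simp add: theta_good_def\<close>)
qed

lemma aug_chain_map: "aug (chain_map q g c) = aug c"
  unfolding aug_def chain_map_def by (induction c rule: frag_induct_all) (auto simp: frag_extend_diff)

text \<open>Acyclic models: the chains of the faces add up to a small cycle, and since the simplex
  is contractible, \<open>small_cycle_boundary\<close> bounds it by a small chain, which makes the
  choice in \<open>theta\<close> legitimate.\<close>

lemma theta_good: "\<lbrakk>word p a; word p b\<rbrakk> \<Longrightarrow> theta_good p a b"
proof (induction p arbitrary: a b)
  case 0
  then show ?case by (rule theta_good_0)
next
  case (Suc p)
  have good: "theta_good p (del j a) (del j b)" if "j \<le> Suc p" for j
    by (rule Suc.IH) (use that Suc.prems word_del in auto)
  have "small_chain (cover (Suc p) a b) p (\<Delta> (Suc p)) (theta_bd p a b)"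
    unfolding small_chain_sm by (rule theta_bd_small [OF Suc.prems good])
  moreover have "chain_boundary p (theta_bd p a b) = 0"
  proof (cases p)
    case 0
    then show ?thesis by (simp add: chain_boundary_def)
  next
    case (Suc p')
    show ?thesis unfolding Suc
      by (rule theta_bd_cycle) (use Suc.prems good Suc in auto)
  qed
  moreover have "aug (theta_bd p a b) = (0 :: (nat \<times> 'p) list \<Rightarrow>\<^sub>0 int)" if p: "p = 0"
  proof -
    have "aug (theta 0 (del j a) (del j b)) = (frag_of [] :: (nat \<times> 'p) list \<Rightarrow>\<^sub>0 int)" if "j \<le> Suc 0" for j
      using good [of j] p that by (simp add: theta_good_def)
    then have "aug (chain_map 0 (simplical_face j) (theta 0 (del j a) (del j b))) = (frag_of [] :: (nat \<times> 'p) list \<Rightarrow>\<^sub>0 int)"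
      if "j \<le> Suc 0" for j using that by (simp only: aug_chain_map)
    \<comment> \<open>The two endpoints of an edge have augmentation 1 and enter with opposite
      signs.\<close>
    from this [of 0] this [of 1] show ?thesis
      by (simp add: p theta_bd_def aug_def frag_extend_diff)
  qed
  ultimately have "\<exists>c. small_chain (cover (Suc p) a b) (Suc p) (\<Delta> (Suc p)) c \<and>
      chain_boundary (Suc p) c = theta_bd p a b"
    by (intro small_cycle_boundary [OF contractible_simplex cover_open [OF Suc.prems]])
  then have "small_chain (cover (Suc p) a b) (Suc p) (\<Delta> (Suc p)) (theta (Suc p) a b) \<and>
      chain_boundary (Suc p) (theta (Suc p) a b) = theta_bd p a b"
    unfolding theta.simps theta_bd_def by (rule someI_ex)
  then show ?case by (simp add: theta_good_def small_chain_sm del: theta.simps)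
qed

text \<open>The condition under the choice operator involves the words only through the cover and
  the chains of the faces, and both are invariant.\<close>

lemma theta_translate:
  "\<lbrakk>word p a; word p b; g \<in> carrier P; h \<in> carrier P\<rbrakk> \<Longrightarrow>
   theta p (map (\<lambda>x. g \<otimes>\<^bsub>P\<^esub> x) a) (map (\<lambda>x. h \<otimes>\<^bsub>P\<^esub> x) b) = theta p a b"
proof (induction p arbitrary: a b)
  case (Suc p)
  have "theta p (del j (map (\<lambda>x. g \<otimes>\<^bsub>P\<^esub> x) a)) (del j (map (\<lambda>x. h \<otimes>\<^bsub>P\<^esub> x) b)) = theta p (del j a) (del j b)"
    if "j \<le> Suc p" for j
    using Suc.IH [OF word_del [OF Suc.prems(1) that] word_del [OF Suc.prems(2) that] Suc.prems(3,4)]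
    by (simp only: map_del)
  then have "theta_bd p (map (\<lambda>x. g \<otimes>\<^bsub>P\<^esub> x) a) (map (\<lambda>x. h \<otimes>\<^bsub>P\<^esub> x) b) = theta_bd p a b"
    unfolding theta_bd_def by (intro sum.cong refl) (simp only: atMost_iff)
  moreover have "cover (Suc p) (map (\<lambda>x. g \<otimes>\<^bsub>P\<^esub> x) a) (map (\<lambda>x. h \<otimes>\<^bsub>P\<^esub> x) b) = cover (Suc p) a b"
    by (simp only: cover_def translate_pt [OF Suc.prems])
  ultimately show ?case by (simp only: theta.simps theta_bd_def)
qed simp

lemma vv_translate:
  assumes a: "word p a" and b: "word p b" and g: "g \<in> carrier P" and h: "h \<in> carrier P"
    and \<tau>: "\<tau> \<in> sm p a b q"
  shows "vv p (map (\<lambda>x. g \<otimes>\<^bsub>P\<^esub> x) a) (map (\<lambda>x. h \<otimes>\<^bsub>P\<^esub> x) b) q \<tau>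
    = map_prod id (two_sided_action P (g, h)) (vv p a b q \<tau>)"
proof -
  have "idx p (map (\<lambda>x. g \<otimes>\<^bsub>P\<^esub> x) a) (map (\<lambda>x. h \<otimes>\<^bsub>P\<^esub> x) b) q \<tau> = idx p a b q \<tau>"
    by (simp only: idx_def translate_pt [OF a b g h])
  moreover have "vtx 0 \<in> standard_simplex q" by simp
  ultimately show ?thesis
    using label_translate [OF a b sm_simplex [OF \<tau>] idx_props(1) [OF \<tau>] idx_props(2) [OF \<tau>] g h, of "vtx 0"]
    by (simp add: vv_def two_sided_action_def)
qed

text \<open>The copies in which the vertices of \<open>s\<close> lie are forgotten; the indices in
  the result are those of the sets \<open>U i\<close>.\<close>

definition psi :: "(nat \<times> 'p \<times> 'p) list \<Rightarrow> ((nat \<times> 'p) list \<Rightarrow>\<^sub>0 int)" where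
  "psi s = (if s = [] then frag_of [] else
     (let p = length s - 1; a = map (fst \<circ> snd) s; b = map (snd \<circ> snd) s
      in ev (vv p a b) p (theta p a b)))"

lemma psi_Suc:
  "length s = Suc p \<Longrightarrow> psi s = ev (vv p (map (fst \<circ> snd) s) (map (snd \<circ> snd) s)) p
     (theta p (map (fst \<circ> snd) s) (map (snd \<circ> snd) s))"
  by (cases s) (simp_all add: psi_def Let_def)

lemma simplex_words:
  assumes "s \<in> ordered_simplices (carrier (P \<times>\<times> P)) (Suc p)"
  shows "word p (map (fst \<circ> snd) s)" "word p (map (snd \<circ> snd) s)"
  using assms by (auto simp: ordered_simplices_def word_def carrier_DirProd mem_Times_iff image_subset_iff)

sublocale join_compression P k psi
proof
  show "psi [] = frag_of []" by (simp add: psi_def)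
next
  fix s m assume s: "s \<in> ordered_simplices (carrier (P \<times>\<times> P)) m"
  show "Poly_Mapping.keys (psi s) \<subseteq> {l \<in> ordered_simplices (carrier P) m. \<forall>x\<in>set l. fst x \<le> k}"
  proof (cases m)
    case 0
    then have "s = []" using s by (simp add: ordered_simplices_def)
    then show ?thesis by (simp add: psi_def ordered_simplices_def 0)
  next
    case (Suc p)
    let ?a = "map (fst \<circ> snd) s" and ?b = "map (snd \<circ> snd) s"
    have w: "word p ?a" "word p ?b" using simplex_words s Suc by auto
    interpret f: flag_vertices "\<Delta> p" "sm p ?a ?b" "vv p ?a ?b" "carrier P" by (rule flags [OF w])
    have "length s = Suc p" using s Suc by (simp add: ordered_simplices_def)
    moreover have "fst (vv p ?a ?b p \<tau>) \<le> k" if "\<tau> \<in> sm p ?a ?b p" for \<tau>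
      using idx_props(1) [OF that] by (simp add: vv_def)
    moreover have "Poly_Mapping.keys (theta p ?a ?b) \<subseteq> sm p ?a ?b p"
      using theta_good [OF w] by (simp add: theta_good_def)
    ultimately show ?thesis using f.ev_keys [of "theta p ?a ?b" p k] Suc by (simp only: psi_Suc)
  qed
next
  fix g s m
  assume g: "g \<in> carrier (P \<times>\<times> P)" and s: "s \<in> ordered_simplices (carrier (P \<times>\<times> P)) m"
  let ?gs = "map (map_prod id (\<lambda>x. g \<otimes>\<^bsub>P \<times>\<times> P\<^esub> x)) s"
  show "psi ?gs = join_map (two_sided_action P g) (psi s)"
  proof (cases m)
    case 0
    then have "s = []" using s by (simp add: ordered_simplices_def)
    then show ?thesis by (simp add: psi_def)
  next
    case (Suc p)
    let ?a = "map (fst \<circ> snd) s" and ?b = "map (snd \<circ> snd) s"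
    obtain g1 g2 where gg: "g = (g1, g2)" "g1 \<in> carrier P" "g2 \<in> carrier P"
      using g by (cases g) (auto simp: carrier_DirProd)
    have w: "word p ?a" "word p ?b" using simplex_words s Suc by auto
    interpret f: flag_vertices "\<Delta> p" "sm p ?a ?b" "vv p ?a ?b" "carrier P" by (rule flags [OF w])
    have len: "length s = Suc p" using s Suc by (simp add: ordered_simplices_def)
    have ga: "map (fst \<circ> snd) ?gs = map (\<lambda>x. g1 \<otimes>\<^bsub>P\<^esub> x) ?a" "map (snd \<circ> snd) ?gs = map (\<lambda>x. g2 \<otimes>\<^bsub>P\<^esub> x) ?b"
      by (auto simp: gg(1) DirProd_def split_beta)
    have k: "Poly_Mapping.keys (theta p ?a ?b) \<subseteq> sm p ?a ?b p"
      using theta_good [OF w] by (simp add: theta_good_def)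
    \<comment> \<open>Translation does not move the pieces, only their labels, so naturality is
      applied with the identity on simplices.\<close>
    then have "chain_map p id (theta p ?a ?b) = theta p ?a ?b"
      by (intro chain_map_ident [of p "\<Delta> p"]) (auto simp: singular_chain_def sm_def)
    moreover have "ev (vv p (map (\<lambda>x. g1 \<otimes>\<^bsub>P\<^esub> x) ?a) (map (\<lambda>x. g2 \<otimes>\<^bsub>P\<^esub> x) ?b)) p (chain_map p id (theta p ?a ?b))
      = join_map (two_sided_action P (g1, g2)) (ev (vv p ?a ?b) p (theta p ?a ?b))"
    proof (rule f.ev_chain_map [OF k])
      fix q \<tau> assume \<tau>: "\<tau> \<in> sm p ?a ?b q"
      then have "simplex_map q id \<tau> = \<tau>"
        by (simp add: sm_iff extensional_restrict)
      then show "vv p (map (\<lambda>x. g1 \<otimes>\<^bsub>P\<^esub> x) ?a) (map (\<lambda>x. g2 \<otimes>\<^bsub>P\<^esub> x) ?b) q (simplex_map q id \<tau>)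
        = map_prod id (two_sided_action P (g1, g2)) (vv p ?a ?b q \<tau>)"
        using vv_translate [OF w gg(2,3) \<tau>] by simp
    qed
    ultimately have "ev (vv p (map (\<lambda>x. g1 \<otimes>\<^bsub>P\<^esub> x) ?a) (map (\<lambda>x. g2 \<otimes>\<^bsub>P\<^esub> x) ?b)) p (theta p ?a ?b)
      = join_map (two_sided_action P g) (psi s)"
      by (simp only: psi_Suc [OF len] gg(1))
    moreover have "length ?gs = Suc p" using len by simp
    ultimately show ?thesis
      by (simp only: psi_Suc ga theta_translate [OF w gg(2,3)])
  qed
next
  fix s m assume s: "s \<in> ordered_simplices (carrier (P \<times>\<times> P)) m"
  let ?a = "map (fst \<circ> snd) s" and ?b = "map (snd \<circ> snd) s"
  have len: "length s = m" using s by (simp add: ordered_simplices_def)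
  \<comment> \<open>A single vertex is separate: its boundary is the empty simplex, and the
    augmentation of \<open>theta\<close> takes the place of its boundary.\<close>
  consider "m = 0" | "m = Suc 0" | p where "m = Suc (Suc p)" by (metis not0_implies_Suc)
  then show "bd (psi s) = frag_extend psi (bd (frag_of s))"
  proof cases
    case 1
    then show ?thesis using len by (simp add: psi_def)
  next
    case 2
    have w: "word 0 ?a" "word 0 ?b" using simplex_words s 2 by auto
    interpret f: flag_vertices "\<Delta> 0" "sm 0 ?a ?b" "vv 0 ?a ?b" "carrier P" by (rule flags [OF w])
    have "bd (psi s) = aug (theta 0 ?a ?b)"
      using f.bd_ev_0 [of "theta 0 ?a ?b"] psi_Suc [of s 0] len 2 by (simp del: ev.simps theta.simps)
    also have "\<dots> = frag_of []" using theta_good [OF w] by (simp add: theta_good_def)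
    finally show ?thesis using len 2 by (simp add: bd_of psi_def)
  next
    case (3 p)
    have w: "word (Suc p) ?a" "word (Suc p) ?b" using simplex_words s 3 by auto
    interpret f: flag_vertices "\<Delta> (Suc p)" "sm (Suc p) ?a ?b" "vv (Suc p) ?a ?b" "carrier P" by (rule flags [OF w])
    have l: "length s = Suc (Suc p)" using len 3 by simp
    have tg: "Poly_Mapping.keys (theta (Suc p) ?a ?b) \<subseteq> sm (Suc p) ?a ?b (Suc p)"
      "chain_boundary (Suc p) (theta (Suc p) ?a ?b) = theta_bd p ?a ?b"
      using theta_good [OF w] by (simp_all add: theta_good_def del: theta.simps)
    have "bd (psi s) = ev (vv (Suc p) ?a ?b) p (theta_bd p ?a ?b)"
      by (simp only: psi_Suc [OF l] f.bd_ev [OF tg(1)] tg(2))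
    also have "\<dots> = (\<Sum>j\<le>Suc p. frag_cmul ((-1) ^ j)
        (ev (vv (Suc p) ?a ?b) p (chain_map p (simplical_face j) (theta p (del j ?a) (del j ?b)))))"
      by (simp only: theta_bd_def ev_sum finite_atMost ev_cmul)
    also have "\<dots> = (\<Sum>j\<le>Suc p. frag_cmul ((-1) ^ j) (psi (del j s)))"
    proof (rule sum.cong [OF refl])
      fix j assume "j \<in> {..Suc p}"
      then have j: "j \<le> Suc p" by simp
      have wj: "word p (del j ?a)" "word p (del j ?b)" using word_del w j by auto
      interpret g: flag_vertices "\<Delta> p" "sm p (del j ?a) (del j ?b)" "vv p (del j ?a) (del j ?b)" "carrier P"
        by (rule flags [OF wj])
      have k: "Poly_Mapping.keys (theta p (del j ?a) (del j ?b)) \<subseteq> sm p (del j ?a) (del j ?b) p"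
        using theta_good [OF wj] by (simp add: theta_good_def)
      \<comment> \<open>By \<open>sm_push\<close> the inclusion of a face leaves all vertices
        unchanged, so naturality applies with the identity on labels.\<close>
      have "ev (vv (Suc p) ?a ?b) p (chain_map p (simplical_face j) (theta p (del j ?a) (del j ?b)))
        = join_map id (ev (vv p (del j ?a) (del j ?b)) p (theta p (del j ?a) (del j ?b)))"
        by (rule g.ev_chain_map [OF k]) (simp add: sm_push(2) [OF w j] prod.map_id0)
      also have "\<dots> = ev (vv p (del j ?a) (del j ?b)) p (theta p (del j ?a) (del j ?b))"
        by (simp add: join_map_def prod.map_id0 flip: frag_expansion)
      also have "\<dots> = psi (del j s)"
      proof -
        have "length (del j s) = Suc p" using l j by simp
        then show ?thesis by (simp only: psi_Suc map_del)
      qed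
      finally show "frag_cmul ((-1) ^ j) (ev (vv (Suc p) ?a ?b) p (chain_map p (simplical_face j) (theta p (del j ?a) (del j ?b))))
        = frag_cmul ((-1) ^ j) (psi (del j s))" by simp
    qed
    also have "\<dots> = frag_extend psi (bd (frag_of s))"
    proof -
      have "{..Suc p} = {..<length s}" using l by auto
      then show ?thesis
        by (simp only: bd_of frag_extend_sum finite_lessThan comp_def frag_extend_cmul frag_extend_of del_def)
    qed
    finally show ?thesis .
  qed
qed

end

section \<open>The lower bound\<close>

theorem theorem4p1:
  fixes X :: "'a topology" and x0 :: 'a and P :: "'p monoid"
    and M :: "('p \<times> 'p, 'm) orbit_functor" and n :: nat
    and \<alpha> :: "(('p \<times> 'p) set \<Rightarrow> ((nat \<times> 'p) list \<Rightarrow>\<^sub>0 int) \<Rightarrow> 'm) set"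
  assumes "finite_cell_complex X" and "aspherical X" and "x0 \<in> topspace X"
    and "group P" and "P \<cong> homotopy_group 1 X x0"
    and "orbit_module (P \<times>\<times> P) (diagonal_family P) M"
    and "\<alpha> \<in> carrier (bredon_HD P M n)"
    and "Phi P M n \<alpha> \<noteq> \<one>\<^bsub>principal_cohomology P M n\<^esub>"
  shows "TC X \<ge> enat n"
proof (rule ccontr)
  assume "\<not> TC X \<ge> enat n"
  then obtain k U where "k < n"
    and U: "\<forall>i\<le>k. openin (prod_topology X X) (U i) \<and> has_path_section X (U i)"
    and cover: "(\<Union>i\<le>k. U i) = topspace (prod_topology X X)"
    by (auto simp: TC_def not_le Inf_less_iff)
  have "\<forall>i. \<exists>s. i \<le> k \<longrightarrow> continuous_map (subtopology (prod_topology X X) (U i)) (path_space X) s \<and>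
      (\<forall>z\<in>U i. s z 0 = fst z \<and> s z 1 = snd z)"
  proof (intro allI)
    fix i
    show "\<exists>s. i \<le> k \<longrightarrow> continuous_map (subtopology (prod_topology X X) (U i)) (path_space X) s \<and>
      (\<forall>z\<in>U i. s z 0 = fst z \<and> s z 1 = snd z)"
    proof (cases "i \<le> k")
      case True
      then obtain s where "continuous_map (subtopology (prod_topology X X) (U i)) (path_space X) s"
        "\<forall>(x, y) \<in> U i. s (x, y) 0 = x \<and> s (x, y) 1 = y"
        using U unfolding has_path_section_def by blast
      then show ?thesis by (intro exI [of _ s]) auto
    qed simp
  qed
  then obtain sec where sec: "\<And>i. i \<le> k \<Longrightarrow> continuous_map (subtopology (prod_topology X X) (U i)) (path_space X) (sec i) \<and>
      (\<forall>z\<in>U i. sec i z 0 = fst z \<and> sec i z 1 = snd z)"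
    unfolding choice_iff by blast
  have "\<exists>lp. (\<forall>a \<in> carrier P. loop X x0 (lp a)) \<and>
    (\<forall>p. loop X x0 p \<longrightarrow> (\<exists>a \<in> carrier P. Sq X p (lp a) (\<lambda>_. x0) (\<lambda>_. x0))) \<and>
    (\<forall>a \<in> carrier P. \<forall>b \<in> carrier P. \<forall>c \<in> carrier P. \<forall>d \<in> carrier P.
       Sq X (lp a) (lp b) (lp c) (lp d) \<longleftrightarrow> c \<otimes>\<^bsub>P\<^esub> b = a \<otimes>\<^bsub>P\<^esub> d) \<and>
    Sq X (lp \<one>\<^bsub>P\<^esub>) (\<lambda>_. x0) (\<lambda>_. x0) (\<lambda>_. x0)"
  proof (rule fundamental_group_labels [OF assms(4,5,3)])
    fix lp
    assume "\<And>a. a \<in> carrier P \<Longrightarrow> loop X x0 (lp a)"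
      "\<And>p. loop X x0 p \<Longrightarrow> \<exists>a \<in> carrier P. Sq X p (lp a) (\<lambda>_. x0) (\<lambda>_. x0)"
      "\<And>a b c d. \<lbrakk>a \<in> carrier P; b \<in> carrier P; c \<in> carrier P; d \<in> carrier P\<rbrakk> \<Longrightarrow>
         Sq X (lp a) (lp b) (lp c) (lp d) \<longleftrightarrow> c \<otimes>\<^bsub>P\<^esub> b = a \<otimes>\<^bsub>P\<^esub> d"
      "Sq X (lp \<one>\<^bsub>P\<^esub>) (\<lambda>_. x0) (\<lambda>_. x0) (\<lambda>_. x0)"
    then show ?thesis by (intro exI [of _ lp] conjI ballI allI impI)
  qed
  then obtain lp where lp: "\<forall>a \<in> carrier P. loop X x0 (lp a)"
    "\<forall>p. loop X x0 p \<longrightarrow> (\<exists>a \<in> carrier P. Sq X p (lp a) (\<lambda>_. x0) (\<lambda>_. x0))"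
    "\<forall>a \<in> carrier P. \<forall>b \<in> carrier P. \<forall>c \<in> carrier P. \<forall>d \<in> carrier P.
       Sq X (lp a) (lp b) (lp c) (lp d) \<longleftrightarrow> c \<otimes>\<^bsub>P\<^esub> b = a \<otimes>\<^bsub>P\<^esub> d"
    "Sq X (lp \<one>\<^bsub>P\<^esub>) (\<lambda>_. x0) (\<lambda>_. x0) (\<lambda>_. x0)"
    by (elim exE conjE)
  interpret motion_planner X x0 P lp k U sec
  proof (intro motion_planner.intro aspherical_space.intro motion_planner_axioms.intro)
    show "group P" "x0 \<in> topspace X" by (fact assms)+
    fix q and g :: "(nat \<Rightarrow> real) \<Rightarrow> 'a"
    assume q: "2 \<le> q" and g: "continuous_map (top_of_set (bdcub (Suc q))) X g" "g (\<lambda>_. 0) = x0"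
    \<comment> \<open>The range \<open>2 \<le> q\<close> in \<open>fill\<close> is exactly the range
      of degrees in which \<open>aspherical\<close> gives vanishing.\<close>
    have triv: "trivial_group (homotopy_group q X x0)"
      using assms(2,3) q by (simp add: aspherical_def)
    show "\<exists>h. continuous_map (top_of_set (cub (Suc q))) X h \<and> (\<forall>x\<in>bdcub (Suc q). h x = g x)"
    proof (rule cube_fill [OF triv assms(3) g])
      fix h
      assume "continuous_map (top_of_set (cub (Suc q))) X h" "\<And>x. x \<in> bdcub (Suc q) \<Longrightarrow> h x = g x"
      then show ?thesis by blast
    qed
  next
    show "loop X x0 (lp a)" if "a \<in> carrier P" for a using lp(1) that by (rule bspec)
    show "\<exists>a \<in> carrier P. Sq X p (lp a) (\<lambda>_. x0) (\<lambda>_. x0)" if "loop X x0 p" for p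
      using lp(2) that by blast
    show "Sq X (lp a) (lp b) (lp c) (lp d) \<longleftrightarrow> c \<otimes>\<^bsub>P\<^esub> b = a \<otimes>\<^bsub>P\<^esub> d"
      if "a \<in> carrier P" "b \<in> carrier P" "c \<in> carrier P" "d \<in> carrier P" for a b c d
      by (rule lp(3) [rule_format, OF that])
    show "Sq X (lp \<one>\<^bsub>P\<^esub>) (\<lambda>_. x0) (\<lambda>_. x0) (\<lambda>_. x0)" by (rule lp(4))
    show "openin (prod_topology X X) (U i)" if "i \<le> k" for i using U that by blast
    show "continuous_map (subtopology (prod_topology X X) (U i)) (path_space X) (sec i)" if "i \<le> k" for i
      using sec [OF that] by (rule conjunct1)
    show "sec i z 0 = fst z \<and> sec i z 1 = snd z" if "i \<le> k" "z \<in> U i" for i z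
      using sec [OF that(1)] that(2) by blast
    show "(\<Union>i\<le>k. U i) = topspace (prod_topology X X)" by (rule cover)
  qed
  interpret B: bredon_setup P M by unfold_locales (use assms(4,6) in auto)
  \<comment> \<open>\<open>k < n\<close> excludes degree 0, where coboundaries have a different
    form.\<close>
  obtain m where n: "n = Suc m" using \<open>k < n\<close> by (cases n) auto
  have "Phi P M (Suc m) \<alpha> = \<one>\<^bsub>principal_cohomology P M (Suc m)\<^esub>"
  proof (rule B.Phi_eq_one)
    show "\<alpha> \<in> carrier (bredon_HD P M (Suc m))" using assms(7) n by simp
    show "Phi_cochain P (Suc m) \<phi>
        \<in> coboundaries (principal_cochains P M) (group_coboundary (P \<times>\<times> P)) (Suc m)"
      if "principal_cocycle P M (Suc m) (\<phi> {\<one>\<^bsub>P \<times>\<times> P\<^esub>})" for \<phi>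
      by (rule Phi_cochain_coboundary [where \<phi> = \<phi>, OF that _ B.A.comm_group_axioms])
        (use \<open>k < n\<close> n in simp)
  qed
  then show False using assms(8) n by simp
qed

end
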